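(* Let $\mathcal{M}_1$ be a model of $\phi$ of cardinality $\aleph_1$. Then for every linear ordering $(L,<)$ with $|L|=\kappa\ge\aleph_1$ there is a model $\mathcal{G}^*$ of $\phi_{\mathcal{F}}$ of cardinality $\kappa$ with $M(\mathcal{G}^* )=\mathcal{M}_1$, and a one-to-one function $F:L\to V(\mathcal{G}^* )$ such that $x<y$ iff $F(x)\triangleleft F(y)$ for all $x,y\in L$, and $F(x)$ is $0$-colored for every $x\in L$.
   Context: Fix a countable structure $\mathcal{M}$ in a countable language $\mathcal{L}_0$ containing a binary relation symbol $<$ interpreted as a linear order on $\mathcal{M}$, whose Scott sentence $\phi$ has a model of cardinality $\aleph_1$ but none of cardinality $\aleph_2$. Let $\mathcal{L}$ extend $\mathcal{L}_0$ by unary predicates $V,M,N$, a binary relation $\triangleleft$ and a binary function symbol $f$. $K(\mathcal{M})$ is the class of countable $\mathcal{L}$-structures $\mathcal{A}$ such that: (1) $V(\mathcal{A}),M(\mathcal{A})$ partition the universe, $V(\mathcal{A})$ is finite and $M(\mathcal{A})$ (with its $\mathcal{L}_0$-structure) is $\mathcal{M}$; (2) $\triangleleft$ is a linear order on $V(\mathcal{A})$; (3) for $x\ne y$ in $V(\mathcal{A})$, $f(x,y)=f(y,x)\in M(\mathcal{A})$; (4) if $x\triangleleft y\triangleleft z$ are distinct elements of $V(\mathcal{A})$, then either $f(x,y)=f(x,z)=f(y,z)$, or $f(x,y)=f(x,z)<f(y,z)$, or $f(x,z)=f(y,z)<f(x,y)$; (5) $N(x)$ implies $x\in V(\mathcal{A})$.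 An element $x\in V$ is $1$-colored if $N(x)$ holds and $0$-colored otherwise. A finitely generated$/\mathcal{M}$ substructure of a structure containing $\mathcal{M}$ is one of the form $\langle A_0\rangle\cup\mathcal{M}$, $A_0$ finite. $\mathcal{F}$ is the Fraïssé limit of $K(\mathcal{M})$: the (unique up to isomorphism) countable $\mathcal{L}$-structure containing $\mathcal{M}$ whose finitely generated$/\mathcal{M}$ substructures are, up to isomorphism, exactly the members of $K(\mathcal{M})$ and in which every isomorphism between finitely generated$/\mathcal{M}$ substructures extends to an automorphism; $\phi_{\mathcal{F}}$ is its Scott sentence. *)

theory Defs
  imports Main "HOL-Library.Countable_Set"
begin

unbundle cardinal_syntax

section \<open>Languages, structures, isomorphisms\<close>

record ('f, 'r) lang =
  Funs :: "'f set"
  Rels :: "'r set"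
  farity :: "'f \<Rightarrow> nat"
  rarity :: "'r \<Rightarrow> nat"

definition countable_lang :: "('f, 'r) lang \<Rightarrow> bool" where
  "countable_lang L \<longleftrightarrow> countable (Funs L) \<and> countable (Rels L)"

record ('a, 'f, 'r) struct =
  univ :: "'a set"
  funI :: "'f \<Rightarrow> 'a list \<Rightarrow> 'a"
  relI :: "'r \<Rightarrow> 'a list \<Rightarrow> bool"

definition closed_under :: "('f, 'r) lang \<Rightarrow> ('a, 'f, 'r) struct \<Rightarrow> 'a set \<Rightarrow> bool" where
  "closed_under L A X \<longleftrightarrow>
     (\<forall>g\<in>Funs L. \<forall>xs. length xs = farity L g \<and> set xs \<subseteq> X \<longrightarrow> funI A g xs \<in> X)"

definition is_struct :: "('f, 'r) lang \<Rightarrow> ('a, 'f, 'r) struct \<Rightarrow> bool" where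
  "is_struct L A \<longleftrightarrow> univ A \<noteq> {} \<and> closed_under L A (univ A)"

definition is_iso ::
  "('f, 'r) lang \<Rightarrow> ('a \<Rightarrow> 'b) \<Rightarrow> ('a, 'f, 'r) struct \<Rightarrow> ('b, 'f, 'r) struct \<Rightarrow> bool" where
  "is_iso L h A B \<longleftrightarrow>
     is_struct L A \<and> is_struct L B \<and> bij_betw h (univ A) (univ B) \<and>
     (\<forall>g\<in>Funs L. \<forall>xs. length xs = farity L g \<and> set xs \<subseteq> univ A \<longrightarrow>
        h (funI A g xs) = funI B g (map h xs)) \<and>
     (\<forall>r\<in>Rels L. \<forall>xs. length xs = rarity L r \<and> set xs \<subseteq> univ A \<longrightarrow>
        (relI A r xs \<longleftrightarrow> relI B r (map h xs)))"

definition isomorphic ::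
  "('f, 'r) lang \<Rightarrow> ('a, 'f, 'r) struct \<Rightarrow> ('b, 'f, 'r) struct \<Rightarrow> bool" where
  "isomorphic L A B \<longleftrightarrow> (\<exists>h. is_iso L h A B)"

definition restrict_to :: "('a, 'f, 'r) struct \<Rightarrow> 'a set \<Rightarrow> ('a, 'f, 'r) struct" where
  "restrict_to A X = A\<lparr>univ := X\<rparr>"

definition generated :: "('f, 'r) lang \<Rightarrow> ('a, 'f, 'r) struct \<Rightarrow> 'a set \<Rightarrow> 'a set" where
  "generated L A X = \<Inter>{Y. X \<subseteq> Y \<and> Y \<subseteq> univ A \<and> closed_under L A Y}"

section \<open>The logic with countable conjunctions, and Scott sentences\<close>

datatype 'f tm = Var nat | Fn 'f "'f tm list"

datatype ('f, 'r) fm =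
    Eq "'f tm" "'f tm"
  | Rel 'r "'f tm list"
  | Neg "('f, 'r) fm"
  | Conj "nat \<Rightarrow> ('f, 'r) fm"
  | Exists nat "('f, 'r) fm"

fun wf_tm :: "('f, 'r) lang \<Rightarrow> 'f tm \<Rightarrow> bool" where
  "wf_tm L (Var n) \<longleftrightarrow> True"
| "wf_tm L (Fn g ts) \<longleftrightarrow> g \<in> Funs L \<and> length ts = farity L g \<and> (\<forall>t\<in>set ts. wf_tm L t)"

fun fv_tm :: "'f tm \<Rightarrow> nat set" where
  "fv_tm (Var n) = {n}"
| "fv_tm (Fn g ts) = (\<Union>t\<in>set ts. fv_tm t)"

fun eval_tm :: "('a, 'f, 'r) struct \<Rightarrow> (nat \<Rightarrow> 'a) \<Rightarrow> 'f tm \<Rightarrow> 'a" where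
  "eval_tm A e (Var n) = e n"
| "eval_tm A e (Fn g ts) = funI A g (map (eval_tm A e) ts)"

primrec wf_fm :: "('f, 'r) lang \<Rightarrow> ('f, 'r) fm \<Rightarrow> bool" where
  "wf_fm L (Eq s t) \<longleftrightarrow> wf_tm L s \<and> wf_tm L t"
| "wf_fm L (Rel r ts) \<longleftrightarrow> r \<in> Rels L \<and> length ts = rarity L r \<and> (\<forall>t\<in>set ts. wf_tm L t)"
| "wf_fm L (Neg p) \<longleftrightarrow> wf_fm L p"
| "wf_fm L (Conj P) \<longleftrightarrow> (\<forall>n. wf_fm L (P n))"
| "wf_fm L (Exists n p) \<longleftrightarrow> wf_fm L p"

primrec fv_fm :: "('f, 'r) fm \<Rightarrow> nat set" where
  "fv_fm (Eq s t) = fv_tm s \<union> fv_tm t"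
| "fv_fm (Rel r ts) = (\<Union>t\<in>set ts. fv_tm t)"
| "fv_fm (Neg p) = fv_fm p"
| "fv_fm (Conj P) = (\<Union>n. fv_fm (P n))"
| "fv_fm (Exists n p) = fv_fm p - {n}"

primrec sat :: "('a, 'f, 'r) struct \<Rightarrow> (nat \<Rightarrow> 'a) \<Rightarrow> ('f, 'r) fm \<Rightarrow> bool" where
  "sat A e (Eq s t) \<longleftrightarrow> eval_tm A e s = eval_tm A e t"
| "sat A e (Rel r ts) \<longleftrightarrow> relI A r (map (eval_tm A e) ts)"
| "sat A e (Neg p) \<longleftrightarrow> \<not> sat A e p"
| "sat A e (Conj P) \<longleftrightarrow> (\<forall>n. sat A e (P n))"
| "sat A e (Exists n p) \<longleftrightarrow> (\<exists>a\<in>univ A. sat A (e(n := a)) p)"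

text \<open>A subformula of a sentence lies in the scope of finitely many quantifiers, so it
  automatically has only finitely many free variables, as usual for this logic.\<close>

definition sentence :: "('f, 'r) lang \<Rightarrow> ('f, 'r) fm \<Rightarrow> bool" where
  "sentence L p \<longleftrightarrow> wf_fm L p \<and> fv_fm p = {}"

definition is_model :: "('f, 'r) lang \<Rightarrow> ('a, 'f, 'r) struct \<Rightarrow> ('f, 'r) fm \<Rightarrow> bool" where
  "is_model L A p \<longleftrightarrow> is_struct L A \<and> (\<forall>e. range e \<subseteq> univ A \<longrightarrow> sat A e p)"

text \<open>The countable models of a Scott sentence are exactly the isomorphic copies of \<open>A\<close>.
  Every countable structure has a copy with universe a subset of \<open>nat\<close>.\<close>

definition scott_sentence ::
  "('f, 'r) lang \<Rightarrow> ('a, 'f, 'r) struct \<Rightarrow> ('f, 'r) fm \<Rightarrow> bool" where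
  "scott_sentence L A p \<longleftrightarrow>
     sentence L p \<and>
     (\<forall>B :: (nat, 'f, 'r) struct. is_struct L B \<longrightarrow> (is_model L B p \<longleftrightarrow> isomorphic L B A))"

section \<open>Cardinals and linear orders\<close>

text \<open>The fields of these well-orders have cardinality \<open>\<aleph>\<^sub>1\<close> and \<open>\<aleph>\<^sub>2\<close>, so every structure of that
  cardinality has a copy over the type \<open>nat set\<close> or \<open>nat set set\<close>, respectively.\<close>

abbreviation aleph1 :: "nat set rel" where
  "aleph1 \<equiv> cardSuc natLeq"

abbreviation aleph2 :: "nat set set rel" where
  "aleph2 \<equiv> cardSuc aleph1"

definition strict_linorder_on :: "'a set \<Rightarrow> ('a \<Rightarrow> 'a \<Rightarrow> bool) \<Rightarrow> bool" where
  "strict_linorder_on X R \<longleftrightarrow> irreflp_on X R \<and> transp_on X R \<and> totalp_on X R"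

section \<open>The expanded language and the class of finite extensions\<close>

datatype 'f ext_fun = OldF 'f | F_sym
datatype 'r ext_rel = OldR 'r | V_sym | M_sym | N_sym | Tri_sym

definition ext_lang :: "('f, 'r) lang \<Rightarrow> ('f ext_fun, 'r ext_rel) lang" where
  "ext_lang L0 =
    \<lparr>Funs = insert F_sym (OldF ` Funs L0),
     Rels = {V_sym, M_sym, N_sym, Tri_sym} \<union> OldR ` Rels L0,
     farity = (\<lambda>g. case g of OldF g' \<Rightarrow> farity L0 g' | F_sym \<Rightarrow> 2),
     rarity = (\<lambda>r. case r of OldR r' \<Rightarrow> rarity L0 r' | V_sym \<Rightarrow> 1 | M_sym \<Rightarrow> 1 | N_sym \<Rightarrow> 1
                             | Tri_sym \<Rightarrow> 2)\<rparr>"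

type_synonym ('a, 'f, 'r) ext_struct = "('a, 'f ext_fun, 'r ext_rel) struct"

definition V_part :: "('a, 'f, 'r) ext_struct \<Rightarrow> 'a set" where
  "V_part A = {x \<in> univ A. relI A V_sym [x]}"

definition M_part :: "('a, 'f, 'r) ext_struct \<Rightarrow> 'a set" where
  "M_part A = {x \<in> univ A. relI A M_sym [x]}"

definition M_struct :: "('a, 'f, 'r) ext_struct \<Rightarrow> ('a, 'f, 'r) struct" where
  "M_struct A =
     \<lparr>univ = M_part A, funI = (\<lambda>g. funI A (OldF g)), relI = (\<lambda>r. relI A (OldR r))\<rparr>"

abbreviation tri :: "('a, 'f, 'r) ext_struct \<Rightarrow> 'a \<Rightarrow> 'a \<Rightarrow> bool" where
  "tri A x y \<equiv> relI A Tri_sym [x, y]"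

abbreviation fI :: "('a, 'f, 'r) ext_struct \<Rightarrow> 'a \<Rightarrow> 'a \<Rightarrow> 'a" where
  "fI A x y \<equiv> funI A F_sym [x, y]"

definition zero_colored :: "('a, 'f, 'r) ext_struct \<Rightarrow> 'a \<Rightarrow> bool" where
  "zero_colored A x \<longleftrightarrow> x \<in> V_part A \<and> \<not> relI A N_sym [x]"

text \<open>Structures containing \<open>M\<close> live on a sum type whose left summand is the type of \<open>M\<close>, so
  that there is always room for the elements of the \<open>V\<close>-part.  Thus ``the \<open>M\<close>-part of \<open>A\<close>
  is \<open>M\<close>'' says that it is the copy of \<open>M\<close> under \<open>Inl\<close>.\<close>

definition M_part_is ::
  "('f, 'r) lang \<Rightarrow> ('m + 'v, 'f, 'r) ext_struct \<Rightarrow> ('m, 'f, 'r) struct \<Rightarrow> bool" where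
  "M_part_is L0 A M \<longleftrightarrow> is_iso L0 Inl M (M_struct A)"

text \<open>The symbols of the base language are meaningful only on the \<open>M\<close>-part, \<open>\<triangleleft>\<close> only on the
  \<open>V\<close>-part, and \<open>f\<close> only at pairs of distinct elements of the \<open>V\<close>-part.  Elsewhere relations are
  false and functions return their first argument, so that they carry no information and
  generate no elements.\<close>

definition trivial_elsewhere :: "('f, 'r) lang \<Rightarrow> ('a, 'f, 'r) ext_struct \<Rightarrow> bool" where
  "trivial_elsewhere L0 A \<longleftrightarrow>
     (\<forall>r\<in>Rels L0. \<forall>xs. length xs = rarity L0 r \<and> set xs \<subseteq> univ A \<and> relI A (OldR r) xs \<longrightarrow>
        set xs \<subseteq> M_part A) \<and>
     (\<forall>g\<in>Funs L0. \<forall>xs. length xs = farity L0 g \<and> set xs \<subseteq> univ A \<and> \<not> set xs \<subseteq> M_part A \<longrightarrow>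
        funI A (OldF g) xs = hd xs) \<and>
     (\<forall>x\<in>univ A. \<forall>y\<in>univ A. tri A x y \<longrightarrow> x \<in> V_part A \<and> y \<in> V_part A) \<and>
     (\<forall>x\<in>univ A. \<forall>y\<in>univ A. \<not> (x \<in> V_part A \<and> y \<in> V_part A \<and> x \<noteq> y) \<longrightarrow> fI A x y = x)"

definition K_class ::
  "('f, 'r) lang \<Rightarrow> 'r \<Rightarrow> ('m, 'f, 'r) struct \<Rightarrow> ('m + 'v, 'f, 'r) ext_struct \<Rightarrow> bool" where
  "K_class L0 lt M A \<longleftrightarrow>
     is_struct (ext_lang L0) A \<and> countable (univ A) \<and>
     V_part A \<union> M_part A = univ A \<and> V_part A \<inter> M_part A = {} \<and>
     finite (V_part A) \<and> M_part_is L0 A M \<and>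
     strict_linorder_on (V_part A) (tri A) \<and>
     (\<forall>x\<in>V_part A. \<forall>y\<in>V_part A. x \<noteq> y \<longrightarrow> fI A x y = fI A y x \<and> fI A x y \<in> M_part A) \<and>
     (\<forall>x\<in>V_part A. \<forall>y\<in>V_part A. \<forall>z\<in>V_part A. tri A x y \<and> tri A y z \<longrightarrow>
        fI A x y = fI A x z \<and> fI A x z = fI A y z \<or>
        fI A x y = fI A x z \<and> relI A (OldR lt) [fI A x z, fI A y z] \<or>
        fI A x z = fI A y z \<and> relI A (OldR lt) [fI A y z, fI A x y]) \<and>
     (\<forall>x\<in>univ A. relI A N_sym [x] \<longrightarrow> x \<in> V_part A) \<and>
     trivial_elsewhere L0 A"

section \<open>The Fraisse limit\<close>

definition fg_over :: "('f, 'r) lang \<Rightarrow> ('m, 'f, 'r) struct \<Rightarrow>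
    ('m + 'v, 'f, 'r) ext_struct \<Rightarrow> ('m + 'v, 'f, 'r) ext_struct set" where
  "fg_over L0 M A =
     {restrict_to A (generated (ext_lang L0) A A0 \<union> Inl ` univ M) | A0.
        finite A0 \<and> A0 \<subseteq> univ A}"

definition fraisse_limit ::
  "('f, 'r) lang \<Rightarrow> 'r \<Rightarrow> ('m, 'f, 'r) struct \<Rightarrow> ('m + nat, 'f, 'r) ext_struct \<Rightarrow> bool" where
  "fraisse_limit L0 lt M F \<longleftrightarrow>
     is_struct (ext_lang L0) F \<and> countable (univ F) \<and> M_part_is L0 F M \<and>
     (\<forall>B\<in>fg_over L0 M F. \<exists>A :: ('m + nat, 'f, 'r) ext_struct.
        K_class L0 lt M A \<and> isomorphic (ext_lang L0) B A) \<and>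
     (\<forall>A :: ('m + nat, 'f, 'r) ext_struct. K_class L0 lt M A \<longrightarrow>
        (\<exists>B\<in>fg_over L0 M F. isomorphic (ext_lang L0) B A)) \<and>
     (\<forall>B\<in>fg_over L0 M F. \<forall>C\<in>fg_over L0 M F. \<forall>h. is_iso (ext_lang L0) h B C \<longrightarrow>
        (\<exists>g. is_iso (ext_lang L0) g F F \<and> (\<forall>x\<in>univ B. g x = h x)))"

end

theory Submission
  imports "HOL-Algebra.Free_Abelian_Groups" Complex_Main Defs
begin

text \<open>Condition (4) in the definition of \<open>K\<close> says that \<open>f x z\<close> is the minimum of \<open>f x y\<close> and \<open>f y z\<close>
  whenever \<open>x \<triangleleft> y \<triangleleft> z\<close>, so the position of a new point relative to a finite set is determined by its
  two neighbours. Call a structure rich if all admissible one-point extensions over at most two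
  points are realized. Countable rich structures with isomorphic \<open>M\<close>-parts are then isomorphic by
  back-and-forth, and the Fraisse limit is rich. If the \<open>M\<close>-part of a rich structure \<open>G\<close> is a model
  of \<open>\<phi>\<close>, then closing off under countably many Skolem functions yields a countable substructure
  that is rich, whose \<open>M\<close>-part is isomorphic to \<open>M\<close>, and that agrees with \<open>G\<close> on \<open>\<phi>F\<close>. It is
  isomorphic to the Fraisse limit, so \<open>G\<close> satisfies \<open>\<phi>F\<close>.

  It remains to find a rich structure over \<open>M1\<close>. Its \<open>V\<close>-part consists of the finitely supported
  functions from \<open>M1\<close> to the lexicographic product of \<open>L\<close> with the rationals, ordered
  lexicographically; \<open>f x y\<close> is the first place where \<open>x\<close> and \<open>y\<close> differ, and the color of \<open>x\<close> is
  read off its last nonzero value. \<open>L\<close> embeds as a set of functions supported at one fixed point.\<close>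

section \<open>Isomorphisms and Scott sentences\<close>

lemma is_struct_closed:
  "is_struct L A \<Longrightarrow> g \<in> Funs L \<Longrightarrow> length xs = farity L g \<Longrightarrow> set xs \<subseteq> univ A \<Longrightarrow>
     funI A g xs \<in> univ A"
  unfolding is_struct_def closed_under_def by blast

lemma is_structI:
  assumes "univ A \<noteq> {}"
    and "\<And>g xs. g \<in> Funs L \<Longrightarrow> length xs = farity L g \<Longrightarrow> set xs \<subseteq> univ A \<Longrightarrow> funI A g xs \<in> univ A"
  shows "is_struct L A"
  using assms unfolding is_struct_def closed_under_def by blast

lemma is_isoI:
  assumes A: "is_struct L A" and bij: "bij_betw h (univ A) (univ B)"
    and h_fun: "\<And>g xs. g \<in> Funs L \<Longrightarrow> length xs = farity L g \<Longrightarrow> set xs \<subseteq> univ A \<Longrightarrow>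
      h (funI A g xs) = funI B g (map h xs)"
    and "\<And>r xs. r \<in> Rels L \<Longrightarrow> length xs = rarity L r \<Longrightarrow> set xs \<subseteq> univ A \<Longrightarrow>
      relI A r xs \<longleftrightarrow> relI B r (map h xs)"
  shows "is_iso L h A B"
proof -
  have univ_B: "univ B = h ` univ A" using bij by (simp add: bij_betw_def)
  have "is_struct L B"
  proof (rule is_structI)
    show "univ B \<noteq> {}" using A univ_B by (simp add: is_struct_def)
    fix g ys assume g: "g \<in> Funs L" "length ys = farity L g" and "set ys \<subseteq> univ B"
    then have "ys \<in> map h ` lists (univ A)" unfolding univ_B lists_image[symmetric] by auto
    then obtain xs where xs: "set xs \<subseteq> univ A" "ys = map h xs" by auto
    then have "length xs = farity L g" using g(2) by simp
    then show "funI B g ys \<in> univ B"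
      using h_fun[OF g(1) _ xs(1)] is_struct_closed[OF A g(1) _ xs(1)] xs(2) univ_B
      by (metis imageI)
  qed
  then show ?thesis using assms unfolding is_iso_def by blast
qed

lemma is_iso_fun:
  "is_iso L h A B \<Longrightarrow> g \<in> Funs L \<Longrightarrow> length xs = farity L g \<Longrightarrow> set xs \<subseteq> univ A \<Longrightarrow>
     h (funI A g xs) = funI B g (map h xs)"
  unfolding is_iso_def by blast

lemma is_iso_rel:
  "is_iso L h A B \<Longrightarrow> r \<in> Rels L \<Longrightarrow> length xs = rarity L r \<Longrightarrow> set xs \<subseteq> univ A \<Longrightarrow>
     relI A r xs \<longleftrightarrow> relI B r (map h xs)"
  unfolding is_iso_def by blast

lemma is_iso_bij_betw: "is_iso L h A B \<Longrightarrow> bij_betw h (univ A) (univ B)"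
  unfolding is_iso_def by blast

lemma is_iso_inj_on: "is_iso L h A B \<Longrightarrow> inj_on h (univ A)"
  and is_iso_image: "is_iso L h A B \<Longrightarrow> h ` univ A = univ B"
  by (simp_all add: is_iso_def bij_betw_def)

lemma is_iso_is_struct: "is_iso L h A B \<Longrightarrow> is_struct L A" "is_iso L h A B \<Longrightarrow> is_struct L B"
  unfolding is_iso_def by blast+

lemma is_iso_trans:
  assumes h: "is_iso L h A B" and k: "is_iso L k B C"
  shows "is_iso L (k \<circ> h) A C"
proof (rule is_isoI)
  show "is_struct L A" by (rule is_iso_is_struct(1)[OF h])
  show "bij_betw (k \<circ> h) (univ A) (univ C)"
    by (rule bij_betw_trans[OF is_iso_bij_betw[OF h] is_iso_bij_betw[OF k]])
next
  fix g xs assume g: "g \<in> Funs L" "length xs = farity L g" "set xs \<subseteq> univ A"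
  then have "set (map h xs) \<subseteq> univ B" using is_iso_image[OF h] by auto
  then show "(k \<circ> h) (funI A g xs) = funI C g (map (k \<circ> h) xs)"
    using is_iso_fun[OF h g] is_iso_fun[OF k g(1), of "map h xs"] g(2) by simp
next
  fix r xs assume r: "r \<in> Rels L" "length xs = rarity L r" "set xs \<subseteq> univ A"
  then have "set (map h xs) \<subseteq> univ B" using is_iso_image[OF h] by auto
  then show "relI A r xs \<longleftrightarrow> relI C r (map (k \<circ> h) xs)"
    using is_iso_rel[OF h r] is_iso_rel[OF k r(1), of "map h xs"] r(2) by simp
qed

lemma is_iso_inv_into:
  assumes h: "is_iso L h A B"
  shows "is_iso L (inv_into (univ A) h) B A"
proof (rule is_isoI)
  let ?k = "inv_into (univ A) h"
  note bij = is_iso_bij_betw[OF h]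
  show "is_struct L B" by (rule is_iso_is_struct(2)[OF h])
  show bij_inv: "bij_betw ?k (univ B) (univ A)" by (rule bij_betw_inv_into[OF bij])
  have h_inv: "map h (map ?k xs) = xs" if "set xs \<subseteq> univ B" for xs
    using that bij_betw_inv_into_right[OF bij] by (induction xs) auto
  have inv_in: "set (map ?k xs) \<subseteq> univ A" if "set xs \<subseteq> univ B" for xs
    using that bij_inv by (auto simp: bij_betw_def)
  show "?k (funI B g xs) = funI A g (map ?k xs)"
    if g: "g \<in> Funs L" "length xs = farity L g" "set xs \<subseteq> univ B" for g xs
  proof -
    have "h (funI A g (map ?k xs)) = funI B g xs"
      using is_iso_fun[OF h g(1) _ inv_in[OF g(3)]] g(2) h_inv[OF g(3)] by simp
    moreover have "funI A g (map ?k xs) \<in> univ A"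
      using is_struct_closed[OF is_iso_is_struct(1)[OF h] g(1) _ inv_in[OF g(3)]] g(2) by simp
    ultimately show ?thesis using bij_betw_inv_into_left[OF bij] by metis
  qed
  show "relI B r xs \<longleftrightarrow> relI A r (map ?k xs)"
    if r: "r \<in> Rels L" "length xs = rarity L r" "set xs \<subseteq> univ B" for r xs
    using is_iso_rel[OF h r(1) _ inv_in[OF r(3)]] r(2) h_inv[OF r(3)] by simp
qed

lemma isomorphic_sym: "isomorphic L A B \<Longrightarrow> isomorphic L B A"
  unfolding isomorphic_def using is_iso_inv_into by blast

lemma isomorphic_trans: "isomorphic L A B \<Longrightarrow> isomorphic L B C \<Longrightarrow> isomorphic L A C"
  unfolding isomorphic_def using is_iso_trans by blast

lemma is_iso_cong:
  assumes h: "is_iso L h A B" and eq: "\<And>x. x \<in> univ A \<Longrightarrow> h x = k x"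
  shows "is_iso L k A B"
proof (rule is_isoI)
  have map_eq: "map k xs = map h xs" if "set xs \<subseteq> univ A" for xs
    using that eq by auto
  show "is_struct L A" by (rule is_iso_is_struct(1)[OF h])
  show "bij_betw k (univ A) (univ B)"
    using is_iso_bij_betw[OF h] bij_betw_cong[of "univ A" h k] eq by blast
  show "k (funI A g xs) = funI B g (map k xs)"
    if g: "g \<in> Funs L" "length xs = farity L g" "set xs \<subseteq> univ A" for g xs
    using is_iso_fun[OF h g] eq[OF is_struct_closed[OF is_iso_is_struct(1)[OF h] g]]
    unfolding map_eq[OF g(3)] by simp
  show "relI A r xs \<longleftrightarrow> relI B r (map k xs)"
    if r: "r \<in> Rels L" "length xs = rarity L r" "set xs \<subseteq> univ A" for r xs
    using is_iso_rel[OF h r] unfolding map_eq[OF r(3)] .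
qed

lemma restrict_to_simps [simp]:
  "univ (restrict_to A X) = X" "funI (restrict_to A X) = funI A" "relI (restrict_to A X) = relI A"
  by (simp_all add: restrict_to_def)

lemma is_iso_restrict_to:
  assumes h: "is_iso L h A B" and X: "X \<subseteq> univ A" and sub: "is_struct L (restrict_to A X)"
  shows "is_iso L h (restrict_to A X) (restrict_to B (h ` X))"
proof (rule is_isoI)
  show "bij_betw h (univ (restrict_to A X)) (univ (restrict_to B (h ` X)))"
    using inj_on_subset[OF is_iso_inj_on[OF h] X] by (simp add: inj_on_imp_bij_betw)
qed (use sub X is_iso_fun[OF h] is_iso_rel[OF h] in auto)

lemma eval_tm_in_univ:
  assumes "is_struct L A" "range e \<subseteq> univ A"
  shows "wf_tm L t \<Longrightarrow> eval_tm A e t \<in> univ A"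
  by (induction t) (use assms in \<open>auto intro!: is_struct_closed[of L]\<close>)

lemma eval_tm_iso:
  assumes h: "is_iso L h A B" and e: "range e \<subseteq> univ A"
  shows "wf_tm L t \<Longrightarrow> h (eval_tm A e t) = eval_tm B (\<lambda>i. h (e i)) t"
proof (induction t)
  case (Fn g ts)
  have args_in: "set (map (eval_tm A e) ts) \<subseteq> univ A"
    using Fn.prems eval_tm_in_univ[OF is_iso_is_struct(1)[OF h] e] by auto
  have args: "map h (map (eval_tm A e) ts) = map (eval_tm B (\<lambda>i. h (e i))) ts"
    using Fn by simp
  show ?case
    using is_iso_fun[OF h, of g "map (eval_tm A e) ts"] Fn.prems args_in
    unfolding eval_tm.simps args by simp
qed simp

lemma sat_iso:
  assumes h: "is_iso L h A B"
  shows "wf_fm L p \<Longrightarrow> range e \<subseteq> univ A \<Longrightarrow> sat A e p \<longleftrightarrow> sat B (\<lambda>i. h (e i)) p"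
proof (induction p arbitrary: e)
  case (Eq s t)
  note in_univ = eval_tm_in_univ[OF is_iso_is_struct(1)[OF h] Eq.prems(2)]
  show ?case
    using Eq.prems(1) eval_tm_iso[OF h Eq.prems(2), symmetric] in_univ
      inj_on_eq_iff[OF is_iso_inj_on[OF h]] by simp
next
  case (Rel r ts)
  have args_in: "set (map (eval_tm A e) ts) \<subseteq> univ A"
    using Rel.prems eval_tm_in_univ[OF is_iso_is_struct(1)[OF h] Rel.prems(2)] by auto
  have args: "map h (map (eval_tm A e) ts) = map (eval_tm B (\<lambda>i. h (e i))) ts"
    using Rel.prems eval_tm_iso[OF h Rel.prems(2)] by simp
  show ?case
    using is_iso_rel[OF h, of r "map (eval_tm A e) ts"] Rel.prems(1) args_in
    unfolding sat.simps args by simp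
next
  case (Exists n p)
  have "sat A (e(n := a)) p \<longleftrightarrow> sat B ((\<lambda>i. h (e i))(n := h a)) p" if "a \<in> univ A" for a
  proof -
    have "range (e(n := a)) \<subseteq> univ A" using that Exists.prems by auto
    then have "sat A (e(n := a)) p \<longleftrightarrow> sat B (\<lambda>i. h ((e(n := a)) i)) p"
      using Exists.IH Exists.prems(1) by (simp del: fun_upd_apply)
    moreover have "(\<lambda>i. h ((e(n := a)) i)) = (\<lambda>i. h (e i))(n := h a)" by auto
    ultimately show ?thesis by (simp only:)
  qed
  then show ?case by (auto simp: is_iso_image[OF h, symmetric])
qed simp_all

lemma is_model_iso:
  assumes h: "is_iso L h A B" and "wf_fm L p" and A: "is_model L A p"
  shows "is_model L B p"
  unfolding is_model_def
proof (intro conjI allI impI)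
  show "is_struct L B" using h is_iso_is_struct by blast
  fix e :: "nat \<Rightarrow> _" assume e: "range e \<subseteq> univ B"
  let ?k = "inv_into (univ A) h"
  have "range (?k \<circ> e) \<subseteq> univ A"
    using e is_iso_image[OF is_iso_inv_into[OF h]] by auto
  moreover have "h ((?k \<circ> e) i) = e i" for i
    using f_inv_into_f[of "e i" h "univ A"] range_subsetD[OF e, of i] is_iso_image[OF h] by simp
  ultimately show "sat B e p"
    using sat_iso[OF h \<open>wf_fm L p\<close>, of "?k \<circ> e"] A unfolding is_model_def by simp
qed

lemma is_model_isomorphic:
  "isomorphic L A B \<Longrightarrow> wf_fm L p \<Longrightarrow> is_model L A p \<longleftrightarrow> is_model L B p"
  unfolding isomorphic_def by (metis is_model_iso is_iso_inv_into)

lemma isomorphic_copy: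
  fixes A :: "('a, 'f, 'r) struct" and k :: "'a \<Rightarrow> 'b"
  assumes A: "is_struct L A" and inj: "inj_on k (univ A)"
  shows "\<exists>B :: ('b, 'f, 'r) struct. isomorphic L B A"
proof -
  let ?k' = "inv_into (univ A) k"
  define B :: "('b, 'f, 'r) struct" where
    "B = \<lparr>univ = k ` univ A, funI = (\<lambda>g xs. k (funI A g (map ?k' xs))),
          relI = (\<lambda>r xs. relI A r (map ?k' xs))\<rparr>"
  have inv: "map ?k' (map k xs) = xs" if "set xs \<subseteq> univ A" for xs
    using that inj by (induction xs) auto
  have "is_iso L k A B"
  proof (rule is_isoI)
    show "bij_betw k (univ A) (univ B)" using inj by (simp add: B_def inj_on_imp_bij_betw)
  qed (simp_all add: A B_def inv del: map_map)
  then show ?thesis using isomorphic_sym unfolding isomorphic_def by blast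
qed

lemma scott_sentence_iff:
  assumes p: "scott_sentence L A p" and B: "is_struct L B" "countable (univ B)"
  shows "is_model L B p \<longleftrightarrow> isomorphic L B A"
proof -
  obtain C :: "(nat, _, _) struct" where C: "isomorphic L C B"
    using isomorphic_copy[OF B(1) inj_on_to_nat_on[OF B(2)]] by blast
  then have "is_struct L C" using is_iso_is_struct unfolding isomorphic_def by blast
  then have "is_model L C p \<longleftrightarrow> isomorphic L C A" and "wf_fm L p"
    using p unfolding scott_sentence_def sentence_def by blast+
  then show ?thesis
    using is_model_isomorphic[OF C] isomorphic_trans[OF C, of A]
      isomorphic_trans[OF isomorphic_sym[OF C], of A] by blast
qed

section \<open>Reflection to countable substructures\<close>

definition closed_in :: "('a list \<Rightarrow> 'a) set \<Rightarrow> 'a set \<Rightarrow> 'a set \<Rightarrow> bool" where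
  "closed_in FF U X \<longleftrightarrow> X \<subseteq> U \<and> (\<forall>f\<in>FF. \<forall>xs\<in>lists X. f xs \<in> U \<longrightarrow> f xs \<in> X)"

definition club :: "'a set \<Rightarrow> 'a set filter" where
  "club U = Abs_filter (\<lambda>P. \<exists>FF. countable FF \<and> (\<forall>X. closed_in FF U X \<longrightarrow> P X))"

lemma eventually_club:
  "eventually P (club U) \<longleftrightarrow> (\<exists>FF. countable FF \<and> (\<forall>X. closed_in FF U X \<longrightarrow> P X))"
  unfolding club_def
proof (rule eventually_Abs_filter, rule is_filter.intro)
  show "\<exists>FF. countable FF \<and> (\<forall>X. closed_in FF U X \<longrightarrow> True)" by auto
next
  fix P Q
  assume "\<exists>FF. countable FF \<and> (\<forall>X. closed_in FF U X \<longrightarrow> P X)"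
    and "\<exists>FF. countable FF \<and> (\<forall>X. closed_in FF U X \<longrightarrow> Q X)"
  then obtain FF GG where "countable (FF \<union> GG)"
    and "\<forall>X. closed_in FF U X \<longrightarrow> P X" "\<forall>X. closed_in GG U X \<longrightarrow> Q X" by auto
  then show "\<exists>FF. countable FF \<and> (\<forall>X. closed_in FF U X \<longrightarrow> P X \<and> Q X)"
    unfolding closed_in_def by (intro exI[of _ "FF \<union> GG"]) simp
qed blast

lemma eventually_club_subset: "\<forall>\<^sub>F X in club U. X \<subseteq> U"
  unfolding eventually_club closed_in_def by auto

lemma eventually_club_closed: "\<forall>\<^sub>F X in club U. \<forall>xs\<in>lists X. f xs \<in> U \<longrightarrow> f xs \<in> X"
  unfolding eventually_club closed_in_def by (intro exI[of _ "{f}"]) simp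

lemma eventually_club_witness:
  "\<forall>\<^sub>F X in club U. \<forall>xs\<in>lists X. (\<exists>z\<in>U. P xs z) \<longrightarrow> (\<exists>z\<in>X. P xs z)"
proof (rule eventually_mono[OF eventually_club_closed[of "\<lambda>xs. SOME z. z \<in> U \<and> P xs z"]],
    intro ballI impI)
  fix X xs
  let ?w = "SOME z. z \<in> U \<and> P xs z"
  assume "\<forall>xs\<in>lists X. (SOME z. z \<in> U \<and> P xs z) \<in> U \<longrightarrow> (SOME z. z \<in> U \<and> P xs z) \<in> X"
    and "xs \<in> lists X" "\<exists>z\<in>U. P xs z"
  moreover from \<open>\<exists>z\<in>U. P xs z\<close> have "?w \<in> U \<and> P xs ?w" by (metis (mono_tags, lifting) someI_ex)
  ultimately show "\<exists>z\<in>X. P xs z" by blast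
qed

lemma eventually_club_witness2:
  "\<forall>\<^sub>F X in club U. \<forall>x\<in>X. \<forall>y\<in>X. (\<exists>z\<in>U. P x y z) \<longrightarrow> (\<exists>z\<in>X. P x y z)"
proof (rule eventually_mono[OF eventually_club_witness[of _ "\<lambda>xs. P (xs ! 0) (xs ! 1)"]],
    intro ballI)
  fix X x y
  assume "\<forall>xs\<in>lists X. (\<exists>z\<in>U. P (xs ! 0) (xs ! 1) z) \<longrightarrow> (\<exists>z\<in>X. P (xs ! 0) (xs ! 1) z)"
    and "x \<in> X" "y \<in> X"
  from this(1)[rule_format, of "[x, y]"] this(2,3)
  show "(\<exists>z\<in>U. P x y z) \<longrightarrow> (\<exists>z\<in>X. P x y z)" by auto
qed

lemma eventually_club_ball:
  assumes "countable I" and P: "\<And>i. i \<in> I \<Longrightarrow> \<forall>\<^sub>F X in club U. P i X"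
  shows "\<forall>\<^sub>F X in club U. \<forall>i\<in>I. P i X"
proof -
  obtain FF where FF: "\<And>i. i \<in> I \<Longrightarrow> countable (FF i)"
    and FF_P: "\<And>i X. i \<in> I \<Longrightarrow> closed_in (FF i) U X \<Longrightarrow> P i X"
    using P unfolding eventually_club by metis
  have "countable (\<Union>i\<in>I. FF i)" using \<open>countable I\<close> FF by blast
  moreover have "P i X" if "closed_in (\<Union>i\<in>I. FF i) U X" "i \<in> I" for i X
    using that by (intro FF_P) (auto simp: closed_in_def)
  ultimately show ?thesis unfolding eventually_club by blast
qed

lemma eventually_club_Int:
  assumes "W \<subseteq> U" "\<forall>\<^sub>F X in club W. P X"
  shows "\<forall>\<^sub>F X in club U. P (W \<inter> X)"
proof -
  obtain FF where FF: "countable FF" "\<And>X. closed_in FF W X \<Longrightarrow> P X"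
    using assms(2) unfolding eventually_club by blast
  have "closed_in FF W (W \<inter> X)" if "closed_in FF U X" for X
    using that \<open>W \<subseteq> U\<close> unfolding closed_in_def by blast
  then show ?thesis using FF unfolding eventually_club by blast
qed

lemma countable_closed_in_superset:
  assumes FF: "countable FF" and X0: "countable X0" "X0 \<subseteq> U"
  shows "\<exists>X. countable X \<and> X0 \<subseteq> X \<and> closed_in FF U X"
proof -
  define step where "step X = X \<union> (\<lambda>(f, xs). f xs) ` (FF \<times> lists X) \<inter> U" for X
  define Y where "Y n = (step ^^ n) X0" for n
  have Y_Suc: "Y (Suc n) = step (Y n)" for n by (simp add: Y_def)
  have "countable (Y n)" for n
    by (induction n) (use FF X0 in \<open>simp_all add: Y_def step_def\<close>)
  moreover have "X0 \<subseteq> (\<Union>n. Y n)" using Y_def[of 0] by auto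
  moreover have "closed_in FF U (\<Union>n. Y n)"
    unfolding closed_in_def
  proof (intro conjI ballI impI)
    have "Y n \<subseteq> U" for n by (induction n) (use X0 in \<open>auto simp: Y_def step_def\<close>)
    then show "(\<Union>n. Y n) \<subseteq> U" by blast
    have "incseq Y" by (rule incseq_SucI) (simp add: Y_Suc step_def)
    then have "subset.chain UNIV (range Y)"
      unfolding subset_chain_def by (metis incseqD linorder_linear rangeE subset_UNIV)
    fix f xs assume f: "f \<in> FF" "f xs \<in> U" and xs: "xs \<in> lists (\<Union>n. Y n)"
    have "set xs \<subseteq> \<Union> (range Y)" using xs by (simp add: in_lists_conv_set subset_iff)
    then obtain B where "B \<in> range Y" "set xs \<subseteq> B"
      by (rule finite_subset_Union_chain[OF finite_set]) (use \<open>subset.chain UNIV (range Y)\<close> in auto)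
    then obtain n where "set xs \<subseteq> Y n" by blast
    then have "f xs \<in> Y (Suc n)" unfolding Y_Suc step_def using f by auto
    then show "f xs \<in> (\<Union>n. Y n)" by blast
  qed
  ultimately show ?thesis by (intro exI[of _ "\<Union>n. Y n"]) simp
qed

lemma eventually_club_imp_countable:
  assumes "\<forall>\<^sub>F X in club U. P X" "countable X0" "X0 \<subseteq> U"
  shows "\<exists>X. countable X \<and> X0 \<subseteq> X \<and> X \<subseteq> U \<and> P X"
  using assms countable_closed_in_superset[OF _ assms(2,3)] unfolding eventually_club
  by (metis closed_in_def)

lemma eval_tm_cong_fv: "(\<And>n. n \<in> fv_tm t \<Longrightarrow> e n = e' n) \<Longrightarrow> eval_tm A e t = eval_tm A e' t"
proof (induction t)
  case (Fn g ts)
  then have "map (eval_tm A e) ts = map (eval_tm A e') ts" by fastforce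
  then show ?case by (simp del: map_eq_conv)
qed simp

lemma sat_cong_fv: "(\<And>n. n \<in> fv_fm p \<Longrightarrow> e n = e' n) \<Longrightarrow> sat A e p \<longleftrightarrow> sat A e' p"
proof (induction p arbitrary: e e')
  case (Eq s t)
  then show ?case using eval_tm_cong_fv[of s e e' A] eval_tm_cong_fv[of t e e' A] by simp
next
  case (Rel r ts)
  then have "map (eval_tm A e) ts = map (eval_tm A e') ts" by (auto intro: eval_tm_cong_fv)
  then show ?case by (simp del: map_eq_conv)
next
  case (Neg p)
  then show ?case by (metis fv_fm.simps(3) sat.simps(3))
next
  case (Conj P)
  then have "sat A e (P n) = sat A e' (P n)" for n by (metis UN_I UNIV_I fv_fm.simps(4) rangeI)
  then show ?case by simp
next
  case (Exists n p)
  have "sat A (e(n := a)) p = sat A (e'(n := a)) p" for a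
    by (rule Exists.IH) (use Exists.prems in auto)
  then show ?case by simp
qed

lemma is_model_iff_sat:
  assumes "is_struct L A" "sentence L p" "range e \<subseteq> univ A"
  shows "is_model L A p \<longleftrightarrow> sat A e p"
  using assms sat_cong_fv[of p] unfolding is_model_def sentence_def by (metis empty_iff)

lemma eval_tm_restrict_to [simp]: "eval_tm (restrict_to A X) e = eval_tm A e"
proof
  show "eval_tm (restrict_to A X) e t = eval_tm A e t" for t
    by (induction t) (auto cong: map_cong)
qed

lemma eventually_club_sat_iff:
  assumes "finite (fv_fm p)"
  shows "\<forall>\<^sub>F X in club (univ A). \<forall>e. range e \<subseteq> X \<longrightarrow> (sat (restrict_to A X) e p \<longleftrightarrow> sat A e p)"
  using assms
proof (induction p)
  case (Conj P)
  have "finite (fv_fm (P n))" for n using Conj.prems by (rule rev_finite_subset) auto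
  then have "\<forall>\<^sub>F X in club (univ A). \<forall>n\<in>UNIV. \<forall>e. range e \<subseteq> X \<longrightarrow>
      (sat (restrict_to A X) e (P n) \<longleftrightarrow> sat A e (P n))"
    using Conj.IH by (intro eventually_club_ball) auto
  then show ?case by (rule eventually_mono) simp
next
  case (Exists n p)
  then have "finite (fv_fm p)" by simp
  then obtain k where k: "fv_fm p \<subseteq> {..<k}" using finite_nat_iff_bounded by blast
  define Q where "Q xs z \<longleftrightarrow> sat A ((\<lambda>i. xs ! i)(n := z)) p" for xs z
  have Q: "Q (map e [0..<k]) z \<longleftrightarrow> sat A (e(n := z)) p" for e z
    unfolding Q_def by (rule sat_cong_fv) (use k in auto)
  show ?case
    using Exists.IH[OF \<open>finite (fv_fm p)\<close>] eventually_club_witness[of "univ A" Q]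
      eventually_club_subset[of "univ A"]
  proof eventually_elim
    case (elim X)
    show ?case
    proof (intro allI impI)
      fix e :: "nat \<Rightarrow> _" assume e: "range e \<subseteq> X"
      then have "range (e(n := z)) \<subseteq> X" if "z \<in> X" for z using that by auto
      then have "sat (restrict_to A X) (e(n := z)) p \<longleftrightarrow> sat A (e(n := z)) p" if "z \<in> X" for z
        using elim(1) that by blast
      moreover have "map e [0..<k] \<in> lists X" using range_subsetD[OF e] by auto
      then have "(\<exists>z\<in>univ A. Q (map e [0..<k]) z) \<longleftrightarrow> (\<exists>z\<in>X. Q (map e [0..<k]) z)"
        using elim(2,3) by blast
      ultimately show "sat (restrict_to A X) e (Exists n p) \<longleftrightarrow> sat A e (Exists n p)"
        unfolding Q by simp
    qed
  qed
qed simp_all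

lemma eventually_club_is_struct:
  assumes "countable_lang L" "is_struct L A"
  shows "\<forall>\<^sub>F X in club (univ A). is_struct L (restrict_to A X)"
proof -
  have "\<forall>\<^sub>F X in club (univ A). \<forall>g\<in>Funs L. \<forall>xs\<in>lists X. funI A g xs \<in> univ A \<longrightarrow> funI A g xs \<in> X"
    using assms(1)
    by (intro eventually_club_ball eventually_club_closed) (simp add: countable_lang_def)
  then show ?thesis
    using eventually_club_subset eventually_club_witness[of "univ A" "\<lambda>_ _. True"]
  proof eventually_elim
    case (elim X)
    show ?case
    proof (rule is_structI)
      show "univ (restrict_to A X) \<noteq> {}"
        using elim(3)[rule_format, of "[]"] assms(2) by (auto simp: is_struct_def)
      fix g xs assume g: "g \<in> Funs L" "length xs = farity L g" "set xs \<subseteq> univ (restrict_to A X)"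
      then have "funI A g xs \<in> univ A" using is_struct_closed[OF assms(2) g(1,2)] elim(2) by auto
      then show "funI (restrict_to A X) g xs \<in> univ (restrict_to A X)" using elim(1) g by auto
    qed
  qed
qed

lemma eventually_club_is_model_iff:
  assumes L: "countable_lang L" and A: "is_struct L A" and p: "sentence L p"
  shows "\<forall>\<^sub>F X in club (univ A). is_model L (restrict_to A X) p \<longleftrightarrow> is_model L A p"
proof -
  have "finite (fv_fm p)" using p by (simp add: sentence_def)
  from eventually_club_sat_iff[OF this] eventually_club_is_struct[OF L A] eventually_club_subset
  show ?thesis
  proof eventually_elim
    case (elim X)
    then obtain x where x: "x \<in> X" by (auto simp: is_struct_def)
    then have "sat (restrict_to A X) (\<lambda>_. x) p \<longleftrightarrow> sat A (\<lambda>_. x) p" using elim(1) by auto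
    then show ?case
      using is_model_iff_sat[OF elim(2) p, of "\<lambda>_. x"] is_model_iff_sat[OF A p, of "\<lambda>_. x"]
        x elim(3) by auto
  qed
qed

lemma eventually_club_isomorphic:
  assumes L: "countable_lang L" and p: "scott_sentence L M p" and A: "is_model L A p"
  shows "\<forall>\<^sub>F X in club (univ A). countable X \<longrightarrow> isomorphic L (restrict_to A X) M"
proof -
  have "is_struct L A" "sentence L p" using A p unfolding is_model_def scott_sentence_def by blast+
  from eventually_club_is_struct[OF L this(1)] eventually_club_is_model_iff[OF L this]
  show ?thesis by eventually_elim (use A scott_sentence_iff[OF p, of "restrict_to A _"] in auto)
qed

section \<open>Strict linear orders\<close>

lemma strict_linorder_onD:
  assumes "strict_linorder_on X R"
  shows strict_linorder_on_irrefl: "x \<in> X \<Longrightarrow> \<not> R x x"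
    and strict_linorder_on_trans: "x \<in> X \<Longrightarrow> y \<in> X \<Longrightarrow> z \<in> X \<Longrightarrow> R x y \<Longrightarrow> R y z \<Longrightarrow> R x z"
    and strict_linorder_on_total: "x \<in> X \<Longrightarrow> y \<in> X \<Longrightarrow> x \<noteq> y \<Longrightarrow> R x y \<or> R y x"
    and strict_linorder_on_asym: "x \<in> X \<Longrightarrow> y \<in> X \<Longrightarrow> R x y \<Longrightarrow> \<not> R y x"
  using assms unfolding strict_linorder_on_def irreflp_on_def transp_on_def totalp_on_def by metis+

lemma strict_linorder_onI:
  assumes "\<And>x. x \<in> X \<Longrightarrow> \<not> R x x"
    and "\<And>x y z. x \<in> X \<Longrightarrow> y \<in> X \<Longrightarrow> z \<in> X \<Longrightarrow> R x y \<Longrightarrow> R y z \<Longrightarrow> R x z"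
    and "\<And>x y. x \<in> X \<Longrightarrow> y \<in> X \<Longrightarrow> x \<noteq> y \<Longrightarrow> R x y \<or> R y x"
  shows "strict_linorder_on X R"
  using assms unfolding strict_linorder_on_def irreflp_on_def transp_on_def totalp_on_def by blast

lemma strict_linorder_on_converse:
  "strict_linorder_on X R \<Longrightarrow> strict_linorder_on X (\<lambda>x y. R y x)"
  unfolding strict_linorder_on_def irreflp_on_def transp_on_def totalp_on_def by blast

lemma strict_linorder_on_subset:
  "strict_linorder_on X R \<Longrightarrow> Y \<subseteq> X \<Longrightarrow> strict_linorder_on Y R"
  unfolding strict_linorder_on_def
  by (blast intro: irreflp_on_subset transp_on_subset totalp_on_subset)

lemma strict_linorder_on_local:
  assumes "\<And>S. finite S \<Longrightarrow> S \<subseteq> X \<Longrightarrow> \<exists>Y. S \<subseteq> Y \<and> strict_linorder_on Y R"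
  shows "strict_linorder_on X R"
proof -
  have triple: "\<exists>Y. x \<in> Y \<and> y \<in> Y \<and> z \<in> Y \<and> strict_linorder_on Y R"
    if "x \<in> X" "y \<in> X" "z \<in> X" for x y z
    using assms[of "{x, y, z}"] that by auto
  show ?thesis
  proof (rule strict_linorder_onI)
    fix x assume "x \<in> X"
    then obtain Y where Y: "x \<in> Y" "strict_linorder_on Y R" using triple by blast
    then show "\<not> R x x" by (rule strict_linorder_on_irrefl[rotated])
  next
    fix x y z assume "x \<in> X" "y \<in> X" "z \<in> X" and R: "R x y" "R y z"
    then obtain Y where Y: "x \<in> Y" "y \<in> Y" "z \<in> Y" "strict_linorder_on Y R"
      using triple by meson
    show "R x z" by (rule strict_linorder_on_trans[OF Y(4,1-3) R])
  next
    fix x y assume "x \<in> X" "y \<in> X" and "x \<noteq> y"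
    then obtain Y where Y: "x \<in> Y" "y \<in> Y" "strict_linorder_on Y R" using triple by meson
    show "R x y \<or> R y x" by (rule strict_linorder_on_total[OF Y(3,1,2) \<open>x \<noteq> y\<close>])
  qed
qed

lemma ex_greatest_below:
  assumes R: "strict_linorder_on X R" and D: "finite D" "D \<subseteq> X" and "\<exists>a\<in>D. R a z"
  shows "\<exists>p\<in>D. R p z \<and> (\<forall>a\<in>D. R a z \<longrightarrow> a = p \<or> R a p)"
proof -
  let ?L = "{a \<in> D. R a z}"
  have "strict_linorder_on ?L R" by (rule strict_linorder_on_subset[OF R]) (use D in auto)
  then have "\<exists>p\<in>?L. \<forall>a\<in>?L. a \<noteq> p \<longrightarrow> R a p"
    using D assms(4) unfolding strict_linorder_on_def
    by (intro Finite_Set.bex_greatest_element) auto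
  then show ?thesis by blast
qed

definition order_iso ::
  "('a \<Rightarrow> 'b) \<Rightarrow> 'a set \<Rightarrow> ('a \<Rightarrow> 'a \<Rightarrow> bool) \<Rightarrow> 'b set \<Rightarrow> ('b \<Rightarrow> 'b \<Rightarrow> bool) \<Rightarrow> bool" where
  "order_iso h U r U' r' \<longleftrightarrow> bij_betw h U U' \<and> (\<forall>u\<in>U. \<forall>v\<in>U. r u v \<longleftrightarrow> r' (h u) (h v))"

lemma order_iso_bij_betw: "order_iso h U r U' r' \<Longrightarrow> bij_betw h U U'"
  and order_iso_iff: "order_iso h U r U' r' \<Longrightarrow> u \<in> U \<Longrightarrow> v \<in> U \<Longrightarrow> r u v \<longleftrightarrow> r' (h u) (h v)"
  unfolding order_iso_def by blast+

lemma order_iso_inv_into: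
  assumes "order_iso h U r U' r'"
  shows "order_iso (inv_into U h) U' r' U r"
  using assms bij_betw_inv_into[of h U U'] bij_betw_inv_into_right[of h U U']
    inv_into_into[of _ h U]
  unfolding order_iso_def by (auto simp: bij_betw_def)

lemma strict_linorder_on_order_iso:
  assumes "order_iso h U r U' r'" "strict_linorder_on U r"
  shows "strict_linorder_on U' r'"
proof -
  note less_iff = order_iso_iff[OF assms(1), symmetric]
  have U': "U' = h ` U" using order_iso_bij_betw[OF assms(1)] by (simp add: bij_betw_def)
  show ?thesis
    unfolding U'
  proof (rule strict_linorder_onI)
    show "\<not> r' x x" if "x \<in> h ` U" for x
      using that less_iff strict_linorder_on_irrefl[OF assms(2)] by auto
  next
    fix x y z assume "x \<in> h ` U" "y \<in> h ` U" "z \<in> h ` U" and lt: "r' x y" "r' y z"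
    then obtain u v w where uvw: "u \<in> U" "v \<in> U" "w \<in> U" "x = h u" "y = h v" "z = h w" by blast
    then show "r' x z"
      using lt less_iff strict_linorder_on_trans[OF assms(2) uvw(1-3)] by metis
  next
    fix x y assume "x \<in> h ` U" "y \<in> h ` U" and "x \<noteq> y"
    then obtain u v where uv: "u \<in> U" "v \<in> U" "x = h u" "y = h v" by blast
    then show "r' x y \<or> r' y x"
      using \<open>x \<noteq> y\<close> less_iff strict_linorder_on_total[OF assms(2) uv(1,2)] by metis
  qed
qed

definition min_by :: "('a \<Rightarrow> 'a \<Rightarrow> bool) \<Rightarrow> 'a \<Rightarrow> 'a \<Rightarrow> 'a" where
  "min_by r u v = (if r u v then u else v)"

lemma min_by_order_iso:
  "order_iso h U r U' r' \<Longrightarrow> u \<in> U \<Longrightarrow> v \<in> U \<Longrightarrow> h (min_by r u v) = min_by r' (h u) (h v)"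
  by (simp add: min_by_def order_iso_iff)

lemma eq_min_by_iff:
  assumes "strict_linorder_on U r" "u \<in> U" "v \<in> U"
  shows "w = min_by r u v \<longleftrightarrow> u = w \<and> w = v \<or> u = w \<and> r w v \<or> w = v \<and> r v u"
  using strict_linorder_onD[OF assms(1)] assms(2,3) unfolding min_by_def by metis

section \<open>Convexly ordered ultrametric spaces\<close>

text \<open>Larger values of the closeness mean smaller distances.\<close>

record ('a, 'u) colored_space =
  points :: "'a set"
  precedes :: "'a \<Rightarrow> 'a \<Rightarrow> bool"
  closeness :: "'a \<Rightarrow> 'a \<Rightarrow> 'u"
  colored :: "'a \<Rightarrow> bool"

definition dual :: "('a, 'u) colored_space \<Rightarrow> ('a, 'u) colored_space" where
  "dual S = S\<lparr>precedes := \<lambda>x y. precedes S y x\<rparr>"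

lemma dual_simps [simp]:
  "points (dual S) = points S" "precedes (dual S) x y \<longleftrightarrow> precedes S y x"
  "closeness (dual S) = closeness S" "colored (dual S) = colored S" "dual (dual S) = S"
  by (simp_all add: dual_def)

locale convex_ultrametric =
  fixes U :: "'u set" and r :: "'u \<Rightarrow> 'u \<Rightarrow> bool" and S :: "('a, 'u) colored_space"
  assumes values_linorder: "strict_linorder_on U r"
    and points_linorder: "strict_linorder_on (points S) (precedes S)"
    and closeness_sym:
      "x \<in> points S \<Longrightarrow> y \<in> points S \<Longrightarrow> x \<noteq> y \<Longrightarrow> closeness S x y = closeness S y x"
    and closeness_in:
      "x \<in> points S \<Longrightarrow> y \<in> points S \<Longrightarrow> x \<noteq> y \<Longrightarrow> closeness S x y \<in> U"
    and closeness_eq_min: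
      "x \<in> points S \<Longrightarrow> y \<in> points S \<Longrightarrow> z \<in> points S \<Longrightarrow> precedes S x y \<Longrightarrow> precedes S y z \<Longrightarrow>
         closeness S x z = min_by r (closeness S x y) (closeness S y z)"
begin

lemmas values_irrefl = strict_linorder_on_irrefl[OF values_linorder]
lemmas values_total = strict_linorder_on_total[OF values_linorder]
lemmas values_asym = strict_linorder_on_asym[OF values_linorder]
lemmas precedes_irrefl = strict_linorder_on_irrefl[OF points_linorder]
lemmas precedes_trans = strict_linorder_on_trans[OF points_linorder]
lemmas precedes_total = strict_linorder_on_total[OF points_linorder]
lemmas precedes_asym = strict_linorder_on_asym[OF points_linorder]

lemma convex_ultrametric_dual: "convex_ultrametric U r (dual S)"
proof
  show "strict_linorder_on (points (dual S)) (precedes (dual S))"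
    using strict_linorder_on_converse[OF points_linorder] by (simp add: dual_def)
  fix x y z
  assume in_S: "x \<in> points (dual S)" "y \<in> points (dual S)" "z \<in> points (dual S)"
    and lt: "precedes (dual S) x y" "precedes (dual S) y z"
  then have sym: "closeness S x y = closeness S y x" "closeness S y z = closeness S z y"
    "closeness S x z = closeness S z x"
    using closeness_sym precedes_irrefl precedes_asym by (metis dual_simps(1,2))+
  have "closeness S z y \<in> U" "closeness S y x \<in> U"
    using closeness_in in_S lt precedes_irrefl by auto
  then show "closeness (dual S) x z = min_by r (closeness (dual S) x y) (closeness (dual S) y z)"
    using closeness_eq_min[of z y x] in_S lt sym values_asym values_total
    unfolding min_by_def by (metis dual_simps(1-3))
qed (use values_linorder closeness_sym closeness_in in auto)

lemma precedes_closer_point: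
  assumes in_S: "x \<in> points S" "y \<in> points S" "w \<in> points S"
    and "precedes S x y" "y \<noteq> w" and closer: "r (closeness S x y) (closeness S y w)"
  shows "precedes S x w \<and> closeness S x w = closeness S x y"
proof -
  have "x \<noteq> y" using assms(4) precedes_irrefl in_S by blast
  note vals = closeness_in[OF in_S(1,2) \<open>x \<noteq> y\<close>] closeness_in[OF in_S(2,3) \<open>y \<noteq> w\<close>]
  consider "precedes S y w" | "precedes S w y" "precedes S x w"
    | "precedes S w y" "\<not> precedes S x w"
    using precedes_total in_S \<open>y \<noteq> w\<close> by blast
  then show ?thesis
  proof cases
    case 1
    then show ?thesis
      using closeness_eq_min[OF in_S \<open>precedes S x y\<close> 1] closer \<open>precedes S x y\<close> in_S precedes_trans
      by (metis min_by_def)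
  next
    case 2
    then have "closeness S x y = min_by r (closeness S x w) (closeness S y w)"
      using closeness_eq_min[of x w y] closeness_sym in_S \<open>y \<noteq> w\<close> by metis
    then show ?thesis
      using closer 2(2) values_irrefl[OF vals(1)] by (auto simp: min_by_def split: if_splits)
  next
    case 3
    have "x \<noteq> w" using closer closeness_sym in_S \<open>x \<noteq> y\<close> values_irrefl[OF vals(1)] by metis
    then have "precedes S w x" using 3 precedes_total in_S by blast
    then have "closeness S y w = min_by r (closeness S w x) (closeness S x y)"
      using closeness_eq_min[of w x y] closeness_sym in_S \<open>y \<noteq> w\<close> \<open>precedes S x y\<close> by metis
    then have False
      using closer values_irrefl[OF vals(1)] values_asym[OF vals]
      by (auto simp: min_by_def split: if_splits)
    then show ?thesis ..
  qed
qed

end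

definition rich :: "'u set \<Rightarrow> ('a, 'u) colored_space \<Rightarrow> bool" where
  "rich U S \<longleftrightarrow> points S \<noteq> {} \<and> U \<noteq> {} \<and>
     (\<forall>b\<in>points S. \<forall>m\<in>U. \<forall>c. \<exists>z\<in>points S.
        precedes S b z \<and> closeness S b z = m \<and> colored S z = c) \<and>
     (\<forall>b\<in>points S. \<forall>m\<in>U. \<forall>c. \<exists>z\<in>points S.
        precedes S z b \<and> closeness S b z = m \<and> colored S z = c) \<and>
     (\<forall>b\<in>points S. \<forall>b'\<in>points S. \<forall>c. precedes S b b' \<longrightarrow> (\<exists>z\<in>points S.
        precedes S b z \<and> precedes S z b' \<and>
        closeness S b z = closeness S b b' \<and> closeness S b' z = closeness S b b' \<and>
        colored S z = c))"

lemma richD: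
  assumes "rich U S"
  shows rich_points_nonempty: "points S \<noteq> {}" and rich_values_nonempty: "U \<noteq> {}"
    and rich_above: "b \<in> points S \<Longrightarrow> m \<in> U \<Longrightarrow>
       \<exists>z\<in>points S. precedes S b z \<and> closeness S b z = m \<and> colored S z = c"
    and rich_below: "b \<in> points S \<Longrightarrow> m \<in> U \<Longrightarrow>
       \<exists>z\<in>points S. precedes S z b \<and> closeness S b z = m \<and> colored S z = c"
    and rich_middle: "b \<in> points S \<Longrightarrow> b' \<in> points S \<Longrightarrow> precedes S b b' \<Longrightarrow>
       \<exists>z\<in>points S. precedes S b z \<and> precedes S z b' \<and>
         closeness S b z = closeness S b b' \<and> closeness S b' z = closeness S b b' \<and> colored S z = c"
  using assms unfolding rich_def by simp_all

lemma (in convex_ultrametric) rich_dual: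
  assumes rich: "rich U S"
  shows "rich U (dual S)"
  unfolding rich_def dual_simps
proof (intro conjI ballI allI impI)
  fix b b' c assume b: "b \<in> points S" "b' \<in> points S" "precedes S b' b"
  then have "closeness S b' b = closeness S b b'" using closeness_sym precedes_irrefl by metis
  then show "\<exists>z\<in>points S. precedes S z b \<and> precedes S b' z \<and>
      closeness S b z = closeness S b b' \<and> closeness S b' z = closeness S b b' \<and> colored S z = c"
    using rich_middle[OF rich b(2,1,3), of c] by auto
qed (use richD[OF rich] in auto)

text \<open>If the prescribed values differ, then the point is chosen close enough to one end to lie on
  the right side of the other.\<close>

lemma (in convex_ultrametric) rich_between:
  assumes rich: "rich U S" and b: "b \<in> points S" "b' \<in> points S" "precedes S b b'"
    and vals: "m \<in> U" "n \<in> U" "closeness S b b' = min_by r m n"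
  shows "\<exists>z\<in>points S. precedes S b z \<and> precedes S z b' \<and>
           closeness S b z = m \<and> closeness S z b' = n \<and> colored S z = c"
proof -
  have "b \<noteq> b'" using b precedes_irrefl by blast
  consider "r m n" | "m = n" | "r n m" using values_total vals(1,2) by blast
  then show ?thesis
  proof cases
    case 1
    obtain z where z: "z \<in> points S" "precedes S z b'" "closeness S b' z = n" "colored S z = c"
      using rich_below[OF rich b(2) vals(2)] by blast
    then have "b' \<noteq> z" using precedes_irrefl by blast
    moreover have "closeness S b b' = m" using vals(3) 1 by (simp add: min_by_def)
    ultimately show ?thesis
      using precedes_closer_point[OF b(1,2) z(1) b(3)] closeness_sym[OF b(2) z(1)] z 1 by auto
  next
    case 2
    then have "closeness S b b' = m" using vals(3) by (simp add: min_by_def)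
    then obtain z where z: "z \<in> points S" "precedes S b z" "precedes S z b'"
      "closeness S b z = m" "closeness S b' z = m" "colored S z = c"
      using rich_middle[OF rich b] by metis
    then have "closeness S z b' = n" using closeness_sym[OF b(2) z(1)] precedes_irrefl 2 by metis
    then show ?thesis using z by blast
  next
    case 3
    interpret D: convex_ultrametric U r "dual S" by (rule convex_ultrametric_dual)
    obtain z where z: "z \<in> points S" "precedes S b z" "closeness S b z = m" "colored S z = c"
      using rich_above[OF rich b(1) vals(1)] by blast
    then have "b \<noteq> z" using precedes_irrefl by blast
    moreover have "closeness S b' b = n"
      using vals 3 values_asym closeness_sym[OF b(1,2) \<open>b \<noteq> b'\<close>] by (simp add: min_by_def)
    ultimately have "precedes S z b'" "closeness S b' z = n"
      using D.precedes_closer_point[of b' b z] b z 3 by auto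
    then show ?thesis using closeness_sym[OF b(2) z(1)] precedes_irrefl z by metis
  qed
qed

definition colored_iso ::
  "('u \<Rightarrow> 'w) \<Rightarrow> ('a \<Rightarrow> 'b) \<Rightarrow> ('a, 'u) colored_space \<Rightarrow> ('b, 'w) colored_space \<Rightarrow> bool" where
  "colored_iso h g S T \<longleftrightarrow> bij_betw g (points S) (points T) \<and>
     (\<forall>x\<in>points S. colored S x \<longleftrightarrow> colored T (g x)) \<and>
     (\<forall>x\<in>points S. \<forall>y\<in>points S. precedes S x y \<longleftrightarrow> precedes T (g x) (g y)) \<and>
     (\<forall>x\<in>points S. \<forall>y\<in>points S. x \<noteq> y \<longrightarrow> h (closeness S x y) = closeness T (g x) (g y))"

lemma
  assumes "colored_iso h g S T"
  shows colored_iso_bij_betw: "bij_betw g (points S) (points T)"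
    and colored_iso_inj_on: "inj_on g (points S)"
    and colored_iso_image: "points T = g ` points S"
    and colored_iso_colored: "x \<in> points S \<Longrightarrow> colored S x \<longleftrightarrow> colored T (g x)"
    and colored_iso_precedes:
      "x \<in> points S \<Longrightarrow> y \<in> points S \<Longrightarrow> precedes S x y \<longleftrightarrow> precedes T (g x) (g y)"
    and colored_iso_closeness: "x \<in> points S \<Longrightarrow> y \<in> points S \<Longrightarrow> x \<noteq> y \<Longrightarrow>
       h (closeness S x y) = closeness T (g x) (g y)"
  using assms unfolding colored_iso_def bij_betw_def by simp_all

lemma colored_iso_trans:
  assumes g: "colored_iso h g S T" and k: "colored_iso h' k T W"
  shows "colored_iso (h' \<circ> h) (k \<circ> g) S W"
proof -
  have "g x \<noteq> g y" if "x \<in> points S" "y \<in> points S" "x \<noteq> y" for x y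
    using that colored_iso_inj_on[OF g] by (auto dest: inj_onD)
  then show ?thesis
    using bij_betw_trans[OF colored_iso_bij_betw[OF g] colored_iso_bij_betw[OF k]]
      bij_betwE[OF colored_iso_bij_betw[OF g]] g k
    unfolding colored_iso_def by simp
qed

lemma convex_ultrametric_iso:
  assumes "convex_ultrametric U r S" and h: "order_iso h U r U' r'" and g: "colored_iso h g S T"
  shows "convex_ultrametric U' r' T"
proof -
  interpret convex_ultrametric U r S by fact
  have h_in: "h u \<in> U'" if "u \<in> U" for u
    using that order_iso_bij_betw[OF h] by (auto simp: bij_betw_def)
  show ?thesis
  proof
    show "strict_linorder_on U' r'" by (rule strict_linorder_on_order_iso[OF h values_linorder])
    have "order_iso g (points S) (precedes S) (points T) (precedes T)"
      using g unfolding colored_iso_def order_iso_def by blast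
    then show "strict_linorder_on (points T) (precedes T)"
      using points_linorder by (rule strict_linorder_on_order_iso)
  next
    fix x' y' assume "x' \<in> points T" "y' \<in> points T" "x' \<noteq> y'"
    then obtain x y where xy: "x \<in> points S" "y \<in> points S" "x \<noteq> y"
      and [simp]: "x' = g x" "y' = g y"
      unfolding colored_iso_image[OF g] by blast
    show "closeness T x' y' = closeness T y' x'"
      using colored_iso_closeness[OF g] closeness_sym xy by (metis \<open>x' = g x\<close> \<open>y' = g y\<close>)
    show "closeness T x' y' \<in> U'"
      using colored_iso_closeness[OF g xy] h_in[OF closeness_in[OF xy]] by simp
  next
    fix x' y' z'
    assume "x' \<in> points T" "y' \<in> points T" "z' \<in> points T"
      and lt: "precedes T x' y'" "precedes T y' z'"
    then obtain x y z where xyz: "x \<in> points S" "y \<in> points S" "z \<in> points S"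
      and [simp]: "x' = g x" "y' = g y" "z' = g z"
      unfolding colored_iso_image[OF g] by blast
    have xyz_lt: "precedes S x y" "precedes S y z" using lt colored_iso_precedes[OF g] xyz by auto
    then have ne: "x \<noteq> y" "y \<noteq> z" "x \<noteq> z" using precedes_irrefl precedes_asym xyz by blast+
    have "closeness T x' z' = h (min_by r (closeness S x y) (closeness S y z))"
      using colored_iso_closeness[OF g xyz(1,3) ne(3)] closeness_eq_min[OF xyz xyz_lt] by simp
    also have "\<dots> = min_by r' (closeness T x' y') (closeness T y' z')"
      using min_by_order_iso[OF h] closeness_in colored_iso_closeness[OF g] xyz ne by simp
    finally show "closeness T x' z' = min_by r' (closeness T x' y') (closeness T y' z')" .
  qed
qed

lemma rich_iso:
  assumes "convex_ultrametric U r S" and h: "bij_betw h U U'" and g: "colored_iso h g S T"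
    and rich: "rich U S"
  shows "rich U' T"
proof -
  interpret convex_ultrametric U r S by fact
  note points_T = colored_iso_image[OF g] and colored_T = colored_iso_colored[OF g]
    and precedes_T = colored_iso_precedes[OF g]
  have U': "U' = h ` U" using h by (simp add: bij_betw_def)
  have closeness_T: "closeness T (g x) (g y) = h (closeness S x y)"
    if "x \<in> points S" "y \<in> points S" "precedes S x y \<or> precedes S y x" for x y
    using colored_iso_closeness[OF g] that precedes_irrefl by metis
  show ?thesis
    unfolding rich_def points_T U'
  proof (intro conjI ballI allI impI)
    show "g ` points S \<noteq> {}" "h ` U \<noteq> {}"
      using rich_points_nonempty[OF rich] rich_values_nonempty[OF rich] by simp_all
  next
    fix b' m' c assume "b' \<in> g ` points S" "m' \<in> h ` U"
    then obtain b m where b: "b \<in> points S" "m \<in> U" and [simp]: "b' = g b" "m' = h m" by blast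
    obtain z where "z \<in> points S" "precedes S b z" "closeness S b z = m" "colored S z = c"
      using rich_above[OF rich b] by blast
    then show "\<exists>z\<in>g ` points S. precedes T b' z \<and> closeness T b' z = m' \<and> colored T z = c"
      using b precedes_T closeness_T colored_T by (intro bexI[of _ "g z"]) auto
    obtain z where "z \<in> points S" "precedes S z b" "closeness S b z = m" "colored S z = c"
      using rich_below[OF rich b] by blast
    then show "\<exists>z\<in>g ` points S. precedes T z b' \<and> closeness T b' z = m' \<and> colored T z = c"
      using b precedes_T closeness_T colored_T by (intro bexI[of _ "g z"]) auto
  next
    fix a' b' c assume "a' \<in> g ` points S" "b' \<in> g ` points S" "precedes T a' b'"
    then obtain a b where ab: "a \<in> points S" "b \<in> points S" "precedes S a b"
      and [simp]: "a' = g a" "b' = g b"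
      using precedes_T by blast
    obtain z where "z \<in> points S" "precedes S a z" "precedes S z b"
      "closeness S a z = closeness S a b" "closeness S b z = closeness S a b" "colored S z = c"
      using rich_middle[OF rich ab] by blast
    then show "\<exists>z\<in>g ` points S. precedes T a' z \<and> precedes T z b' \<and>
        closeness T a' z = closeness T a' b' \<and> closeness T b' z = closeness T a' b' \<and>
        colored T z = c"
      using ab precedes_T closeness_T colored_T by (intro bexI[of _ "g z"]) auto
  qed
qed

section \<open>Uniqueness of countable rich spaces\<close>

definition partial_iso ::
  "('u \<Rightarrow> 'w) \<Rightarrow> ('a, 'u) colored_space \<Rightarrow> ('b, 'w) colored_space \<Rightarrow> ('a \<times> 'b) set \<Rightarrow> bool" where
  "partial_iso h S T R \<longleftrightarrow> finite R \<and>
     (\<forall>a b. (a, b) \<in> R \<longrightarrow> a \<in> points S \<and> b \<in> points T \<and> (colored S a \<longleftrightarrow> colored T b)) \<and>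
     (\<forall>a b a' b'. (a, b) \<in> R \<longrightarrow> (a', b') \<in> R \<longrightarrow>
        (a = a' \<longleftrightarrow> b = b') \<and> (precedes S a a' \<longleftrightarrow> precedes T b b') \<and>
        (a \<noteq> a' \<longrightarrow> h (closeness S a a') = closeness T b b'))"

lemma partial_isoD:
  assumes "partial_iso h S T R"
  shows partial_iso_finite: "finite R"
    and partial_iso_points: "(a, b) \<in> R \<Longrightarrow> a \<in> points S \<and> b \<in> points T"
    and partial_iso_colored: "(a, b) \<in> R \<Longrightarrow> colored S a \<longleftrightarrow> colored T b"
    and partial_iso_eq: "(a, b) \<in> R \<Longrightarrow> (a', b') \<in> R \<Longrightarrow> a = a' \<longleftrightarrow> b = b'"
    and partial_iso_precedes:
      "(a, b) \<in> R \<Longrightarrow> (a', b') \<in> R \<Longrightarrow> precedes S a a' \<longleftrightarrow> precedes T b b'"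
    and partial_iso_closeness: "(a, b) \<in> R \<Longrightarrow> (a', b') \<in> R \<Longrightarrow> a \<noteq> a' \<Longrightarrow>
      h (closeness S a a') = closeness T b b'"
  using assms unfolding partial_iso_def by simp_all

lemma partial_isoI:
  assumes "finite R"
    and "\<And>a b. (a, b) \<in> R \<Longrightarrow> a \<in> points S \<and> b \<in> points T \<and> (colored S a \<longleftrightarrow> colored T b)"
    and "\<And>a b a' b'. (a, b) \<in> R \<Longrightarrow> (a', b') \<in> R \<Longrightarrow>
      (a = a' \<longleftrightarrow> b = b') \<and> (precedes S a a' \<longleftrightarrow> precedes T b b') \<and>
      (a \<noteq> a' \<longrightarrow> h (closeness S a a') = closeness T b b')"
  shows "partial_iso h S T R"
  using assms unfolding partial_iso_def by simp

lemma partial_iso_dual: "partial_iso h S T R \<Longrightarrow> partial_iso h (dual S) (dual T) R"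
  unfolding partial_iso_def by auto

lemma (in convex_ultrametric) partial_iso_cong:
  assumes R: "partial_iso h S T R" and eq: "\<And>u. u \<in> U \<Longrightarrow> h u = k u"
  shows "partial_iso k S T R"
proof (rule partial_isoI)
  fix a b a' b' assume ab: "(a, b) \<in> R" "(a', b') \<in> R"
  have "k (closeness S a a') = closeness T b b'" if "a \<noteq> a'"
    using partial_iso_closeness[OF R ab that] partial_iso_points[OF R] closeness_in ab that eq
    by metis
  then show "(a = a' \<longleftrightarrow> b = b') \<and> (precedes S a a' \<longleftrightarrow> precedes T b b') \<and>
      (a \<noteq> a' \<longrightarrow> k (closeness S a a') = closeness T b b')"
    using partial_iso_eq[OF R ab] partial_iso_precedes[OF R ab] by blast
qed (use partial_isoD(1-3)[OF R] in blast)+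

locale convex_ultrametric_pair =
  S: convex_ultrametric U r S + T: convex_ultrametric U' r' T
  for U :: "'u set" and r and S :: "('a, 'u) colored_space"
    and U' :: "'w set" and r' and T :: "('b, 'w) colored_space" +
  fixes h :: "'u \<Rightarrow> 'w"
  assumes order_iso: "order_iso h U r U' r'"
begin

lemma convex_ultrametric_pair_dual: "convex_ultrametric_pair U r (dual S) U' r' (dual T) h"
  by (intro convex_ultrametric_pair.intro S.convex_ultrametric_dual T.convex_ultrametric_dual
      convex_ultrametric_pair_axioms.intro order_iso)

lemma convex_ultrametric_pair_swap: "convex_ultrametric_pair U' r' T U r S (inv_into U h)"
  by (intro convex_ultrametric_pair.intro S.convex_ultrametric_axioms T.convex_ultrametric_axioms
      convex_ultrametric_pair_axioms.intro order_iso_inv_into order_iso)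

lemma partial_iso_converse:
  assumes R: "partial_iso h S T R"
  shows "partial_iso (inv_into U h) T S (R\<inverse>)"
proof (rule partial_isoI)
  fix b a b' a' assume "(b, a) \<in> R\<inverse>" "(b', a') \<in> R\<inverse>"
  then have ab: "(a, b) \<in> R" "(a', b') \<in> R" by blast+
  have "inv_into U h (closeness T b b') = closeness S a a'" if "a \<noteq> a'"
    using partial_iso_closeness[OF R ab that, symmetric] partial_iso_points[OF R] S.closeness_in
      ab that bij_betw_inv_into_left[OF order_iso_bij_betw[OF order_iso]] by auto
  then show "(b = b' \<longleftrightarrow> a = a') \<and> (precedes T b b' \<longleftrightarrow> precedes S a a') \<and>
      (b \<noteq> b' \<longrightarrow> inv_into U h (closeness T b b') = closeness S a a')"
    using partial_iso_eq[OF R ab] partial_iso_precedes[OF R ab] by blast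
next
  show "finite (R\<inverse>)" using partial_iso_finite[OF R] by simp
  show "b \<in> points T \<and> a \<in> points S \<and> (colored T b \<longleftrightarrow> colored S a)" if "(b, a) \<in> R\<inverse>" for b a
    using partial_iso_points[OF R] partial_iso_colored[OF R] that by blast
qed

lemma partial_iso_insert:
  assumes R: "partial_iso h S T R" and z: "z \<in> points S" and w: "w \<in> points T"
    and color: "colored S z \<longleftrightarrow> colored T w"
    and new: "\<And>a b. (a, b) \<in> R \<Longrightarrow>
      (precedes S a z \<and> precedes T b w \<or> precedes S z a \<and> precedes T w b) \<and>
      h (closeness S a z) = closeness T b w"
  shows "partial_iso h S T (insert (z, w) R)"
proof -
  have old_new: "a \<noteq> z \<and> b \<noteq> w \<and> (precedes S a z \<longleftrightarrow> precedes T b w) \<and>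
      (precedes S z a \<longleftrightarrow> precedes T w b) \<and> closeness S z a = closeness S a z \<and>
      closeness T w b = closeness T b w" if ab: "(a, b) \<in> R" for a b
  proof -
    have "a \<in> points S" "b \<in> points T" using partial_iso_points[OF R ab] by blast+
    then show ?thesis
      using new[OF ab] z w S.precedes_irrefl S.precedes_asym T.precedes_irrefl T.precedes_asym
        S.closeness_sym T.closeness_sym by metis
  qed
  show ?thesis
  proof (rule partial_isoI)
    show "finite (insert (z, w) R)" using partial_iso_finite[OF R] by simp
    show "a \<in> points S \<and> b \<in> points T \<and> (colored S a \<longleftrightarrow> colored T b)"
      if "(a, b) \<in> insert (z, w) R" for a b
      using that z w color partial_iso_points[OF R] partial_iso_colored[OF R] by blast
    fix a b a' b' assume "(a, b) \<in> insert (z, w) R" "(a', b') \<in> insert (z, w) R"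
    then consider "(a, b) \<in> R" "(a', b') \<in> R" | "(a, b) \<in> R" "a' = z" "b' = w"
      | "a = z" "b = w" "(a', b') \<in> R" | "a = z" "b = w" "a' = z" "b' = w" by blast
    then show "(a = a' \<longleftrightarrow> b = b') \<and> (precedes S a a' \<longleftrightarrow> precedes T b b') \<and>
        (a \<noteq> a' \<longrightarrow> h (closeness S a a') = closeness T b b')"
    proof cases
      case 1
      then show ?thesis
        using partial_iso_eq[OF R] partial_iso_precedes[OF R] partial_iso_closeness[OF R] by blast
    next
      case 2
      then show ?thesis using old_new new by simp
    next
      case 3
      then show ?thesis using old_new new by metis
    next
      case 4
      then show ?thesis using S.precedes_irrefl z T.precedes_irrefl w by blast
    qed
  qed
qed

lemma partial_iso_closeness_below:
  assumes R: "partial_iso h S T R" "(p, q) \<in> R" "(a, b) \<in> R"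
    and z: "z \<in> points S" "precedes S p z" and w: "w \<in> points T" "precedes T q w"
    and nearest: "h (closeness S p z) = closeness T q w" and a: "a = p \<or> precedes S a p"
  shows "precedes T b w \<and> h (closeness S a z) = closeness T b w"
proof (cases "a = p")
  case True
  then have "b = q" using partial_iso_eq[OF R(1,3,2)] by blast
  then show ?thesis using True w nearest by simp
next
  case False
  then have ap: "precedes S a p" using a by blast
  have in_S: "a \<in> points S" "p \<in> points S" and in_T: "b \<in> points T" "q \<in> points T"
    using partial_iso_points[OF R(1)] R(2,3) by blast+
  have "p \<noteq> z" using z S.precedes_irrefl by blast
  have bq: "precedes T b q" using partial_iso_precedes[OF R(1,3,2)] ap by blast
  have "closeness T b w = min_by r' (closeness T b q) (closeness T q w)"
    by (rule T.closeness_eq_min[OF in_T w(1) bq w(2)])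
  also have "\<dots> = h (min_by r (closeness S a p) (closeness S p z))"
    using partial_iso_closeness[OF R(1,3,2) False] nearest min_by_order_iso[OF order_iso]
      S.closeness_in[OF in_S False] S.closeness_in[OF in_S(2) z(1) \<open>p \<noteq> z\<close>] by simp
  also have "\<dots> = h (closeness S a z)"
    using S.closeness_eq_min[OF in_S z(1) ap z(2)] by simp
  finally show ?thesis using T.precedes_trans[OF in_T w(1) bq w(2)] by simp
qed

lemma partial_iso_closeness_above:
  assumes R: "partial_iso h S T R" "(p, q) \<in> R" "(a, b) \<in> R"
    and z: "z \<in> points S" "precedes S z p" and w: "w \<in> points T" "precedes T w q"
    and nearest: "h (closeness S p z) = closeness T q w" and a: "a = p \<or> precedes S p a"
  shows "precedes T w b \<and> h (closeness S a z) = closeness T b w"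
proof -
  interpret D: convex_ultrametric_pair U r "dual S" U' r' "dual T" h
    by (rule convex_ultrametric_pair_dual)
  show ?thesis
    using D.partial_iso_closeness_below[OF partial_iso_dual[OF R(1)] R(2,3)] z w nearest a by simp
qed

lemma nearest_below:
  assumes R: "partial_iso h S T R" and "(a, b) \<in> R" "precedes S a z"
  shows "\<exists>p q. (p, q) \<in> R \<and> precedes S p z \<and>
    (\<forall>a b. (a, b) \<in> R \<longrightarrow> precedes S a z \<longrightarrow> a = p \<or> precedes S a p)"
proof -
  have "finite (Domain R)" "Domain R \<subseteq> points S"
    using partial_iso_finite[OF R] partial_iso_points[OF R] by (auto simp: finite_Domain)
  moreover have "\<exists>a\<in>Domain R. precedes S a z" using assms(2,3) by blast
  ultimately obtain p where "p \<in> Domain R" "precedes S p z"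
    "\<forall>a\<in>Domain R. precedes S a z \<longrightarrow> a = p \<or> precedes S a p"
    using ex_greatest_below[OF S.points_linorder] by metis
  then show ?thesis by blast
qed

lemma nearest_above:
  assumes R: "partial_iso h S T R" and "(a, b) \<in> R" "precedes S z a"
  shows "\<exists>p q. (p, q) \<in> R \<and> precedes S z p \<and>
    (\<forall>a b. (a, b) \<in> R \<longrightarrow> precedes S z a \<longrightarrow> a = p \<or> precedes S p a)"
proof -
  interpret D: convex_ultrametric_pair U r "dual S" U' r' "dual T" h
    by (rule convex_ultrametric_pair_dual)
  show ?thesis using D.nearest_below[OF partial_iso_dual[OF R] assms(2)] assms(3) by simp
qed

lemma closeness_image_in:
  assumes "partial_iso h S T R" "(p, q) \<in> R" "z \<in> points S" "precedes S p z \<or> precedes S z p"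
  shows "h (closeness S p z) \<in> U'"
proof -
  have "p \<in> points S" "p \<noteq> z"
    using partial_iso_points[OF assms(1,2)] assms(3,4) S.precedes_irrefl by blast+
  then show ?thesis
    using bij_betwE[OF order_iso_bij_betw[OF order_iso]] S.closeness_in assms(3) by blast
qed

lemma partial_iso_insert_above:
  assumes rich: "rich U' T" and R: "partial_iso h S T R" "R \<noteq> {}" and z: "z \<in> points S"
    and above: "\<And>a b. (a, b) \<in> R \<Longrightarrow> precedes S a z"
  shows "\<exists>w\<in>points T. partial_iso h S T (insert (z, w) R)"
proof -
  obtain p q where pq: "(p, q) \<in> R" "precedes S p z"
    "\<And>a b. (a, b) \<in> R \<Longrightarrow> precedes S a z \<Longrightarrow> a = p \<or> precedes S a p"
    using R(2) above nearest_below[OF R(1)] by (metis all_not_in_conv surj_pair)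
  then obtain w where w: "w \<in> points T" "precedes T q w" "closeness T q w = h (closeness S p z)"
    "colored T w = colored S z"
    using rich_above[OF rich] closeness_image_in[OF R(1) pq(1) z] partial_iso_points[OF R(1)] by blast
  have "partial_iso h S T (insert (z, w) R)"
  proof (rule partial_iso_insert[OF R(1) z w(1)])
    fix a b assume ab: "(a, b) \<in> R"
    have "precedes T b w \<and> h (closeness S a z) = closeness T b w"
      by (rule partial_iso_closeness_below[OF R(1) pq(1) ab z pq(2) w(1,2)])
        (use w(3) pq(3)[OF ab] above[OF ab] in simp_all)
    then show "(precedes S a z \<and> precedes T b w \<or> precedes S z a \<and> precedes T w b) \<and>
        h (closeness S a z) = closeness T b w" using above[OF ab] by blast
  qed (use w(4) in simp)
  then show ?thesis using w(1) by blast
qed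

lemma partial_iso_insert_below:
  assumes rich: "rich U' T" and R: "partial_iso h S T R" "R \<noteq> {}" and z: "z \<in> points S"
    and below: "\<And>a b. (a, b) \<in> R \<Longrightarrow> precedes S z a"
  shows "\<exists>w\<in>points T. partial_iso h S T (insert (z, w) R)"
proof -
  interpret D: convex_ultrametric_pair U r "dual S" U' r' "dual T" h
    by (rule convex_ultrametric_pair_dual)
  have "\<exists>w\<in>points (dual T). partial_iso h (dual S) (dual T) (insert (z, w) R)"
    by (rule D.partial_iso_insert_above[OF T.rich_dual[OF rich] partial_iso_dual[OF R(1)] R(2)])
      (use z below in simp_all)
  then show ?thesis using partial_iso_dual[of h "dual S" "dual T"] by auto
qed

lemma ex_between_neighbours:
  assumes rich: "rich U' T" and R: "partial_iso h S T R" "(p, q) \<in> R" "(p', q') \<in> R"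
    and z: "z \<in> points S" "precedes S p z" "precedes S z p'"
  shows "\<exists>w\<in>points T. precedes T q w \<and> precedes T w q' \<and> closeness T q w = h (closeness S p z) \<and>
    closeness T q' w = h (closeness S p' z) \<and> colored T w = colored S z"
proof -
  have in_S: "p \<in> points S" "p' \<in> points S" and in_T: "q \<in> points T" "q' \<in> points T"
    using partial_iso_points[OF R(1)] R(2,3) by blast+
  have "precedes S p p'" by (rule S.precedes_trans[OF in_S(1) z(1) in_S(2) z(2,3)])
  then have qq': "precedes T q q'" and "p \<noteq> p'" "z \<noteq> p'" "p \<noteq> z"
    using partial_iso_precedes[OF R] S.precedes_irrefl in_S z by blast+
  have sym: "closeness S z p' = closeness S p' z"
    by (rule S.closeness_sym[OF z(1) in_S(2) \<open>z \<noteq> p'\<close>])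
  have "closeness T q q' = h (closeness S p p')"
    using partial_iso_closeness[OF R \<open>p \<noteq> p'\<close>] by simp
  also have "\<dots> = h (min_by r (closeness S p z) (closeness S p' z))"
    using S.closeness_eq_min[OF in_S(1) z(1) in_S(2) z(2,3)] sym by simp
  also have "\<dots> = min_by r' (h (closeness S p z)) (h (closeness S p' z))"
    using min_by_order_iso[OF order_iso] S.closeness_in in_S z(1) \<open>p \<noteq> z\<close> \<open>z \<noteq> p'\<close> by metis
  finally obtain w where w: "w \<in> points T" "precedes T q w" "precedes T w q'"
    "closeness T q w = h (closeness S p z)" "closeness T w q' = h (closeness S p' z)"
    "colored T w = colored S z"
    using T.rich_between[OF rich in_T qq'] closeness_image_in[OF R(1,2) z(1)] closeness_image_in[OF R(1,3) z(1)] z(2,3)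
    by blast
  then have "closeness T q' w = closeness T w q'"
    using T.closeness_sym[OF in_T(2) w(1)] T.precedes_irrefl[OF w(1)] by metis
  then show ?thesis using w by auto
qed

lemma partial_iso_insert_between:
  assumes rich: "rich U' T" and R: "partial_iso h S T R" and z: "z \<in> points S" "z \<notin> Domain R"
    and "(a, b) \<in> R" "precedes S a z" "(a', b') \<in> R" "precedes S z a'"
  shows "\<exists>w\<in>points T. partial_iso h S T (insert (z, w) R)"
proof -
  obtain p q where pq: "(p, q) \<in> R" "precedes S p z"
    "\<And>a b. (a, b) \<in> R \<Longrightarrow> precedes S a z \<Longrightarrow> a = p \<or> precedes S a p"
    using nearest_below[OF R assms(5,6)] by blast
  obtain p' q' where pq': "(p', q') \<in> R" "precedes S z p'"
    "\<And>a b. (a, b) \<in> R \<Longrightarrow> precedes S z a \<Longrightarrow> a = p' \<or> precedes S p' a"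
    using nearest_above[OF R assms(7,8)] by blast
  obtain w where w: "w \<in> points T" "precedes T q w" "precedes T w q'" "colored T w = colored S z"
    "closeness T q w = h (closeness S p z)" "closeness T q' w = h (closeness S p' z)"
    using ex_between_neighbours[OF rich R pq(1) pq'(1) z(1) pq(2) pq'(2)] by blast
  have "partial_iso h S T (insert (z, w) R)"
  proof (rule partial_iso_insert[OF R z(1) w(1)])
    fix a b assume ab: "(a, b) \<in> R"
    then have "a \<in> points S" "a \<noteq> z" using partial_iso_points[OF R] z(2) by blast+
    then consider "precedes S a z" | "precedes S z a" using S.precedes_total z(1) by blast
    then show "(precedes S a z \<and> precedes T b w \<or> precedes S z a \<and> precedes T w b) \<and>
        h (closeness S a z) = closeness T b w"
    proof cases
      case 1
      then show ?thesis
        using partial_iso_closeness_below[OF R pq(1) ab z(1) pq(2) w(1,2)] w(5) pq(3)[OF ab] by simp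
    next
      case 2
      then show ?thesis
        using partial_iso_closeness_above[OF R pq'(1) ab z(1) pq'(2) w(1,3)] w(6) pq'(3)[OF ab]
        by simp
    qed
  qed (use w(4) in simp)
  then show ?thesis using w(1) by blast
qed

lemma partial_iso_forth:
  assumes rich: "rich U' T" and R: "partial_iso h S T R" and z: "z \<in> points S"
  shows "\<exists>w\<in>points T. partial_iso h S T (insert (z, w) R)"
proof -
  have "a = z \<or> precedes S a z \<or> precedes S z a" if "(a, b) \<in> R" for a b
    using S.precedes_total partial_iso_points[OF R that] z by blast
  then consider (mem) "z \<in> Domain R" | (empty) "R = {}"
    | (above) "R \<noteq> {}" "\<And>a b. (a, b) \<in> R \<Longrightarrow> precedes S a z"
    | (below) "R \<noteq> {}" "\<And>a b. (a, b) \<in> R \<Longrightarrow> precedes S z a"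
    | (between) a b a' b' where "z \<notin> Domain R" "(a, b) \<in> R" "precedes S a z"
        "(a', b') \<in> R" "precedes S z a'"
    by blast
  then show ?thesis
  proof cases
    case mem
    then show ?thesis using R partial_iso_points[OF R] by (metis DomainE insert_absorb)
  next
    case empty
    obtain b m where "b \<in> points T" "m \<in> U'"
      using rich_points_nonempty[OF rich] rich_values_nonempty[OF rich] by blast
    then obtain w where "w \<in> points T" "colored T w = colored S z"
      using rich_above[OF rich] by blast
    then show ?thesis using partial_iso_insert[OF R z] empty by blast
  next
    case above
    then show ?thesis by (intro partial_iso_insert_above[OF rich R _ z])
  next
    case below
    then show ?thesis by (intro partial_iso_insert_below[OF rich R _ z])
  next
    case between
    then show ?thesis by (intro partial_iso_insert_between[OF rich R z])
  qed
qed

lemma partial_iso_back: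
  assumes "rich U S" and R: "partial_iso h S T R" and w: "w \<in> points T"
  shows "\<exists>z\<in>points S. partial_iso h S T (insert (z, w) R)"
proof -
  interpret C: convex_ultrametric_pair U' r' T U r S "inv_into U h"
    by (rule convex_ultrametric_pair_swap)
  obtain z where z: "z \<in> points S" "partial_iso (inv_into U h) T S (insert (w, z) (R\<inverse>))"
    using C.partial_iso_forth[OF assms(1) partial_iso_converse[OF R] w] by blast
  have "partial_iso h S T ((insert (w, z) (R\<inverse>))\<inverse>)"
    using C.partial_iso_converse[OF z(2)] inv_into_inv_into_eq[OF order_iso_bij_betw[OF order_iso]]
    by (rule S.partial_iso_cong)
  moreover have "(insert (w, z) (R\<inverse>))\<inverse> = insert (z, w) R" by auto
  ultimately show ?thesis using z(1) by auto
qed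

end

lemma back_and_forth:
  assumes "countable V" "countable W" "V \<noteq> {}" "W \<noteq> {}" "P {}"
    and forward: "\<And>R a. P R \<Longrightarrow> a \<in> V \<Longrightarrow> \<exists>b\<in>W. P (insert (a, b) R)"
    and backward: "\<And>R b. P R \<Longrightarrow> b \<in> W \<Longrightarrow> \<exists>a\<in>V. P (insert (a, b) R)"
  shows "\<exists>T. V \<subseteq> Domain T \<and> W \<subseteq> Range T \<and> (\<forall>p\<in>T. \<forall>q\<in>T. \<exists>R. P R \<and> p \<in> R \<and> q \<in> R)"
proof -
  let ?a = "from_nat_into V" and ?b = "from_nat_into W"
  have "\<exists>R'. R \<subseteq> R' \<and> P R' \<and> ?a n \<in> Domain R' \<and> ?b n \<in> Range R'" if PR: "P R" for R n
  proof -
    obtain b where "P (insert (?a n, b) R)" using forward[OF PR from_nat_into[OF assms(3)]] by blast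
    then obtain a where "P (insert (a, ?b n) (insert (?a n, b) R))"
      using backward from_nat_into[OF assms(4)] by blast
    then show ?thesis by (intro exI[of _ "insert (a, ?b n) (insert (?a n, b) R)"]) blast
  qed
  then obtain s where s: "\<And>R n. P R \<Longrightarrow>
      R \<subseteq> s R n \<and> P (s R n) \<and> ?a n \<in> Domain (s R n) \<and> ?b n \<in> Range (s R n)"
    by metis
  define Y where "Y = rec_nat {} (\<lambda>n R. s R n)"
  have Y_Suc: "Y (Suc n) = s (Y n) n" for n by (simp add: Y_def)
  have PY: "P (Y n)" for n by (induction n) (use s Y_Suc assms(5) in \<open>auto simp: Y_def\<close>)
  have mono: "Y m \<subseteq> Y n" if "m \<le> n" for m n
    using that by (rule lift_Suc_mono_le[of Y, rotated]) (use s[OF PY] Y_Suc in auto)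
  show ?thesis
  proof (rule exI[of _ "\<Union>n. Y n"], intro conjI subsetI ballI)
    show "x \<in> Domain (\<Union>n. Y n)" if "x \<in> V" for x
      using from_nat_into_surj[OF assms(1) that] s[OF PY] Y_Suc
      by (metis Domain_Union UN_I UNIV_I rangeI)
    show "x \<in> Range (\<Union>n. Y n)" if "x \<in> W" for x
      using from_nat_into_surj[OF assms(2) that] s[OF PY] Y_Suc
      by (metis Range_Union UN_I UNIV_I rangeI)
    fix p q assume "p \<in> (\<Union>n. Y n)" "q \<in> (\<Union>n. Y n)"
    then obtain m n where "p \<in> Y m" "q \<in> Y n" by blast
    then have "p \<in> Y (max m n)" "q \<in> Y (max m n)"
      using mono by (meson max.cobounded1 max.cobounded2 subsetD)+
    then show "\<exists>R. P R \<and> p \<in> R \<and> q \<in> R" using PY by blast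
  qed
qed

lemma (in convex_ultrametric_pair) countable_rich_unique:
  assumes rich: "rich U S" "rich U' T" and countable: "countable (points S)" "countable (points T)"
  shows "\<exists>g. colored_iso h g S T"
proof -
  have "\<exists>Q. points S \<subseteq> Domain Q \<and> points T \<subseteq> Range Q \<and>
      (\<forall>p\<in>Q. \<forall>q\<in>Q. \<exists>R. partial_iso h S T R \<and> p \<in> R \<and> q \<in> R)"
    by (rule back_and_forth)
      (use rich_points_nonempty rich partial_iso_forth partial_iso_back in
        \<open>simp_all add: countable partial_iso_def[of _ _ _ "{}"]\<close>)
  then obtain Q where Q: "points S \<subseteq> Domain Q" "points T \<subseteq> Range Q"
    and Q_partial: "\<And>p q. p \<in> Q \<Longrightarrow> q \<in> Q \<Longrightarrow> \<exists>R. partial_iso h S T R \<and> p \<in> R \<and> q \<in> R" by blast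
  obtain g where g: "\<And>x. x \<in> points S \<Longrightarrow> (x, g x) \<in> Q"
  proof -
    have "\<forall>x\<in>points S. \<exists>y. (x, y) \<in> Q" using Q(1) by blast
    then show thesis using that by metis
  qed
  have Q_iso: "a \<in> points S \<and> b \<in> points T \<and> (a = a' \<longleftrightarrow> b = b') \<and> (colored S a \<longleftrightarrow> colored T b) \<and>
      (precedes S a a' \<longleftrightarrow> precedes T b b') \<and> (a \<noteq> a' \<longrightarrow> h (closeness S a a') = closeness T b b')"
    if "(a, b) \<in> Q" "(a', b') \<in> Q" for a b a' b'
    using Q_partial[OF that] partial_isoD by metis
  have "bij_betw g (points S) (points T)"
    unfolding bij_betw_def
  proof
    show "inj_on g (points S)" using g Q_iso by (metis inj_onI)
    show "g ` points S = points T"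
    proof (intro equalityI subsetI)
      fix y assume "y \<in> points T"
      then obtain x where "(x, y) \<in> Q" using Q(2) by blast
      then have "x \<in> points S" "y = g x" using Q_iso g by metis+
      then show "y \<in> g ` points S" by blast
    qed (use g Q_iso in blast)
  qed
  then show ?thesis using g Q_iso unfolding colored_iso_def by (intro exI[of _ g]) blast
qed

section \<open>Structures satisfying the universal part of the class \<open>K\<close>\<close>

lemma ext_lang_simps [simp]:
  "F_sym \<in> Funs (ext_lang L0)" "OldF g \<in> Funs (ext_lang L0) \<longleftrightarrow> g \<in> Funs L0"
  "V_sym \<in> Rels (ext_lang L0)" "M_sym \<in> Rels (ext_lang L0)" "N_sym \<in> Rels (ext_lang L0)"
  "Tri_sym \<in> Rels (ext_lang L0)" "OldR r \<in> Rels (ext_lang L0) \<longleftrightarrow> r \<in> Rels L0"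
  "farity (ext_lang L0) (OldF g) = farity L0 g" "farity (ext_lang L0) F_sym = 2"
  "rarity (ext_lang L0) (OldR r) = rarity L0 r" "rarity (ext_lang L0) V_sym = 1"
  "rarity (ext_lang L0) M_sym = 1" "rarity (ext_lang L0) N_sym = 1"
  "rarity (ext_lang L0) Tri_sym = 2"
  by (auto simp: ext_lang_def)

lemma countable_ext_lang: "countable_lang L0 \<Longrightarrow> countable_lang (ext_lang L0)"
  unfolding countable_lang_def ext_lang_def by simp

lemma length_2_iff: "length xs = 2 \<longleftrightarrow> (\<exists>x y. xs = [x, y])"
  by (auto simp: length_Suc_conv numeral_2_eq_2)

lemma M_struct_simps [simp]:
  "univ (M_struct A) = M_part A" "funI (M_struct A) g = funI A (OldF g)"
  "relI (M_struct A) r = relI A (OldR r)"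
  by (simp_all add: M_struct_def)

definition V_space :: "('a, 'f, 'r) ext_struct \<Rightarrow> ('a, 'a) colored_space" where
  "V_space A = \<lparr>points = V_part A, precedes = tri A, closeness = fI A,
     colored = (\<lambda>x. relI A N_sym [x])\<rparr>"

lemma V_space_simps [simp]:
  "points (V_space A) = V_part A" "precedes (V_space A) = tri A" "closeness (V_space A) = fI A"
  "colored (V_space A) x \<longleftrightarrow> relI A N_sym [x]"
  by (simp_all add: V_space_def)

lemma V_part_subset: "V_part A \<subseteq> univ A" and M_part_subset: "M_part A \<subseteq> univ A"
  by (auto simp: V_part_def M_part_def)

abbreviation (input) binrel :: "('a, 'f, 'r) struct \<Rightarrow> 'r \<Rightarrow> 'a \<Rightarrow> 'a \<Rightarrow> bool" where
  "binrel A q \<equiv> \<lambda>x y. relI A q [x, y]"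

lemma is_iso_order_iso:
  assumes "is_iso L h A B" "q \<in> Rels L" "rarity L q = 2"
  shows "order_iso h (univ A) (binrel A q) (univ B) (binrel B q)"
  using is_iso_bij_betw[OF assms(1)] is_iso_rel[OF assms(1,2), of "[_, _]"] assms(3)
  unfolding order_iso_def by simp

lemma trivial_elsewhereD:
  assumes "trivial_elsewhere L0 A"
  shows "\<And>q xs. q \<in> Rels L0 \<Longrightarrow> length xs = rarity L0 q \<Longrightarrow> set xs \<subseteq> univ A \<Longrightarrow>
           relI A (OldR q) xs \<Longrightarrow> set xs \<subseteq> M_part A"
    "\<And>g xs. g \<in> Funs L0 \<Longrightarrow> length xs = farity L0 g \<Longrightarrow> set xs \<subseteq> univ A \<Longrightarrow>
           \<not> set xs \<subseteq> M_part A \<Longrightarrow> funI A (OldF g) xs = hd xs"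
    "\<And>x y. x \<in> univ A \<Longrightarrow> y \<in> univ A \<Longrightarrow> tri A x y \<Longrightarrow> x \<in> V_part A \<and> y \<in> V_part A"
    "\<And>x y. x \<in> univ A \<Longrightarrow> y \<in> univ A \<Longrightarrow> \<not> (x \<in> V_part A \<and> y \<in> V_part A \<and> x \<noteq> y) \<Longrightarrow>
       fI A x y = x"
  using assms unfolding trivial_elsewhere_def by blast+

lemma trivial_elsewhereI:
  assumes "\<And>q xs. q \<in> Rels L0 \<Longrightarrow> length xs = rarity L0 q \<Longrightarrow> set xs \<subseteq> univ A \<Longrightarrow>
           relI A (OldR q) xs \<Longrightarrow> set xs \<subseteq> M_part A"
    "\<And>g xs. g \<in> Funs L0 \<Longrightarrow> length xs = farity L0 g \<Longrightarrow> set xs \<subseteq> univ A \<Longrightarrow>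
           \<not> set xs \<subseteq> M_part A \<Longrightarrow> funI A (OldF g) xs = hd xs"
    "\<And>x y. x \<in> univ A \<Longrightarrow> y \<in> univ A \<Longrightarrow> tri A x y \<Longrightarrow> x \<in> V_part A \<and> y \<in> V_part A"
    "\<And>x y. x \<in> univ A \<Longrightarrow> y \<in> univ A \<Longrightarrow> \<not> (x \<in> V_part A \<and> y \<in> V_part A \<and> x \<noteq> y) \<Longrightarrow>
       fI A x y = x"
  shows "trivial_elsewhere L0 A"
  using assms unfolding trivial_elsewhere_def by blast

lemma hd_in_set_of_not_subset: "\<not> set xs \<subseteq> X \<Longrightarrow> hd xs \<in> set xs"
  by (cases xs) auto

text \<open>These are the clauses defining \<open>K\<close>, except that \<open>V\<close> may be infinite and the \<open>M\<close>-part is not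
  prescribed.\<close>

locale K_struct =
  convex_ultrametric "M_part A" "binrel (M_struct A) lt" "V_space A"
  for L0 :: "('f, 'r) lang" and lt :: 'r and A :: "('a, 'f, 'r) ext_struct" +
  assumes M_struct_is_struct: "is_struct L0 (M_struct A)"
    and univ_eq: "univ A = V_part A \<union> M_part A"
    and V_M_disjoint: "V_part A \<inter> M_part A = {}"
    and N_imp_V: "\<And>x. x \<in> univ A \<Longrightarrow> relI A N_sym [x] \<Longrightarrow> x \<in> V_part A"
    and trivial_elsewhere: "trivial_elsewhere L0 A"
begin

lemmas OldR_in_M = trivial_elsewhereD(1)[OF trivial_elsewhere]
  and OldF_outside_M = trivial_elsewhereD(2)[OF trivial_elsewhere]
  and tri_in_V = trivial_elsewhereD(3)[OF trivial_elsewhere]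
  and fI_outside_V = trivial_elsewhereD(4)[OF trivial_elsewhere]

lemma fI_in_M: "x \<in> V_part A \<Longrightarrow> y \<in> V_part A \<Longrightarrow> x \<noteq> y \<Longrightarrow> fI A x y \<in> M_part A"
  using closeness_in by simp

lemma is_struct_ext_lang: "is_struct (ext_lang L0) A"
proof (rule is_structI)
  show "univ A \<noteq> {}" using M_struct_is_struct univ_eq by (auto simp: is_struct_def)
  fix s xs
  assume s: "s \<in> Funs (ext_lang L0)" "length xs = farity (ext_lang L0) s" and xs: "set xs \<subseteq> univ A"
  show "funI A s xs \<in> univ A"
  proof (cases s)
    case (OldF g)
    then have g: "g \<in> Funs L0" "length xs = farity L0 g" using s by auto
    show ?thesis
    proof (cases "set xs \<subseteq> M_part A")
      case True
      then show ?thesis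
        using is_struct_closed[OF M_struct_is_struct g] M_part_subset[of A] OldF by auto
    next
      case False
      then show ?thesis
        using OldF_outside_M[OF g xs] hd_in_set_of_not_subset[OF False] xs OldF by auto
    qed
  next
    case F_sym
    then obtain x y where xy: "xs = [x, y]" "x \<in> univ A" "y \<in> univ A"
      using s(2) xs by (auto simp: length_2_iff)
    then show ?thesis
      using fI_in_M[of x y] fI_outside_V[of x y] M_part_subset[of A] F_sym
      by (cases "x \<in> V_part A \<and> y \<in> V_part A \<and> x \<noteq> y") auto
  qed
qed

end


lemma is_iso_V_part_iff:
  "is_iso (ext_lang L0) k A B \<Longrightarrow> x \<in> univ A \<Longrightarrow> k x \<in> V_part B \<longleftrightarrow> x \<in> V_part A"
  using is_iso_rel[of "ext_lang L0" k A B V_sym "[x]"] is_iso_image[of "ext_lang L0" k A B]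
  by (auto simp: V_part_def)

lemma is_iso_M_part_iff:
  "is_iso (ext_lang L0) k A B \<Longrightarrow> x \<in> univ A \<Longrightarrow> k x \<in> M_part B \<longleftrightarrow> x \<in> M_part A"
  using is_iso_rel[of "ext_lang L0" k A B M_sym "[x]"] is_iso_image[of "ext_lang L0" k A B]
  by (auto simp: M_part_def)

lemma is_iso_M_part_image:
  assumes k: "is_iso (ext_lang L0) k A B"
  shows "k ` M_part A = M_part B"
proof -
  have "M_part B \<subseteq> k ` univ A" unfolding is_iso_image[OF k] by (rule M_part_subset)
  then show ?thesis using is_iso_M_part_iff[OF k] M_part_subset[of A] by blast
qed

lemma is_iso_V_part_image:
  assumes k: "is_iso (ext_lang L0) k A B"
  shows "k ` V_part A = V_part B"
proof -
  have "V_part B \<subseteq> k ` univ A" unfolding is_iso_image[OF k] by (rule V_part_subset)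
  then show ?thesis using is_iso_V_part_iff[OF k] V_part_subset[of A] by blast
qed

lemma is_iso_M_struct:
  assumes k: "is_iso (ext_lang L0) k A B" and A: "is_struct L0 (M_struct A)"
  shows "is_iso L0 k (M_struct A) (M_struct B)"
proof (rule is_isoI[OF A])
  show "bij_betw k (univ (M_struct A)) (univ (M_struct B))"
    using is_iso_M_part_image[OF k] inj_on_subset[OF is_iso_inj_on[OF k] M_part_subset]
    by (simp add: bij_betw_def)
qed (use is_iso_fun[OF k, of "OldF _"] is_iso_rel[OF k, of "OldR _"] M_part_subset[of A] in auto)

lemma colored_iso_V_space:
  assumes k: "is_iso (ext_lang L0) k A B"
  shows "colored_iso k k (V_space A) (V_space B)"
proof -
  have "bij_betw k (V_part A) (V_part B)"
    using is_iso_V_part_image[OF k] inj_on_subset[OF is_iso_inj_on[OF k] V_part_subset]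
    by (simp add: bij_betw_def)
  then show ?thesis
    using is_iso_rel[OF k, of N_sym "[_]"] is_iso_rel[OF k, of Tri_sym "[_, _]"]
      is_iso_fun[OF k, of F_sym "[_, _]"] V_part_subset[of A]
    unfolding colored_iso_def by (auto simp: subset_iff)
qed

lemma trivial_elsewhere_iso:
  assumes k: "is_iso (ext_lang L0) k A B" and A: "trivial_elsewhere L0 A"
  shows "trivial_elsewhere L0 B"
proof (rule trivial_elsewhereI)
  note V_iff = is_iso_V_part_iff[OF k] and M_iff = is_iso_M_part_iff[OF k]
  have ex_preimage: "\<exists>ys. xs = map k ys \<and> set ys \<subseteq> univ A \<and> (set xs \<subseteq> M_part B \<longleftrightarrow> set ys \<subseteq> M_part A)"
    if xs: "set xs \<subseteq> univ B" for xs
  proof -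
    have "xs \<in> map k ` lists (univ A)"
      using xs unfolding is_iso_image[OF k, symmetric] lists_image[symmetric] by auto
    then obtain ys where "xs = map k ys" "set ys \<subseteq> univ A" by auto
    then show ?thesis using M_iff by (intro exI[of _ ys]) auto
  qed
  show "set xs \<subseteq> M_part B"
    if q: "q \<in> Rels L0" "length xs = rarity L0 q" "set xs \<subseteq> univ B" "relI B (OldR q) xs" for q xs
  proof -
    obtain ys where ys: "xs = map k ys" "set ys \<subseteq> univ A" "set xs \<subseteq> M_part B \<longleftrightarrow> set ys \<subseteq> M_part A"
      using ex_preimage[OF q(3)] by blast
    then show ?thesis
      using trivial_elsewhereD(1)[OF A q(1), of ys] is_iso_rel[OF k, of "OldR q" ys] q by simp
  qed
  show "funI B (OldF g) xs = hd xs"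
    if g: "g \<in> Funs L0" "length xs = farity L0 g" "set xs \<subseteq> univ B" "\<not> set xs \<subseteq> M_part B" for g xs
  proof -
    obtain ys where ys: "xs = map k ys" "set ys \<subseteq> univ A" "set xs \<subseteq> M_part B \<longleftrightarrow> set ys \<subseteq> M_part A"
      using ex_preimage[OF g(3)] by blast
    then have "funI A (OldF g) ys = hd ys" using trivial_elsewhereD(2)[OF A g(1), of ys] g by simp
    moreover have "ys \<noteq> []" using ys g(4) by auto
    ultimately show ?thesis
      using is_iso_fun[OF k, of "OldF g" ys] ys g by (simp add: hd_map)
  qed
  fix x' y' assume "x' \<in> univ B" "y' \<in> univ B"
  then obtain x y where xy: "x \<in> univ A" "y \<in> univ A" and [simp]: "x' = k x" "y' = k y"
    unfolding is_iso_image[OF k, symmetric] by blast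
  show "x' \<in> V_part B \<and> y' \<in> V_part B" if "tri B x' y'"
    using that trivial_elsewhereD(3)[OF A xy] is_iso_rel[OF k, of Tri_sym "[x, y]"] V_iff xy by simp
  show "fI B x' y' = x'" if "\<not> (x' \<in> V_part B \<and> y' \<in> V_part B \<and> x' \<noteq> y')"
  proof -
    have "fI A x y = x" by (rule trivial_elsewhereD(4)[OF A xy])
      (use that V_iff inj_on_eq_iff[OF is_iso_inj_on[OF k]] xy in auto)
    then show ?thesis using is_iso_fun[OF k, of F_sym "[x, y]"] xy by simp
  qed
qed

lemma K_struct_transport:
  assumes "K_struct L0 lt A" and k: "is_iso (ext_lang L0) k A B"
    and lt: "lt \<in> Rels L0" "rarity L0 lt = 2"
  shows "K_struct L0 lt B"
proof -
  interpret A: K_struct L0 lt A by fact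
  note M_iso = is_iso_M_struct[OF k A.M_struct_is_struct]
  note V_image = is_iso_V_part_image[OF k] and M_image = is_iso_M_part_image[OF k]
  have "convex_ultrametric (M_part B) (binrel (M_struct B) lt) (V_space B)"
    using convex_ultrametric_iso[OF A.convex_ultrametric_axioms _ colored_iso_V_space[OF k]]
      is_iso_order_iso[OF M_iso lt] by simp
  moreover have "V_part B \<inter> M_part B = {}"
    using A.V_M_disjoint inj_on_image_Int[OF is_iso_inj_on[OF k] V_part_subset M_part_subset]
    unfolding V_image[symmetric] M_image[symmetric] by simp
  moreover have "univ B = V_part B \<union> M_part B"
    using A.univ_eq is_iso_image[OF k] V_image M_image by (metis image_Un)
  moreover have "x' \<in> V_part B" if "x' \<in> univ B" "relI B N_sym [x']" for x'
  proof -
    obtain x where "x \<in> univ A" "x' = k x" using \<open>x' \<in> univ B\<close> is_iso_image[OF k] by blast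
    then show ?thesis
      using that(2) A.N_imp_V is_iso_rel[OF k, of N_sym "[x]"] is_iso_V_part_iff[OF k] by simp
  qed
  ultimately show ?thesis
    using is_iso_is_struct(2)[OF M_iso] trivial_elsewhere_iso[OF k A.trivial_elsewhere]
    by (intro K_struct.intro K_struct_axioms.intro)
qed

locale K_struct_iso =
  A: K_struct L0 lt A + B: K_struct L0 lt B
  for L0 :: "('f, 'r) lang" and lt and A :: "('a, 'f, 'r) ext_struct"
    and B :: "('b, 'f, 'r) ext_struct" +
  fixes k :: "'a \<Rightarrow> 'b"
  assumes M_iso: "is_iso L0 k (M_struct A) (M_struct B)"
    and V_iso: "colored_iso k k (V_space A) (V_space B)"
begin

lemma bij_betw_univ: "bij_betw k (univ A) (univ B)"
  unfolding A.univ_eq B.univ_eq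
  using bij_betw_combine[OF colored_iso_bij_betw[OF V_iso] is_iso_bij_betw[OF M_iso]] B.V_M_disjoint
  by simp

lemma in_univ: "x \<in> univ A \<Longrightarrow> k x \<in> univ B"
  using bij_betwE[OF bij_betw_univ] by blast

lemma V_part_iff: "k x \<in> V_part B \<longleftrightarrow> x \<in> V_part A"
  and M_part_iff: "k x \<in> M_part B \<longleftrightarrow> x \<in> M_part A" if "x \<in> univ A"
  using that bij_betwE[OF colored_iso_bij_betw[OF V_iso]] bij_betwE[OF is_iso_bij_betw[OF M_iso]]
    A.univ_eq B.V_M_disjoint by auto

lemma map_in_univ: "set xs \<subseteq> univ A \<Longrightarrow> set (map k xs) \<subseteq> univ B"
  using in_univ by auto

lemma map_M_part_iff: "set xs \<subseteq> univ A \<Longrightarrow> set (map k xs) \<subseteq> M_part B \<longleftrightarrow> set xs \<subseteq> M_part A"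
  using M_part_iff by auto

lemma OldF_hom:
  assumes g: "g \<in> Funs L0" "length xs = farity L0 g" and xs: "set xs \<subseteq> univ A"
  shows "k (funI A (OldF g) xs) = funI B (OldF g) (map k xs)"
proof (cases "set xs \<subseteq> M_part A")
  case True
  then show ?thesis using is_iso_fun[OF M_iso g] by simp
next
  case False
  then have "xs \<noteq> []" by auto
  then show ?thesis
    using A.OldF_outside_M[OF g xs False] B.OldF_outside_M[OF g(1) _ map_in_univ[OF xs]] g(2)
      map_M_part_iff[OF xs] False by (simp add: hd_map)
qed

lemma fI_hom:
  assumes "x \<in> univ A" "y \<in> univ A"
  shows "k (fI A x y) = fI B (k x) (k y)"
proof (cases "x \<in> V_part A \<and> y \<in> V_part A \<and> x \<noteq> y")
  case True
  then show ?thesis using colored_iso_closeness[OF V_iso, of x y] by simp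
next
  case False
  then have "\<not> (k x \<in> V_part B \<and> k y \<in> V_part B \<and> k x \<noteq> k y)" using V_part_iff assms by blast
  then show ?thesis
    using A.fI_outside_V[OF assms False] B.fI_outside_V in_univ assms by simp
qed

lemma OldR_iff:
  assumes q: "q \<in> Rels L0" "length xs = rarity L0 q" and xs: "set xs \<subseteq> univ A"
  shows "relI A (OldR q) xs \<longleftrightarrow> relI B (OldR q) (map k xs)"
proof (cases "set xs \<subseteq> M_part A")
  case True
  then show ?thesis using is_iso_rel[OF M_iso q] by simp
next
  case False
  then show ?thesis
    using A.OldR_in_M[OF q xs] B.OldR_in_M[OF q(1) _ map_in_univ[OF xs]] q(2) map_M_part_iff[OF xs]
    by auto
qed

lemma N_iff: "x \<in> univ A \<Longrightarrow> relI A N_sym [x] \<longleftrightarrow> relI B N_sym [k x]"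
  using colored_iso_colored[OF V_iso, of x] A.N_imp_V[of x] B.N_imp_V[OF in_univ] V_part_iff by auto

lemma tri_iff: "x \<in> univ A \<Longrightarrow> y \<in> univ A \<Longrightarrow> tri A x y \<longleftrightarrow> tri B (k x) (k y)"
  using colored_iso_precedes[OF V_iso, of x y] A.tri_in_V[of x y] B.tri_in_V[OF in_univ in_univ]
    V_part_iff by auto

lemma is_iso_ext_lang: "is_iso (ext_lang L0) k A B"
proof (rule is_isoI[OF A.is_struct_ext_lang bij_betw_univ])
  show "k (funI A s xs) = funI B s (map k xs)"
    if "s \<in> Funs (ext_lang L0)" "length xs = farity (ext_lang L0) s" "set xs \<subseteq> univ A" for s xs
    using that by (cases s) (auto simp: OldF_hom fI_hom length_2_iff)
  show "relI A s xs \<longleftrightarrow> relI B s (map k xs)"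
    if s: "s \<in> Rels (ext_lang L0)" "length xs = rarity (ext_lang L0) s" "set xs \<subseteq> univ A" for s xs
  proof (cases s)
    case (OldR q)
    then show ?thesis using OldR_iff s by simp
  next
    case V_sym
    then show ?thesis using V_part_iff in_univ s by (auto simp: length_Suc_conv V_part_def)
  next
    case M_sym
    then show ?thesis using M_part_iff in_univ s by (auto simp: length_Suc_conv M_part_def)
  next
    case N_sym
    then show ?thesis using N_iff s by (auto simp: length_Suc_conv)
  next
    case Tri_sym
    then show ?thesis using tri_iff s by (auto simp: length_2_iff)
  qed
qed

end

lemma (in convex_ultrametric) colored_iso_cong:
  assumes "colored_iso h g S T"
    and "\<And>u. u \<in> U \<Longrightarrow> h u = h' u" "\<And>x. x \<in> points S \<Longrightarrow> g x = g' x"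
  shows "colored_iso h' g' S T"
  using assms bij_betw_cong[of "points S" g g'] closeness_in unfolding colored_iso_def by simp

lemma is_iso_glue:
  assumes A: "K_struct L0 lt A" and B: "K_struct L0 lt B"
    and M: "is_iso L0 h (M_struct A) (M_struct B)" and V: "colored_iso h g (V_space A) (V_space B)"
  shows "is_iso (ext_lang L0) (\<lambda>x. if x \<in> M_part A then h x else g x) A B"
proof -
  let ?k = "\<lambda>x. if x \<in> M_part A then h x else g x"
  interpret A: K_struct L0 lt A by fact
  have "is_iso L0 ?k (M_struct A) (M_struct B)" by (rule is_iso_cong[OF M]) simp
  moreover have "colored_iso ?k ?k (V_space A) (V_space B)"
    by (rule A.colored_iso_cong[OF V]) (use A.V_M_disjoint in auto)
  ultimately interpret K_struct_iso L0 lt A B ?k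
    by (intro K_struct_iso.intro K_struct_iso_axioms.intro A B)
  show ?thesis by (rule is_iso_ext_lang)
qed

lemma countable_rich_struct_iso:
  assumes A: "K_struct L0 lt A" "rich (M_part A) (V_space A)" "countable (univ A)"
    and B: "K_struct L0 lt B" "rich (M_part B) (V_space B)" "countable (univ B)"
    and lt: "lt \<in> Rels L0" "rarity L0 lt = 2" and M: "isomorphic L0 (M_struct A) (M_struct B)"
  shows "isomorphic (ext_lang L0) A B"
proof -
  interpret A: K_struct L0 lt A by fact
  interpret B: K_struct L0 lt B by fact
  obtain h where h: "is_iso L0 h (M_struct A) (M_struct B)"
    using M unfolding isomorphic_def by blast
  interpret convex_ultrametric_pair "M_part A" "binrel (M_struct A) lt" "V_space A"
    "M_part B" "binrel (M_struct B) lt" "V_space B" h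
    by unfold_locales (use is_iso_order_iso[OF h lt] in simp)
  have "countable (V_part A)" "countable (V_part B)"
    by (rule countable_subset[OF V_part_subset]; fact)+
  then obtain g where "colored_iso h g (V_space A) (V_space B)"
    using countable_rich_unique[OF A(2) B(2)] by auto
  then show ?thesis using is_iso_glue[OF A(1) B(1) h] unfolding isomorphic_def by blast
qed

lemma V_part_restrict_to: "X \<subseteq> univ A \<Longrightarrow> V_part (restrict_to A X) = V_part A \<inter> X"
  and M_part_restrict_to: "X \<subseteq> univ A \<Longrightarrow> M_part (restrict_to A X) = M_part A \<inter> X"
  by (auto simp: V_part_def M_part_def)

lemma M_struct_restrict_to:
  "X \<subseteq> univ A \<Longrightarrow> M_struct (restrict_to A X) = restrict_to (M_struct A) (M_part A \<inter> X)"
  by (auto simp: M_struct_def M_part_def restrict_to_def)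

lemma V_space_restrict_to:
  "X \<subseteq> univ A \<Longrightarrow> V_space (restrict_to A X) = V_space A\<lparr>points := V_part A \<inter> X\<rparr>"
  by (simp add: V_space_def V_part_restrict_to)

lemma (in convex_ultrametric) convex_ultrametric_subspace:
  assumes "P \<subseteq> points S" "W \<subseteq> U"
    and "\<And>x y. x \<in> P \<Longrightarrow> y \<in> P \<Longrightarrow> x \<noteq> y \<Longrightarrow> closeness S x y \<in> W"
  shows "convex_ultrametric W r (S\<lparr>points := P\<rparr>)"
proof
  show "strict_linorder_on W r" by (rule strict_linorder_on_subset[OF values_linorder assms(2)])
  show "strict_linorder_on (points (S\<lparr>points := P\<rparr>)) (precedes (S\<lparr>points := P\<rparr>))"
    using strict_linorder_on_subset[OF points_linorder assms(1)] by simp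
qed (use assms closeness_sym closeness_eq_min in \<open>auto simp: subset_iff\<close>)

lemma (in K_struct) K_struct_restrict_to:
  assumes X: "X \<subseteq> univ A" and "is_struct L0 (M_struct (restrict_to A X))"
    and fI_in: "\<And>x y. x \<in> V_part A \<inter> X \<Longrightarrow> y \<in> V_part A \<inter> X \<Longrightarrow> x \<noteq> y \<Longrightarrow> fI A x y \<in> X"
  shows "K_struct L0 lt (restrict_to A X)"
proof (intro K_struct.intro K_struct_axioms.intro)
  note parts = V_part_restrict_to[OF X] M_part_restrict_to[OF X]
  have "convex_ultrametric (M_part A \<inter> X) (binrel (M_struct A) lt)
      (V_space A\<lparr>points := V_part A \<inter> X\<rparr>)"
    by (rule convex_ultrametric_subspace) (use fI_in fI_in_M in auto)
  then show "convex_ultrametric (M_part (restrict_to A X)) (binrel (M_struct (restrict_to A X)) lt)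
      (V_space (restrict_to A X))"
    by (simp add: parts V_space_restrict_to[OF X])
  show "univ (restrict_to A X) = V_part (restrict_to A X) \<union> M_part (restrict_to A X)"
    "V_part (restrict_to A X) \<inter> M_part (restrict_to A X) = {}"
    using univ_eq V_M_disjoint X by (auto simp: parts)
  show "x \<in> V_part (restrict_to A X)"
    if "x \<in> univ (restrict_to A X)" "relI (restrict_to A X) N_sym [x]" for x
    using that N_imp_V X by (auto simp: parts)
  show "trivial_elsewhere L0 (restrict_to A X)"
  proof (rule trivial_elsewhereI)
    fix q xs assume "q \<in> Rels L0" "length xs = rarity L0 q" "set xs \<subseteq> univ (restrict_to A X)"
      "relI (restrict_to A X) (OldR q) xs"
    then show "set xs \<subseteq> M_part (restrict_to A X)" using OldR_in_M[of q xs] X by (simp add: parts)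
  next
    fix g xs assume "g \<in> Funs L0" "length xs = farity L0 g" "set xs \<subseteq> univ (restrict_to A X)"
      "\<not> set xs \<subseteq> M_part (restrict_to A X)"
    then show "funI (restrict_to A X) (OldF g) xs = hd xs"
      using OldF_outside_M[of g xs] X by (simp add: parts)
  next
    fix x y assume xy: "x \<in> univ (restrict_to A X)" "y \<in> univ (restrict_to A X)"
    then have "x \<in> univ A" "y \<in> univ A" using X by auto
    from tri_in_V[OF this] fI_outside_V[OF this] xy
    show "tri (restrict_to A X) x y \<Longrightarrow> x \<in> V_part (restrict_to A X) \<and> y \<in> V_part (restrict_to A X)"
      and "\<not> (x \<in> V_part (restrict_to A X) \<and> y \<in> V_part (restrict_to A X) \<and> x \<noteq> y) \<Longrightarrow>
        fI (restrict_to A X) x y = x"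
      by (auto simp: parts)
  qed
qed (fact assms(2))

lemma (in K_struct)
  assumes S: "S \<subseteq> V_part A"
  shows K_struct_Un_M_part: "K_struct L0 lt (restrict_to A (S \<union> M_part A))"
    and V_part_Un_M_part: "V_part (restrict_to A (S \<union> M_part A)) = S"
    and M_part_Un_M_part: "M_part (restrict_to A (S \<union> M_part A)) = M_part A"
    and M_struct_Un_M_part: "M_struct (restrict_to A (S \<union> M_part A)) = M_struct A"
proof -
  have X: "S \<union> M_part A \<subseteq> univ A" using S univ_eq by blast
  show "V_part (restrict_to A (S \<union> M_part A)) = S"
    using V_part_restrict_to[OF X] S V_M_disjoint by blast
  show M: "M_part (restrict_to A (S \<union> M_part A)) = M_part A"
    using M_part_restrict_to[OF X] by blast
  then show M_struct: "M_struct (restrict_to A (S \<union> M_part A)) = M_struct A"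
    by (simp add: M_struct_def)
  show "K_struct L0 lt (restrict_to A (S \<union> M_part A))"
    by (rule K_struct_restrict_to[OF X]) (use M_struct M_struct_is_struct fI_in_M in auto)
qed

lemma convex_ultrametric_local:
  assumes local: "\<And>P W. finite P \<Longrightarrow> P \<subseteq> points S \<Longrightarrow> finite W \<Longrightarrow> W \<subseteq> U \<Longrightarrow>
    \<exists>P' W'. P \<subseteq> P' \<and> W \<subseteq> W' \<and> W' \<subseteq> U \<and> convex_ultrametric W' r (S\<lparr>points := P'\<rparr>)"
  shows "convex_ultrametric U r S"
proof
  show "strict_linorder_on U r"
  proof (rule strict_linorder_on_local)
    show "\<exists>W'. W \<subseteq> W' \<and> strict_linorder_on W' r" if W: "finite W" "W \<subseteq> U" for W
    proof -
      obtain P' W' where "W \<subseteq> W'" "convex_ultrametric W' r (S\<lparr>points := P'\<rparr>)"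
        using local[of "{}" W] W by auto
      then show ?thesis using convex_ultrametric.values_linorder by blast
    qed
  qed
  show "strict_linorder_on (points S) (precedes S)"
  proof (rule strict_linorder_on_local)
    show "\<exists>P'. P \<subseteq> P' \<and> strict_linorder_on P' (precedes S)" if P: "finite P" "P \<subseteq> points S" for P
    proof -
      obtain P' W' where "P \<subseteq> P'" "convex_ultrametric W' r (S\<lparr>points := P'\<rparr>)"
        using local[of P "{}"] P by auto
      then show ?thesis
        using convex_ultrametric.points_linorder[of W' r "S\<lparr>points := P'\<rparr>"] by auto
    qed
  qed
next
  fix x y assume xy: "x \<in> points S" "y \<in> points S" "x \<noteq> y"
  then obtain P' W' where "x \<in> P'" "y \<in> P'" "W' \<subseteq> U" "convex_ultrametric W' r (S\<lparr>points := P'\<rparr>)"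
    using local[of "{x, y}" "{}"] by auto
  then show "closeness S x y = closeness S y x" "closeness S x y \<in> U"
    using convex_ultrametric.closeness_sym[of W' r "S\<lparr>points := P'\<rparr>" x y]
      convex_ultrametric.closeness_in[of W' r "S\<lparr>points := P'\<rparr>" x y] xy(3) by auto
next
  fix x y z
  assume xyz: "x \<in> points S" "y \<in> points S" "z \<in> points S" "precedes S x y" "precedes S y z"
  then obtain P' W' where "x \<in> P'" "y \<in> P'" "z \<in> P'" "convex_ultrametric W' r (S\<lparr>points := P'\<rparr>)"
    using local[of "{x, y, z}" "{}"] by auto
  then show "closeness S x z = min_by r (closeness S x y) (closeness S y z)"
    using convex_ultrametric.closeness_eq_min[of W' r "S\<lparr>points := P'\<rparr>" x y z] xyz by simp
qed

lemma trivial_elsewhere_local: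
  assumes local: "\<And>S. finite S \<Longrightarrow> S \<subseteq> univ A \<Longrightarrow>
    \<exists>X. S \<subseteq> X \<and> X \<subseteq> univ A \<and> trivial_elsewhere L0 (restrict_to A X)"
  shows "trivial_elsewhere L0 A"
proof (rule trivial_elsewhereI)
  have local_list: "\<exists>X. set xs \<subseteq> X \<and> X \<subseteq> univ A \<and> trivial_elsewhere L0 (restrict_to A X)"
    if "set xs \<subseteq> univ A" for xs
    by (rule local) (use that in auto)
  show "set xs \<subseteq> M_part A"
    if q: "q \<in> Rels L0" "length xs = rarity L0 q" "set xs \<subseteq> univ A" "relI A (OldR q) xs" for q xs
  proof -
    obtain X where X: "set xs \<subseteq> X" "X \<subseteq> univ A" "trivial_elsewhere L0 (restrict_to A X)"
      using local_list[OF q(3)] by blast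
    then show ?thesis
      using trivial_elsewhereD(1)[OF X(3) q(1,2)] q(4) M_part_restrict_to[OF X(2)] by simp
  qed
  show "funI A (OldF g) xs = hd xs"
    if g: "g \<in> Funs L0" "length xs = farity L0 g" "set xs \<subseteq> univ A" "\<not> set xs \<subseteq> M_part A" for g xs
  proof -
    obtain X where X: "set xs \<subseteq> X" "X \<subseteq> univ A" "trivial_elsewhere L0 (restrict_to A X)"
      using local_list[OF g(3)] by blast
    then show ?thesis
      using trivial_elsewhereD(2)[OF X(3) g(1,2)] g(4) M_part_restrict_to[OF X(2)] by simp
  qed
  fix x y assume "x \<in> univ A" "y \<in> univ A"
  then obtain X where X: "x \<in> X" "y \<in> X" "X \<subseteq> univ A" "trivial_elsewhere L0 (restrict_to A X)"
    using local_list[of "[x, y]"] by auto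
  show "tri A x y \<Longrightarrow> x \<in> V_part A \<and> y \<in> V_part A"
    "\<not> (x \<in> V_part A \<and> y \<in> V_part A \<and> x \<noteq> y) \<Longrightarrow> fI A x y = x"
    using trivial_elsewhereD(3,4)[OF X(4), of x y] X(1,2) V_part_restrict_to[OF X(3)] by auto
qed

lemma K_struct_local:
  assumes "is_struct L0 (M_struct A)"
    and local: "\<And>S. finite S \<Longrightarrow> S \<subseteq> univ A \<Longrightarrow>
      \<exists>X. S \<subseteq> X \<and> X \<subseteq> univ A \<and> K_struct L0 lt (restrict_to A X)"
  shows "K_struct L0 lt A"
proof (intro K_struct.intro K_struct_axioms.intro)
  have parts: "V_part A \<subseteq> univ A" "M_part A \<subseteq> univ A" by (rule V_part_subset M_part_subset)+
  have local_point: "x \<in> V_part A \<union> M_part A \<and> x \<notin> V_part A \<inter> M_part A \<and>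
      (relI A N_sym [x] \<longrightarrow> x \<in> V_part A)" if "x \<in> univ A" for x
  proof -
    obtain X where X: "x \<in> X" "X \<subseteq> univ A" "K_struct L0 lt (restrict_to A X)"
      using local[of "{x}"] \<open>x \<in> univ A\<close> by auto
    interpret K_struct L0 lt "restrict_to A X" by (rule X(3))
    show ?thesis
      using univ_eq V_M_disjoint N_imp_V[of x] X(1)
      unfolding V_part_restrict_to[OF X(2)] M_part_restrict_to[OF X(2)] by auto
  qed
  then show "univ A = V_part A \<union> M_part A" "V_part A \<inter> M_part A = {}"
    using parts by blast+
  show "x \<in> V_part A" if "x \<in> univ A" "relI A N_sym [x]" for x
    using local_point that by blast
  show "trivial_elsewhere L0 A"
    by (rule trivial_elsewhere_local) (use local K_struct.trivial_elsewhere in meson)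
  show "convex_ultrametric (M_part A) (binrel (M_struct A) lt) (V_space A)"
  proof (rule convex_ultrametric_local)
    fix P W assume "finite P" "P \<subseteq> points (V_space A)" "finite W" "W \<subseteq> M_part A"
    then have "finite (P \<union> W)" "P \<union> W \<subseteq> univ A" using parts by auto
    from local[OF this]
    obtain X where X: "P \<union> W \<subseteq> X" "X \<subseteq> univ A" "K_struct L0 lt (restrict_to A X)" by metis
    have "convex_ultrametric (M_part A \<inter> X) (binrel (M_struct A) lt)
        (V_space A\<lparr>points := V_part A \<inter> X\<rparr>)"
      using K_struct.axioms(1)[OF X(3)]
      by (simp add: V_space_restrict_to[OF X(2)] M_part_restrict_to[OF X(2)])
    then show "\<exists>P' W'. P \<subseteq> P' \<and> W \<subseteq> W' \<and> W' \<subseteq> M_part A \<and>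
        convex_ultrametric W' (binrel (M_struct A) lt) (V_space A\<lparr>points := P'\<rparr>)"
      using X(1) \<open>P \<subseteq> points (V_space A)\<close> \<open>W \<subseteq> M_part A\<close>
      by (intro exI[of _ "V_part A \<inter> X"] exI[of _ "M_part A \<inter> X"]) auto
  qed
qed (fact assms(1))

lemma K_class_imp_K_struct:
  assumes M: "strict_linorder_on (univ M) (binrel M lt)" and lt: "lt \<in> Rels L0" "rarity L0 lt = 2"
    and K: "K_class L0 lt M A"
  shows "K_struct L0 lt A"
proof -
  have iso: "is_iso L0 Inl M (M_struct A)" using K unfolding K_class_def M_part_is_def by simp
  have V: "strict_linorder_on (V_part A) (tri A)"
    and fI: "\<And>x y. x \<in> V_part A \<Longrightarrow> y \<in> V_part A \<Longrightarrow> x \<noteq> y \<Longrightarrow>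
      fI A x y = fI A y x \<and> fI A x y \<in> M_part A"
    and triple: "\<And>x y z. x \<in> V_part A \<Longrightarrow> y \<in> V_part A \<Longrightarrow> z \<in> V_part A \<Longrightarrow> tri A x y \<Longrightarrow> tri A y z \<Longrightarrow>
       fI A x y = fI A x z \<and> fI A x z = fI A y z \<or>
       fI A x y = fI A x z \<and> relI A (OldR lt) [fI A x z, fI A y z] \<or>
       fI A x z = fI A y z \<and> relI A (OldR lt) [fI A y z, fI A x y]"
    using K unfolding K_class_def by simp_all
  have M_linorder: "strict_linorder_on (M_part A) (binrel (M_struct A) lt)"
    using strict_linorder_on_order_iso[OF is_iso_order_iso[OF iso lt] M] by simp
  have "convex_ultrametric (M_part A) (binrel (M_struct A) lt) (V_space A)"
  proof
    fix x y z
    assume xyz: "x \<in> points (V_space A)" "y \<in> points (V_space A)" "z \<in> points (V_space A)"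
      "precedes (V_space A) x y" "precedes (V_space A) y z"
    then have "fI A x y \<in> M_part A" "fI A y z \<in> M_part A"
      using fI strict_linorder_on_irrefl[OF V] by auto
    from eq_min_by_iff[OF M_linorder this]
    show "closeness (V_space A) x z = min_by (binrel (M_struct A) lt) (closeness (V_space A) x y)
        (closeness (V_space A) y z)"
      using triple[of x y z] xyz by auto
  qed (use M_linorder V fI in auto)
  then show ?thesis
    using K is_iso_is_struct(2)[OF iso] unfolding K_class_def
    by (intro K_struct.intro K_struct_axioms.intro) auto
qed

lemma K_struct_imp_K_class:
  assumes "K_struct L0 lt A" "countable (univ A)" "finite (V_part A)" "M_part_is L0 A M"
  shows "K_class L0 lt M A"
proof -
  interpret K_struct L0 lt A by fact
  have "fI A x y = fI A x z \<and> fI A x z = fI A y z \<or>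
      fI A x y = fI A x z \<and> relI A (OldR lt) [fI A x z, fI A y z] \<or>
      fI A x z = fI A y z \<and> relI A (OldR lt) [fI A y z, fI A x y]"
    if xyz: "x \<in> V_part A" "y \<in> V_part A" "z \<in> V_part A" "tri A x y" "tri A y z" for x y z
  proof -
    have "x \<noteq> y" "y \<noteq> z" using precedes_irrefl xyz by auto
    then show ?thesis
      using eq_min_by_iff[OF values_linorder, of "fI A x y" "fI A y z" "fI A x z"]
        closeness_eq_min[of x y z] fI_in_M xyz by simp
  qed
  moreover have "\<forall>x\<in>univ A. relI A N_sym [x] \<longrightarrow> x \<in> V_part A" using N_imp_V by blast
  ultimately show ?thesis
    using assms is_struct_ext_lang points_linorder closeness_sym fI_in_M univ_eq V_M_disjoint
      trivial_elsewhere
    unfolding K_class_def by simp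
qed

section \<open>The structure built from a convexly ordered ultrametric space\<close>

definition sum_struct ::
  "('m, 'f, 'r) struct \<Rightarrow> ('v, 'm) colored_space \<Rightarrow> ('m + 'v, 'f, 'r) ext_struct" where
  "sum_struct M S =
    \<lparr>univ = Inl ` univ M \<union> Inr ` points S,
     funI = (\<lambda>s xs. case s of
        OldF g \<Rightarrow> if set xs \<subseteq> range Inl then Inl (funI M g (map projl xs)) else hd xs
      | F_sym \<Rightarrow> if \<exists>x y. xs = [Inr x, Inr y] \<and> x \<noteq> y
                 then Inl (closeness S (projr (xs ! 0)) (projr (xs ! 1))) else hd xs),
     relI = (\<lambda>s xs. case s of
        OldR q \<Rightarrow> set xs \<subseteq> range Inl \<and> relI M q (map projl xs)
      | V_sym \<Rightarrow> \<exists>x. xs = [Inr x]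
      | M_sym \<Rightarrow> \<exists>x. xs = [Inl x]
      | N_sym \<Rightarrow> \<exists>x. xs = [Inr x] \<and> colored S x
      | Tri_sym \<Rightarrow> \<exists>x y. xs = [Inr x, Inr y] \<and> precedes S x y)\<rparr>"

lemma sum_struct_simps [simp]:
  "univ (sum_struct M S) = Inl ` univ M \<union> Inr ` points S"
  "V_part (sum_struct M S) = Inr ` points S"
  "M_part (sum_struct M S) = Inl ` univ M"
  "tri (sum_struct M S) (Inr x) (Inr y) \<longleftrightarrow> precedes S x y"
  "relI (sum_struct M S) N_sym [Inr x] \<longleftrightarrow> colored S x"
  "fI (sum_struct M S) (Inr x) (Inr y) = (if x = y then Inr x else Inl (closeness S x y))"
  "relI (sum_struct M S) (OldR q) xs \<longleftrightarrow> set xs \<subseteq> range Inl \<and> relI M q (map projl xs)"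
  "funI (sum_struct M S) (OldF g) xs =
     (if set xs \<subseteq> range Inl then Inl (funI M g (map projl xs)) else hd xs)"
  by (auto simp: sum_struct_def V_part_def M_part_def)

lemma map_projl_Inl [simp]: "map projl (map Inl xs) = xs"
  by (induction xs) auto

lemma M_part_is_sum_struct: "is_struct L0 M \<Longrightarrow> M_part_is L0 (sum_struct M S) M"
  unfolding M_part_is_def
  by (rule is_isoI) (auto simp: bij_betw_def image_subset_iff simp del: map_map)

lemma colored_iso_sum_struct: "colored_iso Inl Inr S (V_space (sum_struct M S))"
  unfolding colored_iso_def bij_betw_def by simp

lemma K_struct_sum_struct:
  assumes M: "is_struct L0 M" and lt: "lt \<in> Rels L0" "rarity L0 lt = 2"
    and S: "convex_ultrametric (univ M) (binrel M lt) S"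
  shows "K_struct L0 lt (sum_struct M S)"
proof (intro K_struct.intro K_struct_axioms.intro)
  have iso: "is_iso L0 Inl M (M_struct (sum_struct M S))"
    using M_part_is_sum_struct[OF M] unfolding M_part_is_def .
  show "convex_ultrametric (M_part (sum_struct M S)) (binrel (M_struct (sum_struct M S)) lt)
      (V_space (sum_struct M S))"
    using convex_ultrametric_iso[OF S is_iso_order_iso[OF iso lt] colored_iso_sum_struct] by simp
  show "is_struct L0 (M_struct (sum_struct M S))" by (rule is_iso_is_struct(2)[OF iso])
  show "trivial_elsewhere L0 (sum_struct M S)"
  proof (rule trivial_elsewhereI)
    have range_iff: "set xs \<subseteq> range Inl \<longleftrightarrow> set xs \<subseteq> Inl ` univ M"
      if "set xs \<subseteq> univ (sum_struct M S)" for xs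
      using that by auto
    show "set xs \<subseteq> M_part (sum_struct M S)"
      if "set xs \<subseteq> univ (sum_struct M S)" "relI (sum_struct M S) (OldR q) xs" for q xs
      using that range_iff[OF that(1)] by simp
    show "funI (sum_struct M S) (OldF g) xs = hd xs"
      if "set xs \<subseteq> univ (sum_struct M S)" "\<not> set xs \<subseteq> M_part (sum_struct M S)" for g xs
      using that range_iff[OF that(1)] by simp
  qed (auto simp: sum_struct_def V_part_def)
  show "x \<in> V_part (sum_struct M S)"
    if "x \<in> univ (sum_struct M S)" "relI (sum_struct M S) N_sym [x]" for x
    using that by (auto simp: sum_struct_def V_part_def)
qed auto

lemma rich_sum_struct:
  assumes "convex_ultrametric (univ M) r S" "rich (univ M) S"
  shows "rich (M_part (sum_struct M S)) (V_space (sum_struct M S))"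
  using rich_iso[OF assms(1) _ colored_iso_sum_struct assms(2), of "Inl ` univ M"]
  by (simp add: bij_betw_def)

section \<open>The Fraisse limit is rich\<close>

lemma (in K_struct) generated_Un_M_part:
  assumes X: "X \<subseteq> univ A"
  shows "generated (ext_lang L0) A X \<union> M_part A = X \<inter> V_part A \<union> M_part A"
proof -
  let ?Y = "X \<inter> V_part A \<union> M_part A"
  interpret R: K_struct L0 lt "restrict_to A ?Y" by (rule K_struct_Un_M_part) blast
  have "closed_under (ext_lang L0) A ?Y"
    using R.is_struct_ext_lang unfolding is_struct_def closed_under_def by simp
  moreover have "X \<subseteq> ?Y" "?Y \<subseteq> univ A" using X univ_eq by auto
  ultimately have "generated (ext_lang L0) A X \<subseteq> ?Y"
    unfolding generated_def by (intro Inter_lower CollectI conjI)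
  moreover have "X \<subseteq> generated (ext_lang L0) A X" unfolding generated_def by blast
  ultimately show ?thesis by blast
qed

locale K_limit =
  fixes L0 :: "('f, 'r) lang" and lt :: 'r and M :: "('m, 'f, 'r) struct"
    and F :: "('m + nat, 'f, 'r) ext_struct"
  assumes lt_in: "lt \<in> Rels L0" and lt_arity: "rarity L0 lt = 2"
    and M_is_struct: "is_struct L0 M" and M_countable: "countable (univ M)"
    and M_linorder: "strict_linorder_on (univ M) (binrel M lt)"
    and fraisse_limit: "fraisse_limit L0 lt M F"
begin

lemma M_iso: "is_iso L0 Inl M (M_struct F)"
  using fraisse_limit unfolding fraisse_limit_def M_part_is_def by blast

lemma M_part_F: "M_part F = Inl ` univ M"
  using is_iso_image[OF M_iso] by simp

lemma countable_F: "countable (univ F)"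
  and fg_over_imp_K_class: "B \<in> fg_over L0 M F \<Longrightarrow> \<exists>A :: ('m + nat, 'f, 'r) ext_struct.
    K_class L0 lt M A \<and> isomorphic (ext_lang L0) B A"
  and universal: "K_class L0 lt M A \<Longrightarrow> \<exists>B\<in>fg_over L0 M F. isomorphic (ext_lang L0) B A"
  and homogeneous: "B \<in> fg_over L0 M F \<Longrightarrow> C \<in> fg_over L0 M F \<Longrightarrow> is_iso (ext_lang L0) h B C \<Longrightarrow>
    \<exists>g. is_iso (ext_lang L0) g F F \<and> (\<forall>x\<in>univ B. g x = h x)"
  for A :: "('m + nat, 'f, 'r) ext_struct"
  using fraisse_limit unfolding fraisse_limit_def by simp_all

lemma K_struct_F: "K_struct L0 lt F"
proof (rule K_struct_local)
  show "is_struct L0 (M_struct F)" by (rule is_iso_is_struct(2)[OF M_iso])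
  fix S assume S: "finite S" "S \<subseteq> univ F"
  let ?X = "generated (ext_lang L0) F S \<union> Inl ` univ M"
  have "restrict_to F ?X \<in> fg_over L0 M F" using S unfolding fg_over_def by blast
  then obtain A :: "('m + nat, 'f, 'r) ext_struct"
    where A: "K_class L0 lt M A" and "isomorphic (ext_lang L0) A (restrict_to F ?X)"
    using fg_over_imp_K_class isomorphic_sym by blast
  then obtain k where k: "is_iso (ext_lang L0) k A (restrict_to F ?X)"
    unfolding isomorphic_def by blast
  have "K_struct L0 lt A" by (rule K_class_imp_K_struct[OF M_linorder lt_in lt_arity A])
  then have "K_struct L0 lt (restrict_to F ?X)" using k lt_in lt_arity by (rule K_struct_transport)
  moreover have "S \<subseteq> ?X" unfolding generated_def by blast
  moreover have "?X \<subseteq> univ F"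
  proof -
    have "is_struct (ext_lang L0) F" using fraisse_limit unfolding fraisse_limit_def by blast
    then have "generated (ext_lang L0) F S \<subseteq> univ F"
      using S unfolding generated_def is_struct_def by blast
    then show ?thesis using M_part_F M_part_subset[of F] by blast
  qed
  ultimately show "\<exists>X. S \<subseteq> X \<and> X \<subseteq> univ F \<and> K_struct L0 lt (restrict_to F X)" by blast
qed

sublocale K_struct L0 lt F by (rule K_struct_F)

lemma fg_over_iff:
  "B \<in> fg_over L0 M F \<longleftrightarrow> (\<exists>S. finite S \<and> S \<subseteq> V_part F \<and> B = restrict_to F (S \<union> M_part F))"
proof
  assume "B \<in> fg_over L0 M F"
  then obtain X where "finite X" "X \<subseteq> univ F"
    "B = restrict_to F (generated (ext_lang L0) F X \<union> M_part F)"
    unfolding fg_over_def M_part_F by blast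
  then show "\<exists>S. finite S \<and> S \<subseteq> V_part F \<and> B = restrict_to F (S \<union> M_part F)"
    by (intro exI[of _ "X \<inter> V_part F"]) (simp add: generated_Un_M_part)
next
  assume "\<exists>S. finite S \<and> S \<subseteq> V_part F \<and> B = restrict_to F (S \<union> M_part F)"
  then obtain S where S: "finite S" "S \<subseteq> V_part F" "B = restrict_to F (S \<union> M_part F)" by blast
  then have "S \<subseteq> univ F" "S \<inter> V_part F = S" using V_part_subset[of F] by auto
  then have "B = restrict_to F (generated (ext_lang L0) F S \<union> Inl ` univ M)"
    using S(3) generated_Un_M_part[of S] M_part_F by simp
  then show "B \<in> fg_over L0 M F" using S(1) \<open>S \<subseteq> univ F\<close> unfolding fg_over_def by blast
qed

text \<open>Move a copy of \<open>C\<close> in the limit by an automorphism that carries the image of the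
  substructure to its prescribed place.\<close>

lemma embedding_extension:
  fixes C :: "('m + nat, 'f, 'r) ext_struct"
  assumes C: "K_class L0 lt M C" and S: "S \<subseteq> V_part C" and T: "finite T" "T \<subseteq> V_part F"
    and d: "is_iso (ext_lang L0) d (restrict_to C (S \<union> M_part C)) (restrict_to F (T \<union> M_part F))"
  shows "\<exists>e X. X \<subseteq> univ F \<and> is_iso (ext_lang L0) e C (restrict_to F X) \<and>
           (\<forall>x\<in>S \<union> M_part C. e x = d x)"
proof -
  interpret C: K_struct L0 lt C by (rule K_class_imp_K_struct[OF M_linorder lt_in lt_arity C])
  let ?Y = "S \<union> M_part C" and ?D = "T \<union> M_part F"
  have Y_subset: "?Y \<subseteq> univ C" using S C.univ_eq by blast
  have "finite S" using C S finite_subset unfolding K_class_def by blast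
  obtain Z where Z: "Z \<subseteq> V_part F" and "isomorphic (ext_lang L0) (restrict_to F (Z \<union> M_part F)) C"
    using universal[OF C] by (auto simp: fg_over_iff)
  then obtain j where j: "is_iso (ext_lang L0) j C (restrict_to F (Z \<union> M_part F))"
    using isomorphic_sym unfolding isomorphic_def by blast
  let ?B = "Z \<union> M_part F"
  have B_subset: "?B \<subseteq> univ F" using Z univ_eq by blast
  have j_image: "j ` ?Y = j ` S \<union> M_part F" "j ` S \<subseteq> V_part F"
    using is_iso_M_part_image[OF j] is_iso_V_part_image[OF j] S
    unfolding M_part_Un_M_part[OF Z] V_part_Un_M_part[OF Z] using Z by blast+
  have j_restrict: "is_iso (ext_lang L0) j (restrict_to C ?Y) (restrict_to F (j ` ?Y))"
    using is_iso_restrict_to[OF j Y_subset] K_struct.is_struct_ext_lang[OF C.K_struct_Un_M_part[OF S]]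
    by (simp add: restrict_to_def)
  have "is_iso (ext_lang L0) (j \<circ> inv_into ?Y d) (restrict_to F ?D) (restrict_to F (j ` ?Y))"
    using is_iso_trans[OF is_iso_inv_into[OF d] j_restrict] by simp
  moreover have "restrict_to F ?D \<in> fg_over L0 M F" "restrict_to F (j ` ?Y) \<in> fg_over L0 M F"
    unfolding fg_over_iff j_image(1) using T \<open>finite S\<close> j_image(2) by blast+
  ultimately obtain \<sigma> where \<sigma>: "is_iso (ext_lang L0) \<sigma> F F"
    and \<sigma>_eq: "\<And>x. x \<in> ?D \<Longrightarrow> \<sigma> x = j (inv_into ?Y d x)"
    using homogeneous by fastforce
  let ?e = "inv_into (univ F) \<sigma> \<circ> j"
  have \<sigma>_inv: "is_iso (ext_lang L0) (inv_into (univ F) \<sigma>) F F" by (rule is_iso_inv_into[OF \<sigma>])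
  have "is_iso (ext_lang L0) ?e C (restrict_to F (inv_into (univ F) \<sigma> ` ?B))"
    by (rule is_iso_trans[OF j is_iso_restrict_to[OF \<sigma>_inv B_subset is_iso_is_struct(2)[OF j]]])
  moreover have "inv_into (univ F) \<sigma> ` ?B \<subseteq> univ F"
    using is_iso_image[OF \<sigma>_inv] B_subset by blast
  moreover have "?e x = d x" if "x \<in> ?Y" for x
  proof -
    have "d x \<in> ?D" using is_iso_image[OF d] that by auto
    then have "d x \<in> univ F" using T univ_eq by blast
    have "\<sigma> (d x) = j x"
      using \<sigma>_eq[OF \<open>d x \<in> ?D\<close>] inv_into_f_f[OF is_iso_inj_on[OF d]] that by simp
    then show ?thesis
      using inv_into_f_f[OF is_iso_inj_on[OF \<sigma>] \<open>d x \<in> univ F\<close>] by simp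
  qed
  ultimately show ?thesis by blast
qed

lemma K_class_sum_struct:
  assumes S: "convex_ultrametric (univ M) (binrel M lt) S" "finite (points S)"
  shows "K_class L0 lt M (sum_struct M S)"
  by (rule K_struct_imp_K_class)
    (use S M_countable in \<open>auto simp: K_struct_sum_struct[OF M_is_struct lt_in lt_arity]
      M_part_is_sum_struct[OF M_is_struct] intro: countable_finite\<close>)

lemma colored_iso_extension:
  fixes S :: "(nat, 'm) colored_space"
  assumes S: "convex_ultrametric (univ M) (binrel M lt) S" "finite (points S)"
    and P: "P \<subseteq> points S" "d ` P \<subseteq> V_part F"
    and d: "colored_iso Inl d (S\<lparr>points := P\<rparr>) (V_space F\<lparr>points := d ` P\<rparr>)"
  shows "\<exists>e. e ` points S \<subseteq> V_part F \<and>
    colored_iso Inl e S (V_space F\<lparr>points := e ` points S\<rparr>) \<and> (\<forall>x\<in>P. e x = d x)"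
proof -
  let ?C = "sum_struct M S"
  interpret S: convex_ultrametric "univ M" "binrel M lt" S by (rule S(1))
  interpret C: K_struct L0 lt ?C by (rule K_struct_sum_struct[OF M_is_struct lt_in lt_arity S(1)])
  have C_iso: "is_iso L0 Inl M (M_struct ?C)"
    using M_part_is_sum_struct[OF M_is_struct] unfolding M_part_is_def .
  let ?CP = "restrict_to ?C (Inr ` P \<union> M_part ?C)" and ?FP = "restrict_to F (d ` P \<union> M_part F)"
  have InrP: "Inr ` P \<subseteq> V_part ?C" using P(1) by auto
  note CP = C.V_part_Un_M_part[OF InrP] C.M_part_Un_M_part[OF InrP] C.M_struct_Un_M_part[OF InrP]
  note FP = V_part_Un_M_part[OF P(2)] M_struct_Un_M_part[OF P(2)]
  define d0 where "d0 x = (if x \<in> M_part ?CP then x else d (projr x))" for x :: "'m + nat"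
  have d0: "is_iso (ext_lang L0) d0 ?CP ?FP"
    unfolding d0_def
  proof (rule is_iso_glue[OF C.K_struct_Un_M_part[OF InrP] K_struct_Un_M_part[OF P(2)]])
    show "is_iso L0 (\<lambda>x. x) (M_struct ?CP) (M_struct ?FP)"
      unfolding CP FP
      by (rule is_iso_cong[OF is_iso_trans[OF is_iso_inv_into[OF C_iso] M_iso]])
        (auto simp: f_inv_into_f)
    show "colored_iso (\<lambda>x. x) (\<lambda>x. d (projr x)) (V_space ?CP) (V_space ?FP)"
      using d unfolding colored_iso_def V_space_simps CP FP
      by (auto simp: bij_betw_def inj_on_def image_image)
  qed
  have "finite (d ` P)" using S(2) P(1) finite_subset by blast
  from embedding_extension[OF K_class_sum_struct[OF S] InrP this P(2) d0]
  obtain e X where X: "X \<subseteq> univ F" and e: "is_iso (ext_lang L0) e ?C (restrict_to F X)"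
    and e_eq: "\<And>x. x \<in> Inr ` P \<union> M_part ?C \<Longrightarrow> e x = d0 x"
    by blast
  have "V_part F \<inter> X = (e \<circ> Inr) ` points S"
    using is_iso_V_part_image[OF e] V_part_restrict_to[OF X] by (simp add: image_comp)
  moreover have "colored_iso (e \<circ> Inl) (e \<circ> Inr) S (V_space (restrict_to F X))"
    by (rule colored_iso_trans[OF colored_iso_sum_struct colored_iso_V_space[OF e]])
  then have "colored_iso Inl (e \<circ> Inr) S (V_space (restrict_to F X))"
    by (rule S.colored_iso_cong) (use e_eq CP(2) in \<open>auto simp: d0_def\<close>)
  moreover have "\<forall>x\<in>P. (e \<circ> Inr) x = d x" using e_eq CP(2) by (auto simp: d0_def)
  ultimately show ?thesis unfolding V_space_restrict_to[OF X] by (intro exI[of _ "e \<circ> Inr"]) auto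
qed

definition const_space :: "nat \<Rightarrow> 'm \<Rightarrow> (nat \<Rightarrow> bool) \<Rightarrow> (nat, 'm) colored_space" where
  "const_space n m N = \<lparr>points = {..<n}, precedes = (<), closeness = (\<lambda>_ _. m), colored = N\<rparr>"

lemma const_space_simps [simp]:
  "points (const_space n m N) = {..<n}" "precedes (const_space n m N) = (<)"
  "closeness (const_space n m N) = (\<lambda>_ _. m)" "colored (const_space n m N) = N"
  by (simp_all add: const_space_def)

lemma convex_ultrametric_const_space:
  "m \<in> univ M \<Longrightarrow> convex_ultrametric (univ M) (binrel M lt) (const_space n m N)"
  by unfold_locales (auto simp: M_linorder min_by_def intro: strict_linorder_onI)

lemma colored_iso_const_space:
  fixes P :: "nat set"
  assumes d_in: "d ` P \<subseteq> V_part F"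
    and d: "\<And>i j. i \<in> P \<Longrightarrow> j \<in> P \<Longrightarrow> i < j \<Longrightarrow> tri F (d i) (d j) \<and> fI F (d i) (d j) = Inl m"
    and N: "\<And>i. i \<in> P \<Longrightarrow> N i = relI F N_sym [d i]"
  shows "colored_iso Inl d (const_space n m N\<lparr>points := P\<rparr>) (V_space F\<lparr>points := d ` P\<rparr>)"
proof -
  have d_points: "d i \<in> points (V_space F)" if "i \<in> P" for i using d_in that by auto
  have less: "d i \<noteq> d j \<and> tri F (d i) (d j) \<and> \<not> tri F (d j) (d i) \<and>
      fI F (d i) (d j) = Inl m \<and> fI F (d j) (d i) = Inl m"
    if "i \<in> P" "j \<in> P" "i < j" for i j
    using d[OF that] precedes_irrefl[OF d_points[OF that(1)]]
      precedes_asym[OF d_points[OF that(1)] d_points[OF that(2)]]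
      closeness_sym[OF d_points[OF that(1)] d_points[OF that(2)]]
    by (cases "d i = d j") auto
  have d_embeds: "d i \<noteq> d j \<and> (tri F (d i) (d j) \<longleftrightarrow> i < j) \<and> fI F (d i) (d j) = Inl m"
    if "i \<in> P" "j \<in> P" "i \<noteq> j" for i j
  proof (cases "i < j")
    case True
    then show ?thesis using less[OF that(1,2)] by blast
  next
    case False
    then have "j < i" using that(3) by simp
    then show ?thesis using less[OF that(2,1)] False by metis
  qed
  moreover have "\<not> tri F (d i) (d i)" if "i \<in> P" for i
    using precedes_irrefl[OF d_points[OF that]] by simp
  moreover have "inj_on d P" using d_embeds by (meson inj_onI)
  ultimately show ?thesis using N unfolding colored_iso_def by (auto simp: bij_betw_def)
qed

lemma const_space_insert_point:
  fixes k n :: nat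
  assumes m: "m \<in> univ M" and "k < n" and d_in: "\<And>i. i < n \<Longrightarrow> i \<noteq> k \<Longrightarrow> d i \<in> V_part F"
    and d: "\<And>i j. i < j \<Longrightarrow> j < n \<Longrightarrow> i \<noteq> k \<Longrightarrow> j \<noteq> k \<Longrightarrow>
      tri F (d i) (d j) \<and> fI F (d i) (d j) = Inl m"
  shows "\<exists>z\<in>V_part F. relI F N_sym [z] = c \<and> (\<forall>i<k. tri F (d i) z) \<and>
    (\<forall>i<n. k < i \<longrightarrow> tri F z (d i)) \<and> (\<forall>i<n. i \<noteq> k \<longrightarrow> fI F (d i) z = Inl m)"
proof -
  let ?P = "{..<n} - {k}"
  let ?S = "const_space n m (\<lambda>i. if i = k then c else relI F N_sym [d i])"
  have P: "finite (points ?S)" "?P \<subseteq> points ?S" "d ` ?P \<subseteq> V_part F" using d_in by auto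
  have "colored_iso Inl d (?S\<lparr>points := ?P\<rparr>) (V_space F\<lparr>points := d ` ?P\<rparr>)"
    by (rule colored_iso_const_space[OF P(3)]) (use d in auto)
  from colored_iso_extension[OF convex_ultrametric_const_space[OF m] P this]
  obtain e where e_in: "e ` points ?S \<subseteq> V_part F" and e_eq: "\<forall>i\<in>?P. e i = d i"
    and e: "colored_iso Inl e ?S (V_space F\<lparr>points := e ` points ?S\<rparr>)" by blast
  have "relI F N_sym [e k] = c" using colored_iso_colored[OF e, of k] \<open>k < n\<close> by simp
  moreover have "tri F (d i) (e k)" if "i < k" for i
    using colored_iso_precedes[OF e, of i k] e_eq \<open>k < n\<close> that by simp
  moreover have "tri F (e k) (d i)" if "k < i" "i < n" for i
    using colored_iso_precedes[OF e, of k i] e_eq that by simp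
  moreover have "fI F (d i) (e k) = Inl m" if "i < n" "i \<noteq> k" for i
    using colored_iso_closeness[OF e, of i k] e_eq \<open>k < n\<close> that by simp
  ultimately show ?thesis using e_in \<open>k < n\<close> by (intro bexI[of _ "e k"]) auto
qed

lemma rich_F: "rich (M_part F) (V_space F)"
  unfolding rich_def V_space_simps
proof (intro conjI ballI allI impI)
  obtain m where m: "m \<in> univ M" using M_is_struct by (auto simp: is_struct_def)
  then show "M_part F \<noteq> {}" using M_part_F by blast
  show "V_part F \<noteq> {}" using const_space_insert_point[OF m, of 0 1] by force
next
  fix b x c assume b: "b \<in> V_part F" and "x \<in> M_part F"
  then obtain m where m: "m \<in> univ M" "x = Inl m" using M_part_F by blast
  show "\<exists>z\<in>V_part F. tri F b z \<and> fI F b z = x \<and> relI F N_sym [z] = c"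
    using const_space_insert_point[OF m(1), of 1 2 "\<lambda>_. b" c] b m(2)
    by (auto simp: All_less_Suc eval_nat_numeral)
  show "\<exists>z\<in>V_part F. tri F z b \<and> fI F b z = x \<and> relI F N_sym [z] = c"
    using const_space_insert_point[OF m(1), of 0 2 "\<lambda>_. b" c] b m(2)
    by (auto simp: All_less_Suc eval_nat_numeral)
next
  fix b b' c assume b: "b \<in> V_part F" "b' \<in> V_part F" "tri F b b'"
  then have "b \<noteq> b'" using precedes_irrefl by auto
  then obtain m where m: "m \<in> univ M" "fI F b b' = Inl m" using fI_in_M b M_part_F by blast
  define d where "d i = (if i = 0 then b else b')" for i :: nat
  have "d i \<in> V_part F" if "i < 3" "i \<noteq> 1" for i using b by (simp add: d_def)
  moreover have "tri F (d i) (d j) \<and> fI F (d i) (d j) = Inl m"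
    if "i < j" "j < 3" "i \<noteq> 1" "j \<noteq> 1" for i j
    using b(3) m(2) that by (simp add: d_def)
  ultimately have "\<exists>z\<in>V_part F. relI F N_sym [z] = c \<and> (\<forall>i<1. tri F (d i) z) \<and>
      (\<forall>i<3. 1 < i \<longrightarrow> tri F z (d i)) \<and> (\<forall>i<3. i \<noteq> 1 \<longrightarrow> fI F (d i) z = Inl m)"
    by (intro const_space_insert_point[OF m(1)]) auto
  then show "\<exists>z\<in>V_part F. tri F b z \<and> tri F z b' \<and> fI F b z = fI F b b' \<and>
      fI F b' z = fI F b b' \<and> relI F N_sym [z] = c"
    using m(2) by (auto simp: d_def All_less_Suc eval_nat_numeral)
qed

lemma countable_rich_isomorphic:
  assumes H: "K_struct L0 lt H" "rich (M_part H) (V_space H)" "countable (univ H)"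
    and M: "isomorphic L0 (M_struct H) M"
  shows "isomorphic (ext_lang L0) H F"
proof (rule countable_rich_struct_iso[OF H K_struct_F rich_F countable_F lt_in lt_arity])
  have "isomorphic L0 M (M_struct F)" using M_iso unfolding isomorphic_def by blast
  with M show "isomorphic L0 (M_struct H) (M_struct F)" by (rule isomorphic_trans)
qed

end
section \<open>Models of the Scott sentence of the limit\<close>

lemma rich_subspace:
  assumes rich: "rich U S" and nonempty: "points S \<inter> X \<noteq> {}" "U \<inter> X \<noteq> {}"
    and above: "\<And>b m c. b \<in> X \<Longrightarrow> m \<in> X \<Longrightarrow>
      \<exists>z\<in>points S. precedes S b z \<and> closeness S b z = m \<and> colored S z = c \<Longrightarrow>
      \<exists>z\<in>points S \<inter> X. precedes S b z \<and> closeness S b z = m \<and> colored S z = c"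
    and below: "\<And>b m c. b \<in> X \<Longrightarrow> m \<in> X \<Longrightarrow>
      \<exists>z\<in>points S. precedes S z b \<and> closeness S b z = m \<and> colored S z = c \<Longrightarrow>
      \<exists>z\<in>points S \<inter> X. precedes S z b \<and> closeness S b z = m \<and> colored S z = c"
    and middle: "\<And>b b' c. b \<in> X \<Longrightarrow> b' \<in> X \<Longrightarrow>
      \<exists>z\<in>points S. precedes S b z \<and> precedes S z b' \<and>
        closeness S b z = closeness S b b' \<and> closeness S b' z = closeness S b b' \<and> colored S z = c \<Longrightarrow>
      \<exists>z\<in>points S \<inter> X. precedes S b z \<and> precedes S z b' \<and>
        closeness S b z = closeness S b b' \<and> closeness S b' z = closeness S b b' \<and> colored S z = c"
  shows "rich (U \<inter> X) (S\<lparr>points := points S \<inter> X\<rparr>)"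
  unfolding rich_def using nonempty
  by (simp add: above below middle rich_above[OF rich] rich_below[OF rich] rich_middle[OF rich])

lemma eventually_club_rich:
  fixes S :: "('a, 'a) colored_space"
  assumes rich: "rich U S" and subset: "points S \<union> U \<subseteq> W"
  shows "\<forall>\<^sub>F X in club W. rich (U \<inter> X) (S\<lparr>points := points S \<inter> X\<rparr>)"
proof -
  have witnesses: "\<forall>\<^sub>F X in club W. \<forall>c\<in>UNIV. \<forall>x\<in>X. \<forall>y\<in>X.
      (\<exists>z\<in>points S. P c x y z) \<longrightarrow> (\<exists>z\<in>points S \<inter> X. P c x y z)" for P :: "bool \<Rightarrow> _"
  proof (rule eventually_club_ball)
    show "\<forall>\<^sub>F X in club W. \<forall>x\<in>X. \<forall>y\<in>X.
      (\<exists>z\<in>points S. P c x y z) \<longrightarrow> (\<exists>z\<in>points S \<inter> X. P c x y z)" for c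
      using eventually_club_witness2[of W "\<lambda>x y z. z \<in> points S \<and> P c x y z"]
      by (rule eventually_mono) (use subset in blast)
  qed simp
  from eventually_club_witness[of W "\<lambda>_ z. z \<in> points S"]
    eventually_club_witness[of W "\<lambda>_ z. z \<in> U"]
    witnesses[of "\<lambda>c b m z. precedes S b z \<and> closeness S b z = m \<and> colored S z = c"]
    witnesses[of "\<lambda>c b m z. precedes S z b \<and> closeness S b z = m \<and> colored S z = c"]
    witnesses[of "\<lambda>c b b' z. precedes S b z \<and> precedes S z b' \<and>
      closeness S b z = closeness S b b' \<and> closeness S b' z = closeness S b b' \<and> colored S z = c"]
  show ?thesis
  proof eventually_elim
    case (elim X)
    show ?case
    proof (rule rich_subspace[OF rich])
      show "points S \<inter> X \<noteq> {}" "U \<inter> X \<noteq> {}"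
        using elim(1,2)[rule_format, of "[]"] subset rich_points_nonempty[OF rich]
          rich_values_nonempty[OF rich] by auto
    qed (fact elim(3-5)[rule_format, OF UNIV_I])+
  qed
qed

lemma scott_model_strict_linorder:
  assumes "countable_lang L" "scott_sentence L M p" "is_model L A p"
    and lt: "lt \<in> Rels L" "rarity L lt = 2" and M: "strict_linorder_on (univ M) (binrel M lt)"
  shows "strict_linorder_on (univ A) (binrel A lt)"
proof (rule strict_linorder_on_local)
  fix S assume S: "finite S" "S \<subseteq> univ A"
  then obtain X where "countable X" "S \<subseteq> X" "isomorphic L (restrict_to A X) M"
    using eventually_club_imp_countable[OF eventually_club_isomorphic[OF assms(1-3)]]
      countable_finite by metis
  then obtain h where h: "is_iso L h M (restrict_to A X)"
    using isomorphic_sym unfolding isomorphic_def by blast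
  have "strict_linorder_on X (binrel A lt)"
    using strict_linorder_on_order_iso[OF is_iso_order_iso[OF h lt] M] by simp
  then show "\<exists>X. S \<subseteq> X \<and> strict_linorder_on X (binrel A lt)" using \<open>S \<subseteq> X\<close> by blast
qed

lemma (in K_limit) rich_imp_is_model:
  assumes L0: "countable_lang L0" and \<phi>: "scott_sentence L0 M \<phi>"
    and \<phi>F: "scott_sentence (ext_lang L0) F \<phi>F"
    and G: "K_struct L0 lt G" "rich (M_part G) (V_space G)" "is_model L0 (M_struct G) \<phi>"
  shows "is_model (ext_lang L0) G \<phi>F"
proof -
  interpret G: K_struct L0 lt G by (rule G(1))
  have sentence: "sentence (ext_lang L0) \<phi>F" using \<phi>F unfolding scott_sentence_def by blast
  have parts: "points (V_space G) \<union> M_part G \<subseteq> univ G" using G.univ_eq by simp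
  note ext_lang = countable_ext_lang[OF L0]
  have M_reflects: "\<forall>\<^sub>F X in club (M_part G).
      countable X \<longrightarrow> isomorphic L0 (restrict_to (M_struct G) X) M"
    using eventually_club_isomorphic[OF L0 \<phi> G(3)] by simp
  have "\<forall>\<^sub>F X in club (univ G). countable X \<longrightarrow> is_model (ext_lang L0) G \<phi>F"
    using eventually_club_subset[of "univ G"]
      eventually_club_is_struct[OF ext_lang G.is_struct_ext_lang]
      eventually_club_is_model_iff[OF ext_lang G.is_struct_ext_lang sentence]
      eventually_club_rich[OF G(2) parts] eventually_club_Int[OF M_part_subset M_reflects]
  proof eventually_elim
    case (elim X)
    let ?H = "restrict_to G X"
    show ?case
    proof
      assume "countable X"
      then have M: "isomorphic L0 (M_struct ?H) M"
        using elim(5) by (simp add: M_struct_restrict_to[OF elim(1)])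
      have "K_struct L0 lt ?H"
      proof (rule G.K_struct_restrict_to[OF elim(1)])
        show "is_struct L0 (M_struct ?H)" using M is_iso_is_struct unfolding isomorphic_def by blast
        show "fI G x y \<in> X" if "x \<in> V_part G \<inter> X" "y \<in> V_part G \<inter> X" for x y
          using is_struct_closed[OF elim(2), of F_sym "[x, y]"] that by simp
      qed
      moreover have "rich (M_part ?H) (V_space ?H)"
        using elim(4) by (simp add: M_part_restrict_to[OF elim(1)] V_space_restrict_to[OF elim(1)])
      ultimately have "isomorphic (ext_lang L0) ?H F"
        by (rule countable_rich_isomorphic) (use \<open>countable X\<close> M in simp_all)
      then show "is_model (ext_lang L0) G \<phi>F"
        using elim(3) scott_sentence_iff[OF \<phi>F elim(2)] \<open>countable X\<close> by simp
    qed
  qed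
  from eventually_club_imp_countable[OF this, of "{}"] show ?thesis by auto
qed

section \<open>Finitely supported functions\<close>

definition densely_colored :: "'q set \<Rightarrow> ('q \<Rightarrow> 'q \<Rightarrow> bool) \<Rightarrow> ('q \<Rightarrow> bool) \<Rightarrow> bool" where
  "densely_colored Q lq col \<longleftrightarrow>
     (\<forall>a\<in>Q. \<forall>c. \<exists>q\<in>Q. lq a q \<and> col q = c) \<and> (\<forall>a\<in>Q. \<forall>c. \<exists>q\<in>Q. lq q a \<and> col q = c) \<and>
     (\<forall>a\<in>Q. \<forall>b\<in>Q. \<forall>c. lq a b \<longrightarrow> (\<exists>q\<in>Q. lq a q \<and> lq q b \<and> col q = c))"

locale lex_space =
  fixes U :: "'u set" and r :: "'u \<Rightarrow> 'u \<Rightarrow> bool" and Q :: "'q set" and lq :: "'q \<Rightarrow> 'q \<Rightarrow> bool"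
    and col :: "'q \<Rightarrow> bool" and q0 :: 'q
  assumes U_linorder: "strict_linorder_on U r" and U_nonempty: "U \<noteq> {}"
    and Q_linorder: "strict_linorder_on Q lq" and Q_dense: "densely_colored Q lq col"
    and q0_in: "q0 \<in> Q"
begin

definition fin_funs :: "('u \<Rightarrow> 'q) set" where
  "fin_funs = {x. x ` U \<subseteq> Q \<and> {u. x u \<noteq> q0} \<subseteq> U \<and> finite {u. x u \<noteq> q0}}"

definition first_diff :: "('u \<Rightarrow> 'q) \<Rightarrow> ('u \<Rightarrow> 'q) \<Rightarrow> 'u \<Rightarrow> bool" where
  "first_diff x y m \<longleftrightarrow> m \<in> U \<and> x m \<noteq> y m \<and> (\<forall>u\<in>U. r u m \<longrightarrow> x u = y u)"

definition lex_funs :: "('u \<Rightarrow> 'q, 'u) colored_space" where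
  "lex_funs = \<lparr>points = fin_funs,
     precedes = (\<lambda>x y. \<exists>m. first_diff x y m \<and> lq (x m) (y m)),
     closeness = (\<lambda>x y. THE m. first_diff x y m),
     colored = (\<lambda>x. \<exists>m\<in>U. x m \<noteq> q0 \<and> (\<forall>u\<in>U. r m u \<longrightarrow> x u = q0) \<and> col (x m))\<rparr>"

lemmas U_irrefl = strict_linorder_on_irrefl[OF U_linorder]
lemmas U_trans = strict_linorder_on_trans[OF U_linorder]
lemmas U_total = strict_linorder_on_total[OF U_linorder]
lemmas U_asym = strict_linorder_on_asym[OF U_linorder]
lemmas Q_irrefl = strict_linorder_on_irrefl[OF Q_linorder]
lemmas Q_trans = strict_linorder_on_trans[OF Q_linorder]
lemmas Q_total = strict_linorder_on_total[OF Q_linorder]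

lemma points_lex_funs [simp]: "points lex_funs = fin_funs"
  by (simp add: lex_funs_def)

lemma fin_funs_in: "x \<in> fin_funs \<Longrightarrow> u \<in> U \<Longrightarrow> x u \<in> Q"
  unfolding fin_funs_def by blast

lemma first_diff_in: "first_diff x y m \<Longrightarrow> m \<in> U"
  unfolding first_diff_def by blast

lemma first_diff_unique: "first_diff x y m \<Longrightarrow> first_diff x y m' \<Longrightarrow> m = m'"
  using U_total unfolding first_diff_def by metis

lemma first_diff_sym: "first_diff x y m \<longleftrightarrow> first_diff y x m"
  unfolding first_diff_def by metis

lemma closeness_lex_funs: "first_diff x y m \<Longrightarrow> closeness lex_funs x y = m"
  unfolding lex_funs_def using first_diff_unique by simp blast

lemma precedes_lex_funs_iff: "first_diff x y m \<Longrightarrow> precedes lex_funs x y \<longleftrightarrow> lq (x m) (y m)"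
  unfolding lex_funs_def using first_diff_unique by simp blast

lemma precedes_lex_funsE:
  assumes "precedes lex_funs x y"
  obtains m where "first_diff x y m" "lq (x m) (y m)"
  using assms unfolding lex_funs_def by auto

lemma ex_first_diff:
  assumes "x \<in> fin_funs" "y \<in> fin_funs" "x \<noteq> y"
  shows "\<exists>m. first_diff x y m"
proof -
  let ?D = "{u. x u \<noteq> y u}"
  have "?D \<subseteq> {u. x u \<noteq> q0} \<union> {u. y u \<noteq> q0}" by auto
  then have "finite ?D" "?D \<subseteq> U" using assms finite_subset unfolding fin_funs_def by auto
  moreover have "?D \<noteq> {}" using assms(3) by auto
  moreover have "strict_linorder_on ?D r"
    using strict_linorder_on_subset[OF U_linorder \<open>?D \<subseteq> U\<close>] .
  ultimately obtain m where m: "m \<in> ?D" "\<forall>u\<in>?D. u \<noteq> m \<longrightarrow> r m u"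
    unfolding strict_linorder_on_def using Finite_Set.bex_least_element[of ?D r] by blast
  then have "m \<in> U" using \<open>?D \<subseteq> U\<close> by blast
  have "x u = y u" if u: "u \<in> U" "r u m" for u
  proof (rule ccontr)
    assume "x u \<noteq> y u"
    then have "u = m \<or> r m u" using m(2) by blast
    then show False using U_asym[OF u(1) \<open>m \<in> U\<close> u(2)] U_irrefl[OF u(1)] u(2) by blast
  qed
  then show ?thesis using m(1) \<open>m \<in> U\<close> unfolding first_diff_def by blast
qed

lemma first_diff_trans:
  assumes V: "x \<in> fin_funs" "y \<in> fin_funs" "z \<in> fin_funs"
    and xy: "first_diff x y m" "lq (x m) (y m)" and yz: "first_diff y z n" "lq (y n) (z n)"
  shows "first_diff x z (min_by r m n) \<and> lq (x (min_by r m n)) (z (min_by r m n))"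
proof -
  have mn: "m \<in> U" "n \<in> U" using xy yz first_diff_in by blast+
  consider "r m n" | "m = n" | "r n m" using U_total mn by blast
  then show ?thesis
  proof cases
    case 1
    then have "y m = z m" using yz mn unfolding first_diff_def by blast
    moreover have "x u = z u" if "u \<in> U" "r u m" for u
      using that xy yz U_trans[OF that(1) mn that(2) 1] unfolding first_diff_def by metis
    ultimately show ?thesis using xy 1 unfolding first_diff_def min_by_def by auto
  next
    case 2
    have "lq (x m) (z m)"
      using Q_trans[of "x m" "y m" "z m"] V[THEN fin_funs_in, OF mn(1)] xy yz 2 by blast
    then have "x m \<noteq> z m" using Q_irrefl fin_funs_in[OF V(1) mn(1)] by metis
    then show ?thesis
      using \<open>lq (x m) (z m)\<close> xy yz 2 U_irrefl[OF mn(2)] unfolding first_diff_def min_by_def by simp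
  next
    case 3
    then have "x n = y n" using xy mn unfolding first_diff_def by blast
    moreover have "x u = z u" if "u \<in> U" "r u n" for u
      using that xy yz U_trans[OF that(1) mn(2,1) that(2) 3] unfolding first_diff_def by metis
    ultimately show ?thesis
      using yz 3 U_asym[OF mn(2,1) 3] unfolding first_diff_def min_by_def by auto
  qed
qed

lemma convex_ultrametric_lex_funs: "convex_ultrametric U r lex_funs"
proof
  have trans: "precedes lex_funs x z \<and>
      closeness lex_funs x z = min_by r (closeness lex_funs x y) (closeness lex_funs y z)"
    if V: "x \<in> fin_funs" "y \<in> fin_funs" "z \<in> fin_funs"
      and lt: "precedes lex_funs x y" "precedes lex_funs y z" for x y z
  proof -
    obtain m where m: "first_diff x y m" "lq (x m) (y m)" using lt(1) by (rule precedes_lex_funsE)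
    obtain n where n: "first_diff y z n" "lq (y n) (z n)" using lt(2) by (rule precedes_lex_funsE)
    note xz = first_diff_trans[OF V m n]
    show ?thesis
      using xz closeness_lex_funs[OF conjunct1[OF xz]] precedes_lex_funs_iff[OF conjunct1[OF xz]]
        closeness_lex_funs[OF m(1)] closeness_lex_funs[OF n(1)] by simp
  qed
  show "closeness lex_funs x z = min_by r (closeness lex_funs x y) (closeness lex_funs y z)"
    if "x \<in> points lex_funs" "y \<in> points lex_funs" "z \<in> points lex_funs"
      "precedes lex_funs x y" "precedes lex_funs y z" for x y z
    using trans[of x y z] that by simp
  show "strict_linorder_on (points lex_funs) (precedes lex_funs)"
    unfolding points_lex_funs
  proof (rule strict_linorder_onI)
    show "\<not> precedes lex_funs x x" for x by (auto simp: first_diff_def elim: precedes_lex_funsE)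
    fix x y assume xy: "x \<in> fin_funs" "y \<in> fin_funs" "x \<noteq> y"
    then obtain m where m: "first_diff x y m" using ex_first_diff by blast
    then have "lq (x m) (y m) \<or> lq (y m) (x m)"
      using Q_total fin_funs_in xy unfolding first_diff_def by blast
    then show "precedes lex_funs x y \<or> precedes lex_funs y x"
      using precedes_lex_funs_iff m first_diff_sym by blast
  qed (use trans in blast)
  show "strict_linorder_on U r" by (rule U_linorder)
  fix x y assume "x \<in> points lex_funs" "y \<in> points lex_funs" "x \<noteq> y"
  then obtain m where m: "first_diff x y m" using ex_first_diff by auto
  then show "closeness lex_funs x y \<in> U" using closeness_lex_funs first_diff_in by metis
  show "closeness lex_funs x y = closeness lex_funs y x"
    using m first_diff_sym closeness_lex_funs by metis
qed

definition branch :: "('u \<Rightarrow> 'q) \<Rightarrow> 'u \<Rightarrow> 'q \<Rightarrow> 'u \<Rightarrow> 'q" where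
  "branch b m q u = (if u \<in> U \<and> r u m then b u else if u = m then q else q0)"

lemma branch_in:
  assumes b: "b \<in> fin_funs" and "m \<in> U" "q \<in> Q"
  shows "branch b m q \<in> fin_funs"
proof -
  have "{u. branch b m q u \<noteq> q0} \<subseteq> insert m {u. b u \<noteq> q0}" by (auto simp: branch_def)
  moreover have "finite {u. b u \<noteq> q0}" using b unfolding fin_funs_def by blast
  ultimately have "finite {u. branch b m q u \<noteq> q0}" using finite_subset by blast
  then show ?thesis
    using assms fin_funs_in[OF b] q0_in unfolding fin_funs_def by (auto simp: branch_def)
qed

lemma branch_at: "m \<in> U \<Longrightarrow> branch b m q m = q"
  using U_irrefl unfolding branch_def by auto

lemma first_diff_branch:
  assumes "m \<in> U" "q \<noteq> b m"
  shows "first_diff b (branch b m q) m"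
  using assms branch_at[OF assms(1)] unfolding first_diff_def by (auto simp: branch_def)

lemma colored_branch:
  assumes "m \<in> U" "q \<noteq> q0"
  shows "colored lex_funs (branch b m q) \<longleftrightarrow> col q"
proof -
  have last: "u \<in> U \<Longrightarrow> r m u \<Longrightarrow> branch b m q u = q0" for u
    using assms(1) U_asym U_irrefl unfolding branch_def by auto
  have "n \<in> U \<and> branch b m q n \<noteq> q0 \<and> (\<forall>u\<in>U. r n u \<longrightarrow> branch b m q u = q0) \<longleftrightarrow> n = m" for n
    using last U_total[OF _ assms(1)] assms branch_at by metis
  then have "colored lex_funs (branch b m q) \<longleftrightarrow> (\<exists>n. n = m \<and> col (branch b m q n))"
    unfolding lex_funs_def by (simp add: Bex_def) metis
  then show ?thesis using branch_at[OF assms(1)] by simp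
qed

lemma precedes_branch_iff:
  assumes "m \<in> U" "q \<in> Q" "q' \<in> Q"
  shows "precedes lex_funs (branch b m q) (branch b m q') \<longleftrightarrow> lq q q'"
proof (cases "q = q'")
  case True
  then show ?thesis using Q_irrefl assms by (auto simp: first_diff_def elim: precedes_lex_funsE)
next
  case False
  then have "first_diff (branch b m q) (branch b m q') m"
    using assms(1) branch_at[OF assms(1)] unfolding first_diff_def by (auto simp: branch_def)
  then show ?thesis using precedes_lex_funs_iff branch_at[OF assms(1)] by simp
qed

lemma inj_branch: "m \<in> U \<Longrightarrow> inj (branch b m)"
  by (metis branch_at injI)

lemma
  shows ex_above: "a \<in> Q \<Longrightarrow> \<exists>q\<in>Q. lq a q \<and> col q = c \<and> q \<noteq> q0"
    and ex_below: "a \<in> Q \<Longrightarrow> \<exists>q\<in>Q. lq q a \<and> col q = c \<and> q \<noteq> q0"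
    and ex_between: "a \<in> Q \<Longrightarrow> b \<in> Q \<Longrightarrow> lq a b \<Longrightarrow> \<exists>q\<in>Q. lq a q \<and> lq q b \<and> col q = c \<and> q \<noteq> q0"
proof -
  have above: "\<exists>q\<in>Q. lq a q" and below: "\<exists>q\<in>Q. lq q a" if "a \<in> Q" for a
    using Q_dense that unfolding densely_colored_def by blast+
  have between: "\<exists>q\<in>Q. lq a q \<and> lq q b \<and> col q = c" if "a \<in> Q" "b \<in> Q" "lq a b" for a b
    using Q_dense that unfolding densely_colored_def by blast
  have avoiding: "\<exists>q\<in>Q. lq a q \<and> lq q b \<and> col q = c \<and> q \<noteq> q0"
    if ab: "a \<in> Q" "b \<in> Q" "lq a b" for a b
  proof -
    obtain q where q: "q \<in> Q" "lq a q" "lq q b" "col q = c" using between[OF ab] by blast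
    obtain q' where q': "q' \<in> Q" "lq a q'" "lq q' q" "col q' = c"
      using between[OF ab(1) q(1,2)] by blast
    have "lq q' b" "q' \<noteq> q"
      using Q_trans[OF q'(1) q(1) ab(2) q'(3) q(3)] q'(3) Q_irrefl[OF q(1)] by auto
    then show ?thesis using q q' by metis
  qed
  show "a \<in> Q \<Longrightarrow> b \<in> Q \<Longrightarrow> lq a b \<Longrightarrow> \<exists>q\<in>Q. lq a q \<and> lq q b \<and> col q = c \<and> q \<noteq> q0" by (rule avoiding)
  show "a \<in> Q \<Longrightarrow> \<exists>q\<in>Q. lq a q \<and> col q = c \<and> q \<noteq> q0" using above avoiding by blast
  show "a \<in> Q \<Longrightarrow> \<exists>q\<in>Q. lq q a \<and> col q = c \<and> q \<noteq> q0" using below avoiding by blast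
qed

lemma rich_lex_funs: "rich U lex_funs"
  unfolding rich_def points_lex_funs
proof (intro conjI ballI allI impI)
  have "(\<lambda>_. q0) \<in> fin_funs" using q0_in unfolding fin_funs_def by auto
  then show "fin_funs \<noteq> {}" by blast
  show "U \<noteq> {}" by (rule U_nonempty)
next
  fix b m c assume b: "b \<in> fin_funs" and m: "m \<in> U"
  obtain q where q: "q \<in> Q" "lq (b m) q" "col q = c" "q \<noteq> q0"
    using ex_above fin_funs_in[OF b m] by blast
  then have d: "first_diff b (branch b m q) m" using first_diff_branch[OF m] Q_irrefl by metis
  show "\<exists>z\<in>fin_funs. precedes lex_funs b z \<and> closeness lex_funs b z = m \<and> colored lex_funs z = c"
    using branch_in[OF b m q(1)] precedes_lex_funs_iff[OF d] closeness_lex_funs[OF d]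
      colored_branch[OF m q(4)] branch_at[OF m] q by (intro bexI[of _ "branch b m q"]) auto
  obtain q where q: "q \<in> Q" "lq q (b m)" "col q = c" "q \<noteq> q0"
    using ex_below fin_funs_in[OF b m] by blast
  then have d: "first_diff b (branch b m q) m" using first_diff_branch[OF m] Q_irrefl by metis
  show "\<exists>z\<in>fin_funs. precedes lex_funs z b \<and> closeness lex_funs b z = m \<and> colored lex_funs z = c"
    using branch_in[OF b m q(1)] precedes_lex_funs_iff[OF d[unfolded first_diff_sym[of b]]]
      closeness_lex_funs[OF d] colored_branch[OF m q(4)] branch_at[OF m] q
    by (intro bexI[of _ "branch b m q"]) auto
next
  fix b b' c assume b: "b \<in> fin_funs" "b' \<in> fin_funs" and "precedes lex_funs b b'"
  then obtain m where m: "first_diff b b' m" "lq (b m) (b' m)" by (elim precedes_lex_funsE)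
  have mU: "m \<in> U" using m(1) first_diff_in by blast
  obtain q where q: "q \<in> Q" "lq (b m) q" "lq q (b' m)" "col q = c" "q \<noteq> q0"
    using ex_between[OF fin_funs_in[OF b(1) mU] fin_funs_in[OF b(2) mU] m(2)] by blast
  then have ne: "q \<noteq> b m" "q \<noteq> b' m" using Q_irrefl by metis+
  have d: "first_diff b (branch b m q) m" by (rule first_diff_branch[where b = b, OF mU ne(1)])
  have d': "first_diff (branch b m q) b' m"
    using m(1) ne(2) branch_at[OF mU] unfolding first_diff_def branch_def by auto
  show "\<exists>z\<in>fin_funs. precedes lex_funs b z \<and> precedes lex_funs z b' \<and>
      closeness lex_funs b z = closeness lex_funs b b' \<and>
      closeness lex_funs b' z = closeness lex_funs b b' \<and> colored lex_funs z = c"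
    using branch_in[OF b(1) mU q(1)] precedes_lex_funs_iff[OF d] precedes_lex_funs_iff[OF d']
      closeness_lex_funs[OF d] closeness_lex_funs[OF d'[unfolded first_diff_sym[of _ b']]]
      closeness_lex_funs[OF m(1)] colored_branch[OF mU q(5)] branch_at[OF mU] q
    by (intro bexI[of _ "branch b m q"]) auto
qed

lemma card_of_fin_funs:
  assumes "infinite (U \<times> Q)"
  shows "|fin_funs| \<le>o |U \<times> Q|"
proof -
  have "fin_funs \<lesssim> Fpow (U \<times> Q)" unfolding fin_funs_def by (rule lepoll_restricted_funspace)
  then have "|fin_funs| \<le>o |Fpow (U \<times> Q)|" unfolding lepoll_def card_of_ordLeq .
  also have "|Fpow (U \<times> Q)| =o |U \<times> Q|" by (rule card_of_Fpow_infinite[OF assms])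
  finally show ?thesis .
qed

end

section \<open>A dense coloring of the rationals\<close>

definition odd_denom :: "rat \<Rightarrow> bool" where
  "odd_denom q \<longleftrightarrow> (\<exists>k n :: int. odd n \<and> q = of_int k / of_int n)"

lemma odd_denom_diff:
  assumes "odd_denom p" "odd_denom q"
  shows "odd_denom (p - q)"
proof -
  obtain k n k' n' :: int where "odd n" "odd n'"
    and [simp]: "p = of_int k / of_int n" "q = of_int k' / of_int n'"
    using assms unfolding odd_denom_def by blast
  then have "n \<noteq> 0" "n' \<noteq> 0" by auto
  then have "p - q = of_int (k * n' - k' * n) / of_int (n * n')" by (simp add: diff_frac_eq)
  moreover have "odd (n * n')" using \<open>odd n\<close> \<open>odd n'\<close> by simp
  ultimately show ?thesis unfolding odd_denom_def by blast
qed

lemma not_odd_denom_half: "\<not> odd_denom (1 / 2)"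
proof
  assume "odd_denom (1 / 2)"
  then obtain k n :: int where "odd n" "(1 / 2 :: rat) = of_int k / of_int n"
    unfolding odd_denom_def by blast
  then have "(of_int n :: rat) = of_int (2 * k)" by (auto simp: field_simps)
  then show False using \<open>odd n\<close> by (simp only: of_int_eq_iff) simp
qed

lemma ex_odd_denom_between:
  fixes r s :: rat
  assumes "r < s"
  shows "\<exists>q. r < q \<and> q < s \<and> odd_denom q"
proof -
  obtain j :: nat where j: "1 / (s - r) < of_nat j" using reals_Archimedean2 by blast
  define n where "n = 2 * int j + 1"
  define k where "k = \<lfloor>r * of_int n\<rfloor> + 1"
  have n: "odd n" "0 < (of_int n :: rat)" by (simp_all add: n_def)
  have "1 / (s - r) < of_int n" using j by (simp add: n_def)
  then have "1 < (s - r) * of_int n" using assms by (simp add: divide_less_eq mult.commute)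
  moreover have "r * of_int n < of_int k" "of_int k \<le> r * of_int n + 1" unfolding k_def by linarith+
  ultimately have "r < of_int k / of_int n" "of_int k / of_int n < s"
    using n(2) by (simp_all add: field_simps)
  then show ?thesis using n(1) unfolding odd_denom_def by blast
qed

text \<open>Translation by \<open>1 / 2\<close> takes the subgroup of rationals with an odd denominator into its
  complement.\<close>

lemma ex_odd_denom_eq_between:
  assumes "r < s"
  shows "\<exists>q. r < q \<and> q < s \<and> odd_denom q = c"
proof (cases c)
  case True
  then show ?thesis using ex_odd_denom_between[OF assms] by simp
next
  case False
  obtain q where q: "r < q + 1 / 2" "q + 1 / 2 < s" "odd_denom q"
    using ex_odd_denom_between[of "r - 1 / 2" "s - 1 / 2"] assms by (auto simp: algebra_simps)
  then have "\<not> odd_denom (q + 1 / 2)"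
    using odd_denom_diff[of "q + 1 / 2" q] not_odd_denom_half by auto
  then show ?thesis using q(1,2) False by blast
qed

definition rat_lex :: "('l \<Rightarrow> 'l \<Rightarrow> bool) \<Rightarrow> 'l \<times> rat \<Rightarrow> 'l \<times> rat \<Rightarrow> bool" where
  "rat_lex R = (\<lambda>(l, s) (l', s'). R l l' \<or> l = l' \<and> s < s')"

lemma rat_lex_simp [simp]: "rat_lex R (l, s) (l', s') \<longleftrightarrow> R l l' \<or> l = l' \<and> s < s'"
  by (simp add: rat_lex_def)

lemma strict_linorder_on_rat_lex:
  assumes R: "strict_linorder_on L R"
  shows "strict_linorder_on (L \<times> UNIV) (rat_lex R)"
proof (rule strict_linorder_onI)
  show "\<not> rat_lex R p p" if "p \<in> L \<times> UNIV" for p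
    using that strict_linorder_on_irrefl[OF R] by auto
  show "rat_lex R p p''"
    if "p \<in> L \<times> UNIV" "p' \<in> L \<times> UNIV" "p'' \<in> L \<times> UNIV" "rat_lex R p p'" "rat_lex R p' p''"
    for p p' p''
    using that strict_linorder_on_trans[OF R, of "fst p" "fst p'" "fst p''"] by auto
  show "rat_lex R p p' \<or> rat_lex R p' p" if "p \<in> L \<times> UNIV" "p' \<in> L \<times> UNIV" "p \<noteq> p'" for p p'
    using that strict_linorder_on_total[OF R, of "fst p" "fst p'"]
    by (cases "fst p = fst p'") auto
qed

lemma densely_colored_rat_lex: "densely_colored (L \<times> UNIV) (rat_lex R) (odd_denom \<circ> snd)"
  unfolding densely_colored_def
proof (intro conjI ballI allI impI)
  fix p c assume "p \<in> L \<times> (UNIV :: rat set)"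
  then obtain l s where p: "p = (l, s)" "l \<in> L" by auto
  obtain q where "s < q" "odd_denom q = c" using ex_odd_denom_eq_between[of s "s + 1"] by auto
  then show "\<exists>q\<in>L \<times> UNIV. rat_lex R p q \<and> (odd_denom \<circ> snd) q = c"
    using p by (intro bexI[of _ "(l, q)"]) auto
  obtain q where "q < s" "odd_denom q = c" using ex_odd_denom_eq_between[of "s - 1" s] by auto
  then show "\<exists>q\<in>L \<times> UNIV. rat_lex R q p \<and> (odd_denom \<circ> snd) q = c"
    using p by (intro bexI[of _ "(l, q)"]) auto
next
  fix p p' c
  assume "p \<in> L \<times> (UNIV :: rat set)" "p' \<in> L \<times> (UNIV :: rat set)" and lt: "rat_lex R p p'"
  then obtain l s l' s' where p: "p = (l, s)" "l \<in> L" "p' = (l', s')" "l' \<in> L" by auto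
  obtain t where t: "s < t" "R l l' \<or> t \<le> s'"
    using lt p by (cases "R l l'") (auto intro: that[of "s + 1"])
  obtain q where "s < q" "q < t" "odd_denom q = c" using ex_odd_denom_eq_between[OF t(1)] by blast
  then show "\<exists>q\<in>L \<times> UNIV. rat_lex R p q \<and> rat_lex R q p' \<and> (odd_denom \<circ> snd) q = c"
    using p t(2) lt by (intro bexI[of _ "(l, q)"]) auto
qed

section \<open>The main theorem\<close>

lemma rich_space_copy:
  assumes S: "convex_ultrametric U r S" "rich U S" and g: "bij_betw g (points S) B"
  shows "\<exists>T. points T = B \<and> convex_ultrametric U r T \<and> rich U T \<and> colored_iso (\<lambda>u. u) g S T"
proof -
  let ?k = "inv_into (points S) g"
  define T where "T = \<lparr>points = B, precedes = (\<lambda>a b. precedes S (?k a) (?k b)),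
    closeness = (\<lambda>a b. closeness S (?k a) (?k b)), colored = (\<lambda>a. colored S (?k a))\<rparr>"
  have iso: "colored_iso (\<lambda>u. u) g S T"
    using g bij_betw_inv_into_left[OF g] unfolding colored_iso_def T_def by simp
  have "convex_ultrametric U r T"
    using convex_ultrametric_iso[OF S(1) _ iso] by (simp add: order_iso_def bij_betw_def)
  moreover have "rich U T" using rich_iso[OF S(1) _ iso S(2)] by (simp add: bij_betw_def)
  ultimately show ?thesis using iso by (intro exI[of _ T]) (simp add: T_def)
qed

lemma (in lex_space) card_of_fin_funs_ordIso:
  assumes "|U \<times> Q| \<le>o |L|" "infinite (U \<times> Q)" "inj_on e L" "e ` L \<subseteq> fin_funs"
  shows "|fin_funs| =o |L|"
proof (rule ordIso_iff_ordLeq[THEN iffD2, OF conjI])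
  show "|fin_funs| \<le>o |L|" by (rule ordLeq_transitive[OF card_of_fin_funs[OF assms(2)] assms(1)])
  show "|L| \<le>o |fin_funs|" using assms(3,4) card_of_ordLeq by blast
qed

lemma card_of_Times_rat:
  assumes "|U| \<le>o |L|" "infinite L"
  shows "|U \<times> (L \<times> (UNIV :: rat set))| \<le>o |L|"
proof -
  have "|UNIV :: rat set| \<le>o |L|"
    using infinite_iff_card_of_countable[of "UNIV :: rat set" L] assms(2) infinite_UNIV_char_0
    by auto
  then show ?thesis using assms by (intro card_of_Times_ordLeq_infinite) simp_all
qed

lemma aleph1_ordLeq_imp_infinite:
  assumes "aleph1 \<le>o |L|"
  shows "infinite L"
  using ordLeq_transitive[OF cardSuc_ordLeq[OF natLeq_Card_order] assms]
    infinite_iff_natLeq_ordLeq[of L] by blast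

lemma ex_rich_space:
  fixes U :: "'u set" and L :: "'l set"
  assumes U: "strict_linorder_on U r" "U \<noteq> {}" "|U| \<le>o |L|"
    and L: "strict_linorder_on L ltL" "infinite L"
  obtains S :: "('l, 'u) colored_space" and e :: "'l \<Rightarrow> 'l"
  where "points S = L" "convex_ultrametric U r S" "rich U S" "inj_on e L" "e ` L \<subseteq> L"
    "\<And>x y. x \<in> L \<Longrightarrow> y \<in> L \<Longrightarrow> ltL x y \<longleftrightarrow> precedes S (e x) (e y)"
    "\<And>x. x \<in> L \<Longrightarrow> \<not> colored S (e x)"
proof -
  obtain l0 m0 where "l0 \<in> L" "m0 \<in> U" using L(2) U(2) by fastforce
  interpret lex_space U r "L \<times> UNIV" "rat_lex ltL" "odd_denom \<circ> snd" "(l0, 0)"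
    by unfold_locales
      (use U L \<open>l0 \<in> L\<close> strict_linorder_on_rat_lex densely_colored_rat_lex in auto)
  obtain s0 where s0: "\<not> odd_denom s0" "s0 \<noteq> 0" using ex_odd_denom_eq_between[of 0 1 False] by auto
  define e where "e l = branch (\<lambda>_. (l0, 0)) m0 (l, s0)" for l
  have "(\<lambda>_. (l0, 0)) \<in> fin_funs" using \<open>l0 \<in> L\<close> unfolding fin_funs_def by auto
  then have e_in: "e ` L \<subseteq> fin_funs" using branch_in \<open>m0 \<in> U\<close> unfolding e_def by auto
  have e_inj: "inj_on e L"
    using inj_branch[OF \<open>m0 \<in> U\<close>] unfolding e_def by (auto intro!: inj_onI dest: injD)
  have "infinite (U \<times> (L \<times> (UNIV :: rat set)))"
    using U(2) L(2) by (auto simp: finite_cartesian_product_iff)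
  then have "|fin_funs| =o |L|"
    by (rule card_of_fin_funs_ordIso[OF card_of_Times_rat[OF U(3) L(2)] _ e_inj e_in])
  then obtain g where g: "bij_betw g fin_funs L" using card_of_ordIso by blast
  then obtain S where S: "points S = L" "convex_ultrametric U r S" "rich U S"
    and iso: "colored_iso (\<lambda>u. u) g lex_funs S"
    using rich_space_copy[OF convex_ultrametric_lex_funs rich_lex_funs] points_lex_funs by metis
  show thesis
  proof (rule that[OF S])
    show "inj_on (g \<circ> e) L"
      using comp_inj_on[OF e_inj] inj_on_subset[OF bij_betw_imp_inj_on[OF g] e_in] by blast
    show "(g \<circ> e) ` L \<subseteq> L" using e_in g by (auto simp: bij_betw_def)
    show "ltL x y \<longleftrightarrow> precedes S ((g \<circ> e) x) ((g \<circ> e) y)" if "x \<in> L" "y \<in> L" for x y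
    proof -
      have "precedes S ((g \<circ> e) x) ((g \<circ> e) y) \<longleftrightarrow> precedes lex_funs (e x) (e y)"
        using colored_iso_precedes[OF iso] e_in that by (simp add: image_subset_iff)
      also have "\<dots> \<longleftrightarrow> ltL x y"
        using precedes_branch_iff[OF \<open>m0 \<in> U\<close>] that unfolding e_def by simp
      finally show ?thesis ..
    qed
    show "\<not> colored S ((g \<circ> e) x)" if "x \<in> L" for x
      using colored_iso_colored[OF iso, of "e x"] colored_branch[OF \<open>m0 \<in> U\<close>, of "(x, s0)"]
        s0 e_in that unfolding e_def by auto
  qed
qed

theorem theorem4p14:
  fixes L0 :: "('f, 'r) lang"
    and lt :: 'r
    and M :: "('m, 'f, 'r) struct"
    and \<phi> :: "('f, 'r) fm"
    and F :: "('m + nat, 'f, 'r) ext_struct"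
    and \<phi>F :: "('f ext_fun, 'r ext_rel) fm"
    and M1 :: "('b, 'f, 'r) struct"
    and L :: "'l set"
    and ltL :: "'l \<Rightarrow> 'l \<Rightarrow> bool"
  assumes "countable_lang L0"
    and "lt \<in> Rels L0" and "rarity L0 lt = 2"
    and "is_struct L0 M" and "countable (univ M)"
    and "strict_linorder_on (univ M) (\<lambda>x y. relI M lt [x, y])"
    and "scott_sentence L0 M \<phi>"
    and "\<exists>A :: (nat set, 'f, 'r) struct. is_model L0 A \<phi> \<and> |univ A| =o aleph1"
    and "\<not> (\<exists>A :: (nat set set, 'f, 'r) struct. is_model L0 A \<phi> \<and> |univ A| =o aleph2)"
    and "fraisse_limit L0 lt M F"
    and "scott_sentence (ext_lang L0) F \<phi>F"
    and "is_model L0 M1 \<phi>" and "|univ M1| =o aleph1"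
    and "strict_linorder_on L ltL" and "aleph1 \<le>o |L|"
  shows "\<exists>(G :: ('b + 'l, 'f, 'r) ext_struct) (emb :: 'l \<Rightarrow> 'b + 'l).
           is_model (ext_lang L0) G \<phi>F \<and>
           |univ G| =o |L| \<and>
           M_part_is L0 G M1 \<and>
           inj_on emb L \<and> emb ` L \<subseteq> V_part G \<and>
           (\<forall>x\<in>L. \<forall>y\<in>L. ltL x y \<longleftrightarrow> tri G (emb x) (emb y)) \<and>
           (\<forall>x\<in>L. zero_colored G (emb x))"
proof -
  interpret K_limit L0 lt M F by unfold_locales fact+
  have M1: "is_struct L0 M1" "univ M1 \<noteq> {}"
    using assms(12) by (auto simp: is_model_def is_struct_def)
  have linorder: "strict_linorder_on (univ M1) (binrel M1 lt)"
    by (rule scott_model_strict_linorder[OF assms(1,7,12,2,3,6)])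
  have card: "|univ M1| \<le>o |L|" "infinite L"
    using ordIso_ordLeq_trans[OF assms(13,15)] aleph1_ordLeq_imp_infinite[OF assms(15)] by blast+
  obtain S :: "('l, 'b) colored_space" and e
    where S: "points S = L" "convex_ultrametric (univ M1) (binrel M1 lt) S" "rich (univ M1) S"
      and e: "inj_on e L" "e ` L \<subseteq> L" "\<And>x. x \<in> L \<Longrightarrow> \<not> colored S (e x)"
        "\<And>x y. x \<in> L \<Longrightarrow> y \<in> L \<Longrightarrow> ltL x y \<longleftrightarrow> precedes S (e x) (e y)"
    using ex_rich_space[OF linorder M1(2) card(1) assms(14) card(2)] by metis
  let ?G = "sum_struct M1 S"
  have M1_part: "M_part_is L0 ?G M1" by (rule M_part_is_sum_struct[OF M1(1)])
  then have "is_model L0 (M_struct ?G) \<phi>"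
    using is_model_iso assms(7,12) unfolding M_part_is_def scott_sentence_def sentence_def by blast
  then have "is_model (ext_lang L0) ?G \<phi>F"
    using K_struct_sum_struct[OF M1(1) assms(2,3) S(2)] rich_sum_struct[OF S(2,3)]
    by (intro rich_imp_is_model[OF assms(1,7,11)])
  moreover have "|univ ?G| =o |L|"
    using card_of_Plus_infinite2[OF card(2,1)] S(1) by (simp add: Plus_def)
  moreover have "inj_on (Inr \<circ> e) L" using e(1) by (simp add: comp_inj_on)
  ultimately show ?thesis
    using M1_part e S(1) by (intro exI[of _ ?G] exI[of _ "Inr \<circ> e"]) (auto simp: zero_colored_def)
qed

end
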